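(* Let $K$ be a field and let $\mathcal{G}$ be a small groupoid with set of objects $\mathcal{G}_0$. Then the $K$-linearization $K[\mathcal{G}]$ is separable if and only if, for all $x,y\in\mathcal{G}_{0}$, $\mathcal{G}(x,y)$ is a finite set and $|\mathcal{G}(x,y)|$ is invertible in $K$.
   Context: Write $\mathcal{C}_0$ for the set of objects of a small category $\mathcal{C}$ and $\mathcal{C}(x,y)$ for $\mathrm{Hom}_{\mathcal{C}}(x,y)$. A groupoid is a category in which all morphisms are invertible. The $K$-linearization $K[\mathcal{A}]$ of a category $\mathcal{A}$ is the $K$-linear category with the same objects as $\mathcal{A}$, in which $K[\mathcal{A}](x,y)$ is the $K$-vector space with basis $\mathcal{A}(x,y)$, and whose composition is the unique bilinear extension of that of $\mathcal{A}$. A category is $K$-linear if each $\mathcal{C}(x,y)$ is a $K$-vector space and composition is $K$-bilinear; a functor between $K$-linear categories is $K$-linear if it is $K$-linear on each Hom space. Tensor products are over $K$. For a small $K$-linear category $\mathcal{C}$, $\mathcal{C}\boxtimes_K\mathcal{C}^{op}$ is the $K$-linear category whose objects are pairs $(x,y)\in\mathcal{C}_0\times\mathcal{C}_0$, with morphisms from $(x,y)$ to $(x',y')$ given by $\mathcal{C}(x,x')\otimes\mathcal{C}(y',y)$ and the evident composition. A $\mathcal{C}$-bimodule is a $K$-linear functor $M:\mathcal{C}\boxtimes_K\mathcal{C}^{op}\to K\text{-}\mathrm{Mod}$, with value ${}_xM_y$ at $(x,y)$; morphisms are natural transformations. The category of $\mathcal{C}$-bimodules is abelian with enough projectives and injectives.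 $\mathcal{C}$ itself is a bimodule by ${}_x\mathcal{C}_y=\mathcal{C}(y,x)$, with actions given by composition. Hochschild-Mitchell cohomology: $H^{n}(\mathcal{C},M):=\mathrm{Ext}^{n}_{\mathcal{C}-\mathcal{C}}(\mathcal{C},M)$, with $\mathrm{Ext}$ computed in the category of $\mathcal{C}$-bimodules. $\mathcal{C}$ is called separable if $H^{1}(\mathcal{C},M)=0$ for every $\mathcal{C}$-bimodule $M$.
   Formalization: The finiteness and invertibility condition is required only for x, y with G(x,y) nonempty; literally the claim fails for the discrete groupoid on two objects, which is separable although |G(x,y)| = 0 for x ≠ y. *)

theory Defs
  imports "HOL-Algebra.Algebra" "HOL-Library.Equipollence"
begin

section \<open>Small categories and groupoids\<close>

text \<open>
  Hom-sets are indexed by their endpoints and need not be disjoint, so composition carries the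
  three objects as arguments: \<open>Comp C x y z g f\<close> is \<open>g \<circ> f\<close> for \<open>f : x \<rightarrow> y\<close> and \<open>g : y \<rightarrow> z\<close>.
\<close>

record ('o, 'a) cat =
  Obj :: "'o set"
  Hom :: "'o \<Rightarrow> 'o \<Rightarrow> 'a set"
  Id :: "'o \<Rightarrow> 'a"
  Comp :: "'o \<Rightarrow> 'o \<Rightarrow> 'o \<Rightarrow> 'a \<Rightarrow> 'a \<Rightarrow> 'a"

locale small_category =
  fixes C :: "('o, 'a) cat"
  assumes Id_in: "x \<in> Obj C \<Longrightarrow> Id C x \<in> Hom C x x"
    and Comp_in: "\<lbrakk>x \<in> Obj C; y \<in> Obj C; z \<in> Obj C; f \<in> Hom C x y; g \<in> Hom C y z\<rbrakk>
      \<Longrightarrow> Comp C x y z g f \<in> Hom C x z"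
    and Comp_Id: "\<lbrakk>x \<in> Obj C; y \<in> Obj C; f \<in> Hom C x y\<rbrakk> \<Longrightarrow> Comp C x x y f (Id C x) = f"
    and Id_Comp: "\<lbrakk>x \<in> Obj C; y \<in> Obj C; f \<in> Hom C x y\<rbrakk> \<Longrightarrow> Comp C x y y (Id C y) f = f"
    and Comp_assoc: "\<lbrakk>w \<in> Obj C; x \<in> Obj C; y \<in> Obj C; z \<in> Obj C;
        f \<in> Hom C w x; g \<in> Hom C x y; h \<in> Hom C y z\<rbrakk>
      \<Longrightarrow> Comp C w y z h (Comp C w x y g f) = Comp C w x z (Comp C x y z h g) f"

locale small_groupoid = small_category G for G :: "('o, 'a) cat" +
  assumes invertible: "\<lbrakk>x \<in> Obj G; y \<in> Obj G; f \<in> Hom G x y\<rbrakk>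
    \<Longrightarrow> \<exists>g \<in> Hom G y x. Comp G x y x g f = Id G x \<and> Comp G y x y f g = Id G y"


section \<open>Linear maps, quotients, free modules and tensor products\<close>

text \<open>
  Over a field \<open>K\<close>, a vector space is a \<^locale>\<open>module\<close> over \<open>K\<close>. The record type of modules
  extends that of rings; the multiplicative fields are irrelevant for modules and are left
  \<^const>\<open>undefined\<close> in the constructions below.
\<close>

definition is_linear :: "('k, 'c) ring_scheme \<Rightarrow> ('k, 'v) module \<Rightarrow> ('k, 'w) module \<Rightarrow> ('v \<Rightarrow> 'w) \<Rightarrow> bool"
  where "is_linear K V W h \<longleftrightarrow>
    h \<in> carrier V \<rightarrow> carrier W \<and>
    (\<forall>u\<in>carrier V. \<forall>v\<in>carrier V. h (u \<oplus>\<^bsub>V\<^esub> v) = h u \<oplus>\<^bsub>W\<^esub> h v) \<and>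
    (\<forall>a\<in>carrier K. \<forall>v\<in>carrier V. h (a \<odot>\<^bsub>V\<^esub> v) = a \<odot>\<^bsub>W\<^esub> h v)"

text \<open>Linear maps are made extensional, so that equality of maps is equality in HOL.\<close>

definition hom_module :: "('k, 'c) ring_scheme \<Rightarrow> ('k, 'v) module \<Rightarrow> ('k, 'w) module \<Rightarrow> ('k, 'v \<Rightarrow> 'w) module"
  where "hom_module K V W =
    \<lparr>carrier = {h. is_linear K V W h \<and> h \<in> extensional (carrier V)},
     monoid.mult = undefined, one = undefined,
     ring.zero = (\<lambda>v\<in>carrier V. \<zero>\<^bsub>W\<^esub>),
     ring.add = (\<lambda>h h'. \<lambda>v\<in>carrier V. h v \<oplus>\<^bsub>W\<^esub> h' v),
     module.smult = (\<lambda>a h. \<lambda>v\<in>carrier V. a \<odot>\<^bsub>W\<^esub> h v)\<rparr>"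

definition quotient_module :: "('k, 'v) module \<Rightarrow> 'v set \<Rightarrow> ('k, 'v set) module"
  where "quotient_module V N =
    \<lparr>carrier = a_rcosets\<^bsub>V\<^esub> N,
     monoid.mult = undefined, one = undefined,
     ring.zero = N,
     ring.add = set_add V,
     module.smult = (\<lambda>a S. \<Union>v\<in>S. N +>\<^bsub>V\<^esub> a \<odot>\<^bsub>V\<^esub> v)\<rparr>"

text \<open>The vector space with basis \<open>B\<close>: finitely supported functions \<open>B \<rightarrow> K\<close>, extended by zero.\<close>

definition free_module :: "('k, 'c) ring_scheme \<Rightarrow> 'b set \<Rightarrow> ('k, 'b \<Rightarrow> 'k) module"
  where "free_module K B =
    \<lparr>carrier = {t. t \<in> UNIV \<rightarrow> carrier K \<and> {b. t b \<noteq> \<zero>\<^bsub>K\<^esub>} \<subseteq> B \<and> finite {b. t b \<noteq> \<zero>\<^bsub>K\<^esub>}},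
     monoid.mult = undefined, one = undefined,
     ring.zero = (\<lambda>_. \<zero>\<^bsub>K\<^esub>),
     ring.add = (\<lambda>s t b. s b \<oplus>\<^bsub>K\<^esub> t b),
     module.smult = (\<lambda>a t b. a \<otimes>\<^bsub>K\<^esub> t b)\<rparr>"

definition basis_elt :: "('k, 'c) ring_scheme \<Rightarrow> 'b \<Rightarrow> 'b \<Rightarrow> 'k"
  where "basis_elt K b = (\<lambda>b'. if b' = b then \<one>\<^bsub>K\<^esub> else \<zero>\<^bsub>K\<^esub>)"

text \<open>The linear extension of \<open>\<phi> : B \<rightarrow> V\<close> to the vector space with basis \<open>B\<close>.\<close>

definition free_lift :: "('k, 'c) ring_scheme \<Rightarrow> ('k, 'v) module \<Rightarrow> ('b \<Rightarrow> 'v) \<Rightarrow> ('b \<Rightarrow> 'k) \<Rightarrow> 'v"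
  where "free_lift K V \<phi> t = (\<Oplus>\<^bsub>V\<^esub>b\<in>{b. t b \<noteq> \<zero>\<^bsub>K\<^esub>}. t b \<odot>\<^bsub>V\<^esub> \<phi> b)"

definition tensor_relations ::
    "('k, 'c) ring_scheme \<Rightarrow> ('k, 'v) module \<Rightarrow> ('k, 'w) module \<Rightarrow> ('v \<times> 'w \<Rightarrow> 'k) set"
  where "tensor_relations K V W =
    (let F = free_module K (carrier V \<times> carrier W) in
      {basis_elt K (v \<oplus>\<^bsub>V\<^esub> v', w) \<ominus>\<^bsub>F\<^esub> (basis_elt K (v, w) \<oplus>\<^bsub>F\<^esub> basis_elt K (v', w)) | v v' w.
         v \<in> carrier V \<and> v' \<in> carrier V \<and> w \<in> carrier W} \<union>
      {basis_elt K (v, w \<oplus>\<^bsub>W\<^esub> w') \<ominus>\<^bsub>F\<^esub> (basis_elt K (v, w) \<oplus>\<^bsub>F\<^esub> basis_elt K (v, w')) | v w w'.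
         v \<in> carrier V \<and> w \<in> carrier W \<and> w' \<in> carrier W} \<union>
      {basis_elt K (a \<odot>\<^bsub>V\<^esub> v, w) \<ominus>\<^bsub>F\<^esub> a \<odot>\<^bsub>F\<^esub> basis_elt K (v, w) | a v w.
         a \<in> carrier K \<and> v \<in> carrier V \<and> w \<in> carrier W} \<union>
      {basis_elt K (v, a \<odot>\<^bsub>W\<^esub> w) \<ominus>\<^bsub>F\<^esub> a \<odot>\<^bsub>F\<^esub> basis_elt K (v, w) | a v w.
         a \<in> carrier K \<and> v \<in> carrier V \<and> w \<in> carrier W})"

definition tensor_kernel ::
    "('k, 'c) ring_scheme \<Rightarrow> ('k, 'v) module \<Rightarrow> ('k, 'w) module \<Rightarrow> ('v \<times> 'w \<Rightarrow> 'k) set"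
  where "tensor_kernel K V W =
    (\<lambda>N. submodule N K (free_module K (carrier V \<times> carrier W))) hull tensor_relations K V W"

definition tensor_module ::
    "('k, 'c) ring_scheme \<Rightarrow> ('k, 'v) module \<Rightarrow> ('k, 'w) module \<Rightarrow> ('k, ('v \<times> 'w \<Rightarrow> 'k) set) module"
  where "tensor_module K V W =
    quotient_module (free_module K (carrier V \<times> carrier W)) (tensor_kernel K V W)"

definition tensor ::
    "('k, 'c) ring_scheme \<Rightarrow> ('k, 'v) module \<Rightarrow> ('k, 'w) module \<Rightarrow> 'v \<Rightarrow> 'w \<Rightarrow> ('v \<times> 'w \<Rightarrow> 'k) set"
  where "tensor K V W v w =
    tensor_kernel K V W +>\<^bsub>free_module K (carrier V \<times> carrier W)\<^esub> basis_elt K (v, w)"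

text \<open>
  For bilinear \<open>\<phi> : V \<times> W \<rightarrow> U\<close>, the linear extension \<open>free_lift K U \<phi>\<close> is constant on every
  element \<open>T\<close> of the tensor product (a coset); its value there is the image of \<open>T\<close> under the
  linear map with \<open>v \<otimes> w \<mapsto> \<phi> (v, w)\<close>.
\<close>

definition tensor_lift ::
    "('k, 'c) ring_scheme \<Rightarrow> ('k, 'u) module \<Rightarrow> ('v \<times> 'w \<Rightarrow> 'u) \<Rightarrow> ('v \<times> 'w \<Rightarrow> 'k) set \<Rightarrow> 'u"
  where "tensor_lift K U \<phi> T = the_elem (free_lift K U \<phi> ` T)"


section \<open>Linear categories and linear functors\<close>

record ('k, 'o, 'v) lincat =
  LObj :: "'o set"
  LHom :: "'o \<Rightarrow> 'o \<Rightarrow> ('k, 'v) module"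
  LId :: "'o \<Rightarrow> 'v"
  LComp :: "'o \<Rightarrow> 'o \<Rightarrow> 'o \<Rightarrow> 'v \<Rightarrow> 'v \<Rightarrow> 'v"

definition underlying_cat :: "('k, 'o, 'v) lincat \<Rightarrow> ('o, 'v) cat"
  where "underlying_cat C =
    \<lparr>Obj = LObj C, Hom = (\<lambda>x y. carrier (LHom C x y)), Id = LId C, Comp = LComp C\<rparr>"

definition linear_category :: "('k, 'c) ring_scheme \<Rightarrow> ('k, 'o, 'v) lincat \<Rightarrow> bool"
  where "linear_category K C \<longleftrightarrow>
    field K \<and> small_category (underlying_cat C) \<and>
    (\<forall>x\<in>LObj C. \<forall>y\<in>LObj C. module K (LHom C x y)) \<and>
    (\<forall>x\<in>LObj C. \<forall>y\<in>LObj C. \<forall>z\<in>LObj C.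
      (\<forall>f\<in>carrier (LHom C x y). is_linear K (LHom C y z) (LHom C x z) (\<lambda>g. LComp C x y z g f)) \<and>
      (\<forall>g\<in>carrier (LHom C y z). is_linear K (LHom C x y) (LHom C x z) (\<lambda>f. LComp C x y z g f)))"

text \<open>The vector spaces whose elements are drawn from the type \<open>'m\<close>, with the linear maps.\<close>

definition Kmod :: "('k, 'c) ring_scheme \<Rightarrow> ('k, ('k, 'm) module, 'm \<Rightarrow> 'm) lincat"
  where "Kmod K =
    \<lparr>LObj = {V. module K V},
     LHom = hom_module K,
     LId = (\<lambda>V. \<lambda>v\<in>carrier V. v),
     LComp = (\<lambda>U V W g f. compose (carrier U) g f)\<rparr>"

text \<open>The linearization \<open>K[A]\<close>; composition is the bilinear extension of that of \<open>A\<close>.\<close>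

definition linearization :: "('k, 'c) ring_scheme \<Rightarrow> ('o, 'a) cat \<Rightarrow> ('k, 'o, 'a \<Rightarrow> 'k) lincat"
  where "linearization K A =
    \<lparr>LObj = Obj A,
     LHom = (\<lambda>x y. free_module K (Hom A x y)),
     LId = (\<lambda>x. basis_elt K (Id A x)),
     LComp = (\<lambda>x y z t s.
       let V = free_module K (Hom A x z) in
       free_lift K V (\<lambda>g. free_lift K V (\<lambda>f. basis_elt K (Comp A x y z g f)) s) t)\<rparr>"

text \<open>
  The linear category \<open>C \<boxtimes> C\<^sup>o\<^sup>p\<close>. A morphism \<open>f \<otimes> g : (x, y) \<rightarrow> (x', y')\<close> has \<open>f : x \<rightarrow> x'\<close> and
  \<open>g : y' \<rightarrow> y\<close> in \<open>C\<close>, and \<open>(f' \<otimes> g') \<circ> (f \<otimes> g) = (f' \<circ> f) \<otimes> (g \<circ> g')\<close>.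
\<close>

definition enveloping :: "('k, 'c) ring_scheme \<Rightarrow> ('k, 'o, 'v) lincat \<Rightarrow>
    ('k, 'o \<times> 'o, ('v \<times> 'v \<Rightarrow> 'k) set) lincat"
  where "enveloping K C =
    \<lparr>LObj = LObj C \<times> LObj C,
     LHom = (\<lambda>(x, y) (x', y'). tensor_module K (LHom C x x') (LHom C y' y)),
     LId = (\<lambda>(x, y). tensor K (LHom C x x) (LHom C y y) (LId C x) (LId C y)),
     LComp = (\<lambda>(x, y) (x', y') (x'', y'') S T.
       let V = LHom C x x''; W = LHom C y'' y; U = tensor_module K V W in
       tensor_lift K U (\<lambda>(f', g').
         tensor_lift K U (\<lambda>(f, g).
           tensor K V W (LComp C x x' x'' f' f) (LComp C y'' y' y g g')) T) S)\<rparr>"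

record ('o, 'v, 'p, 'w) fctr =
  FObj :: "'o \<Rightarrow> 'p"
  FMor :: "'o \<Rightarrow> 'o \<Rightarrow> 'v \<Rightarrow> 'w"

definition linear_functor :: "('k, 'c) ring_scheme \<Rightarrow> ('k, 'o, 'v) lincat \<Rightarrow> ('k, 'p, 'w) lincat \<Rightarrow>
    ('o, 'v, 'p, 'w) fctr \<Rightarrow> bool"
  where "linear_functor K C D F \<longleftrightarrow>
    FObj F \<in> LObj C \<rightarrow> LObj D \<and>
    (\<forall>x\<in>LObj C. \<forall>y\<in>LObj C. is_linear K (LHom C x y) (LHom D (FObj F x) (FObj F y)) (FMor F x y)) \<and>
    (\<forall>x\<in>LObj C. FMor F x x (LId C x) = LId D (FObj F x)) \<and>
    (\<forall>x\<in>LObj C. \<forall>y\<in>LObj C. \<forall>z\<in>LObj C.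
      \<forall>f\<in>carrier (LHom C x y). \<forall>g\<in>carrier (LHom C y z).
        FMor F x z (LComp C x y z g f) =
        LComp D (FObj F x) (FObj F y) (FObj F z) (FMor F y z g) (FMor F x y f))"


section \<open>Modules over a linear category and Ext\<close>

text \<open>
  A linear functor from a linear category \<open>D\<close> to \<^term>\<open>Kmod K\<close> is called a \<open>D\<close>-module. Natural
  transformations are also formed between \<open>D\<close>-modules with values in different types \<open>'m\<close>, \<open>'n\<close>.
\<close>

type_synonym ('k, 'o, 'v, 'm) dmod = "('o, 'v, ('k, 'm) module, 'm \<Rightarrow> 'm) fctr"

abbreviation is_dmod :: "('k, 'c) ring_scheme \<Rightarrow> ('k, 'o, 'v) lincat \<Rightarrow> ('k, 'o, 'v, 'm) dmod \<Rightarrow> bool"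
  where "is_dmod K D M \<equiv> linear_functor K D (Kmod K) M"

definition nat_trans :: "('k, 'c) ring_scheme \<Rightarrow> ('k, 'o, 'v) lincat \<Rightarrow>
    ('k, 'o, 'v, 'm) dmod \<Rightarrow> ('k, 'o, 'v, 'n) dmod \<Rightarrow> ('o \<Rightarrow> 'm \<Rightarrow> 'n) set"
  where "nat_trans K D M N =
    {\<tau> \<in> (\<Pi>\<^sub>E x\<in>LObj D. carrier (hom_module K (FObj M x) (FObj N x))).
      \<forall>x\<in>LObj D. \<forall>y\<in>LObj D. \<forall>f\<in>carrier (LHom D x y).
        compose (carrier (FObj M x)) (\<tau> y) (FMor M x y f) =
        compose (carrier (FObj M x)) (FMor N x y f) (\<tau> x)}"

definition nat_trans_module :: "('k, 'c) ring_scheme \<Rightarrow> ('k, 'o, 'v) lincat \<Rightarrow>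
    ('k, 'o, 'v, 'm) dmod \<Rightarrow> ('k, 'o, 'v, 'n) dmod \<Rightarrow> ('k, 'o \<Rightarrow> 'm \<Rightarrow> 'n) module"
  where "nat_trans_module K D M N =
    \<lparr>carrier = nat_trans K D M N,
     monoid.mult = undefined, one = undefined,
     ring.zero = (\<lambda>x\<in>LObj D. \<zero>\<^bsub>hom_module K (FObj M x) (FObj N x)\<^esub>),
     ring.add = (\<lambda>\<sigma> \<tau>. \<lambda>x\<in>LObj D. \<sigma> x \<oplus>\<^bsub>hom_module K (FObj M x) (FObj N x)\<^esub> \<tau> x),
     module.smult = (\<lambda>a \<tau>. \<lambda>x\<in>LObj D. a \<odot>\<^bsub>hom_module K (FObj M x) (FObj N x)\<^esub> \<tau> x)\<rparr>"

text \<open>\<open>nat_comp D M \<tau> \<sigma>\<close> is \<open>\<tau> \<circ> \<sigma>\<close>, where \<open>M\<close> is the source of \<open>\<sigma>\<close>.\<close>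

definition nat_comp :: "('k, 'o, 'v) lincat \<Rightarrow> ('k, 'o, 'v, 'm) dmod \<Rightarrow>
    ('o \<Rightarrow> 'n \<Rightarrow> 'p) \<Rightarrow> ('o \<Rightarrow> 'm \<Rightarrow> 'n) \<Rightarrow> 'o \<Rightarrow> 'm \<Rightarrow> 'p"
  where "nat_comp D M \<tau> \<sigma> = (\<lambda>x\<in>LObj D. compose (carrier (FObj M x)) (\<tau> x) (\<sigma> x))"

text \<open>
  Kernels, images and exactness in the abelian category of \<open>D\<close>-modules are computed objectwise;
  in particular the epimorphisms are the objectwise surjective natural transformations.
\<close>

definition dmod_epi :: "('k, 'o, 'v) lincat \<Rightarrow> ('k, 'o, 'v, 'm) dmod \<Rightarrow> ('k, 'o, 'v, 'n) dmod \<Rightarrow>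
    ('o \<Rightarrow> 'm \<Rightarrow> 'n) \<Rightarrow> bool"
  where "dmod_epi D M N \<tau> \<longleftrightarrow> (\<forall>x\<in>LObj D. \<tau> x ` carrier (FObj M x) = carrier (FObj N x))"

definition exact_at :: "('k, 'o, 'v) lincat \<Rightarrow> ('k, 'o, 'v, 'l) dmod \<Rightarrow> ('o \<Rightarrow> 'l \<Rightarrow> 'm) \<Rightarrow>
    ('k, 'o, 'v, 'm) dmod \<Rightarrow> ('o \<Rightarrow> 'm \<Rightarrow> 'n) \<Rightarrow> ('k, 'o, 'v, 'n) dmod \<Rightarrow> bool"
  where "exact_at D L \<sigma> M \<tau> N \<longleftrightarrow>
    (\<forall>x\<in>LObj D. \<sigma> x ` carrier (FObj L x) = {m \<in> carrier (FObj M x). \<tau> x m = \<zero>\<^bsub>FObj N x\<^esub>})"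

definition projective_dmod :: "('k, 'c) ring_scheme \<Rightarrow> ('k, 'o, 'v) lincat \<Rightarrow> ('k, 'o, 'v, 'm) dmod \<Rightarrow> bool"
  where "projective_dmod K D P \<longleftrightarrow> is_dmod K D P \<and>
    (\<forall>(M :: ('k, 'o, 'v, 'm) dmod) (N :: ('k, 'o, 'v, 'm) dmod). \<forall>\<pi> \<phi>.
      is_dmod K D M \<and> is_dmod K D N \<and> \<pi> \<in> nat_trans K D M N \<and> dmod_epi D M N \<pi> \<and>
      \<phi> \<in> nat_trans K D P N \<longrightarrow>
      (\<exists>\<psi> \<in> nat_trans K D P M. nat_comp D P \<pi> \<psi> = \<phi>))"

text \<open>
  A projective resolution \<open>\<dots> \<rightarrow> P 2 \<rightarrow> P 1 \<rightarrow> P 0 \<rightarrow> A \<rightarrow> 0\<close> with differentials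
  \<open>rdiff n : P (n + 1) \<rightarrow> P n\<close> and augmentation \<open>P 0 \<rightarrow> A\<close>.
\<close>

record ('k, 'o, 'v, 'm, 'n) resolution =
  rterm :: "nat \<Rightarrow> ('k, 'o, 'v, 'm) dmod"
  rdiff :: "nat \<Rightarrow> 'o \<Rightarrow> 'm \<Rightarrow> 'm"
  raug :: "'o \<Rightarrow> 'm \<Rightarrow> 'n"

definition projective_resolution :: "('k, 'c) ring_scheme \<Rightarrow> ('k, 'o, 'v) lincat \<Rightarrow>
    ('k, 'o, 'v, 'n) dmod \<Rightarrow> ('k, 'o, 'v, 'm, 'n) resolution \<Rightarrow> bool"
  where "projective_resolution K D A R \<longleftrightarrow>
    (\<forall>n. projective_dmod K D (rterm R n)) \<and>
    (\<forall>n. rdiff R n \<in> nat_trans K D (rterm R (Suc n)) (rterm R n)) \<and>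
    raug R \<in> nat_trans K D (rterm R 0) A \<and>
    dmod_epi D (rterm R 0) A (raug R) \<and>
    exact_at D (rterm R 1) (rdiff R 0) (rterm R 0) (raug R) A \<and>
    (\<forall>n. exact_at D (rterm R (Suc (Suc n))) (rdiff R (Suc n))
      (rterm R (Suc n)) (rdiff R n) (rterm R n))"

definition ext_cocycles :: "('k, 'c) ring_scheme \<Rightarrow> ('k, 'o, 'v) lincat \<Rightarrow>
    ('k, 'o, 'v, 'm, 'n) resolution \<Rightarrow> ('k, 'o, 'v, 'm) dmod \<Rightarrow> nat \<Rightarrow> ('o \<Rightarrow> 'm \<Rightarrow> 'm) set"
  where "ext_cocycles K D R B n =
    {\<tau> \<in> nat_trans K D (rterm R n) B.
      nat_comp D (rterm R (Suc n)) \<tau> (rdiff R n) = \<zero>\<^bsub>nat_trans_module K D (rterm R (Suc n)) B\<^esub>}"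

fun ext_coboundaries :: "('k, 'c) ring_scheme \<Rightarrow> ('k, 'o, 'v) lincat \<Rightarrow>
    ('k, 'o, 'v, 'm, 'n) resolution \<Rightarrow> ('k, 'o, 'v, 'm) dmod \<Rightarrow> nat \<Rightarrow> ('o \<Rightarrow> 'm \<Rightarrow> 'm) set"
  where
    "ext_coboundaries K D R B 0 = {\<zero>\<^bsub>nat_trans_module K D (rterm R 0) B\<^esub>}"
  | "ext_coboundaries K D R B (Suc n) =
      (\<lambda>\<tau>. nat_comp D (rterm R (Suc n)) \<tau> (rdiff R n)) ` nat_trans K D (rterm R n) B"

text \<open>
  \<open>Ext\<^sup>n(A, B)\<close> as the \<open>n\<close>-th cohomology of \<open>Hom(P, B)\<close> for a projective resolution \<open>P\<close> of \<open>A\<close>,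
  computed in the category of \<open>D\<close>-modules with values in \<open>'m\<close>. Only \<open>A\<close> may have values in another
  type; if \<open>'m\<close> is large enough (infinite, and at least as large as \<open>K\<close>, the object and Hom sets
  of \<open>D\<close>, and the values of \<open>A\<close>), resolutions exist and the choice does not matter up to isomorphism.
\<close>

definition Ext :: "('k, 'c) ring_scheme \<Rightarrow> ('k, 'o, 'v) lincat \<Rightarrow> nat \<Rightarrow>
    ('k, 'o, 'v, 'n) dmod \<Rightarrow> ('k, 'o, 'v, 'm) dmod \<Rightarrow> ('k, ('o \<Rightarrow> 'm \<Rightarrow> 'm) set) module"
  where "Ext K D n A B =
    (let R = (SOME R. projective_resolution K D A R) in
      quotient_module
        ((nat_trans_module K D (rterm R n) B)\<lparr>carrier := ext_cocycles K D R B n\<rparr>)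
        (ext_coboundaries K D R B n))"


section \<open>Hochschild-Mitchell cohomology and separability\<close>

type_synonym ('k, 'o, 'v, 'm) bimod = "('k, 'o \<times> 'o, ('v \<times> 'v \<Rightarrow> 'k) set, 'm) dmod"

abbreviation bimodule :: "('k, 'c) ring_scheme \<Rightarrow> ('k, 'o, 'v) lincat \<Rightarrow> ('k, 'o, 'v, 'm) bimod \<Rightarrow> bool"
  where "bimodule K C M \<equiv> is_dmod K (enveloping K C) M"

text \<open>
  The value of \<open>C\<close> at \<open>(x, y)\<close> is \<open>C(y, x)\<close>, and \<open>f \<otimes> g : (x, y) \<rightarrow> (x', y')\<close> acts by
  \<open>m \<mapsto> f \<circ> m \<circ> g\<close>.
\<close>

definition regular_bimodule :: "('k, 'c) ring_scheme \<Rightarrow> ('k, 'o, 'v) lincat \<Rightarrow> ('k, 'o, 'v, 'v) bimod"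
  where "regular_bimodule K C =
    \<lparr>FObj = (\<lambda>(x, y). LHom C y x),
     FMor = (\<lambda>(x, y) (x', y') T. \<lambda>m\<in>carrier (LHom C y x).
       tensor_lift K (LHom C y' x') (\<lambda>(f, g). LComp C y' x x' f (LComp C y' y x m g)) T)\<rparr>"

definition HM_cohomology :: "('k, 'c) ring_scheme \<Rightarrow> nat \<Rightarrow> ('k, 'o, 'v) lincat \<Rightarrow>
    ('k, 'o, 'v, 'm) bimod \<Rightarrow> ('k, ('o \<times> 'o \<Rightarrow> 'm \<Rightarrow> 'm) set) module"
  where "HM_cohomology K n C M = Ext K (enveloping K C) n (regular_bimodule K C) M"

text \<open>
  The first argument fixes the universe: bimodules take values in vector spaces whose elements are
  drawn from \<open>'m\<close>.
\<close>

definition separable :: "'m itself \<Rightarrow> ('k, 'c) ring_scheme \<Rightarrow> ('k, 'o, 'v) lincat \<Rightarrow> bool"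
  where "separable (_ :: 'm itself) K C \<longleftrightarrow>
    (\<forall>M :: ('k, 'o, 'v, 'm) bimod. bimodule K C M \<longrightarrow>
      carrier (HM_cohomology K 1 C M) = {\<zero>\<^bsub>HM_cohomology K 1 C M\<^esub>})"

text \<open>
  \<open>K\<close> and \<open>G\<close> are small relative to the universe \<open>'m\<close>: the vector spaces with elements in \<open>'m\<close> then
  include, up to isomorphism, all the free bimodules needed for the category of bimodules to have
  enough projectives.
\<close>

definition small_in :: "'m itself \<Rightarrow> ('k, 'c) ring_scheme \<Rightarrow> ('o, 'a) cat \<Rightarrow> bool"
  where "small_in (_ :: 'm itself) K G \<longleftrightarrow>
    infinite (UNIV :: 'm set) \<and>
    carrier K \<lesssim> (UNIV :: 'm set) \<and>
    Obj G \<lesssim> (UNIV :: 'm set) \<and>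
    (\<forall>x\<in>Obj G. \<forall>y\<in>Obj G. Hom G x y \<lesssim> (UNIV :: 'm set))"

end

theory Submission
  imports Defs
begin

text \<open>
  Let \<open>C = K[G]\<close>. For a projective resolution \<open>\<dots> \<rightarrow> P\<^sub>1 \<rightarrow> P\<^sub>0 \<rightarrow> C\<close> of bimodules, all \<open>H\<^sup>1(C, M)\<close>
  vanish if and only if the augmentation \<open>P\<^sub>0 \<rightarrow> C\<close> has a section: take \<open>M\<close> to be its kernel, for
  which the tautological cocycle \<open>P\<^sub>1 \<rightarrow> M\<close> must be a coboundary. As \<open>P\<^sub>0\<close> is projective, a section
  of the augmentation yields one of every epimorphism \<open>Q \<rightarrow> C\<close>. For \<open>Q = \<Oplus>\<^sub>z C(z, -) \<otimes> C(-, z)\<close>, with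
  composition as the epimorphism, the image of \<open>1\<^sub>x\<close> is a finitely supported function on the triples
  \<open>(z, g, h)\<close> with \<open>g : z \<rightarrow> x\<close>, \<open>h : x \<rightarrow> z\<close>, invariant under conjugation by \<open>G(x, x)\<close>; its values at
  \<open>(z, g, g\<^sup>-\<^sup>1)\<close> depend only on \<open>z\<close> and sum to \<open>1\<close>, which forces \<open>G(x, x)\<close> to be finite of order
  invertible in \<open>K\<close>. Conversely, a section is obtained by averaging.
\<close>

section \<open>Linear maps and free modules\<close>

text \<open>The obstacle is one of universes. \<open>projective_dmod\<close> tests lifting only
  against modules with elements in 'm, whereas \<open>K[G]\<close> and the bimodule Q consist of
  functions and live in other types. \<open>small_in\<close> bounds their size so that they can be
  copied into 'm and back; this yields a map from the projective cover to Q over K[G], and composing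
  it with the section carries 1_x into Q. The final count: conjugation by f sends (z, g, h) to (z, f
  g, h f^-1), and G(x, x) acts simply transitively on each nonempty G(z, x). Hence each z that
  occurs contributes all its |G(z, x)| = |G(x, x)| triples (z, g, g^-1), with one common coefficient
  c_z. Finite support gives finiteness, and 1 = |G(x, x)| * (sum of the c_z) gives invertibility.
  Calculations stay elementary because \<open>enveloping K (linearization K G)\<close> is treated as
  a linearization of the product of G with its opposite: functoriality and naturality then reduce to
  identities between arrows of G. Since \<open>Ext\<close> fixes one resolution by
  \<open>SOME\<close>, the argument works inside that resolution throughout.\<close>

lemma is_linearI:
  assumes "\<And>v. v \<in> carrier V \<Longrightarrow> h v \<in> carrier W"
    and "\<And>u v. \<lbrakk>u \<in> carrier V; v \<in> carrier V\<rbrakk> \<Longrightarrow> h (u \<oplus>\<^bsub>V\<^esub> v) = h u \<oplus>\<^bsub>W\<^esub> h v"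
    and "\<And>a v. \<lbrakk>a \<in> carrier K; v \<in> carrier V\<rbrakk> \<Longrightarrow> h (a \<odot>\<^bsub>V\<^esub> v) = a \<odot>\<^bsub>W\<^esub> h v"
  shows "is_linear K V W h"
  using assms by (auto simp: is_linear_def)

lemma is_linear_closed: "\<lbrakk>is_linear K V W h; v \<in> carrier V\<rbrakk> \<Longrightarrow> h v \<in> carrier W"
  by (auto simp: is_linear_def)

lemma is_linear_add:
  "\<lbrakk>is_linear K V W h; u \<in> carrier V; v \<in> carrier V\<rbrakk> \<Longrightarrow> h (u \<oplus>\<^bsub>V\<^esub> v) = h u \<oplus>\<^bsub>W\<^esub> h v"
  by (auto simp: is_linear_def)

lemma is_linear_smult:
  "\<lbrakk>is_linear K V W h; a \<in> carrier K; v \<in> carrier V\<rbrakk> \<Longrightarrow> h (a \<odot>\<^bsub>V\<^esub> v) = a \<odot>\<^bsub>W\<^esub> h v"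
  by (auto simp: is_linear_def)

lemmas module_add_closed = abelian_monoid.a_closed[OF abelian_group.axioms(1)[OF module.axioms(2)]]

lemma is_linear_cong:
  assumes "is_linear K V W h" "module K V" "\<And>v. v \<in> carrier V \<Longrightarrow> h' v = h v"
  shows "is_linear K V W h'"
  using assms module_add_closed[OF assms(2)] module.smult_closed[OF assms(2)]
  by (auto simp: is_linear_def Pi_iff)

lemma is_linear_comp:
  assumes "is_linear K U V f" "is_linear K V W g"
  shows "is_linear K U W (\<lambda>u. g (f u))"
  using assms by (auto simp: is_linear_def Pi_iff)

lemma is_linear_zero:
  assumes "module K V" "module K W" "is_linear K V W h"
  shows "h \<zero>\<^bsub>V\<^esub> = \<zero>\<^bsub>W\<^esub>"
proof -
  interpret V: module K V by fact
  interpret W: module K W by fact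
  have "h (\<zero>\<^bsub>K\<^esub> \<odot>\<^bsub>V\<^esub> \<zero>\<^bsub>V\<^esub>) = \<zero>\<^bsub>K\<^esub> \<odot>\<^bsub>W\<^esub> h \<zero>\<^bsub>V\<^esub>"
    using assms(3) by (intro is_linear_smult) auto
  then show ?thesis using is_linear_closed[OF assms(3) V.M.zero_closed] by simp
qed

lemma is_linear_uminus:
  assumes "module K V" "module K W" "is_linear K V W h" "v \<in> carrier V"
  shows "h (\<ominus>\<^bsub>V\<^esub> v) = \<ominus>\<^bsub>W\<^esub> h v"
proof -
  interpret V: module K V by fact
  interpret W: module K W by fact
  have "h (\<ominus>\<^bsub>V\<^esub> v) = h ((\<ominus>\<^bsub>K\<^esub> \<one>\<^bsub>K\<^esub>) \<odot>\<^bsub>V\<^esub> v)"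
    using V.smult_l_minus[of "\<one>\<^bsub>K\<^esub>" v] assms(4) by simp
  also have "\<dots> = (\<ominus>\<^bsub>K\<^esub> \<one>\<^bsub>K\<^esub>) \<odot>\<^bsub>W\<^esub> h v"
    using assms by (intro is_linear_smult) auto
  also have "\<dots> = \<ominus>\<^bsub>W\<^esub> h v"
    using W.smult_l_minus[of "\<one>\<^bsub>K\<^esub>" "h v"] is_linear_closed[OF assms(3,4)] by simp
  finally show ?thesis .
qed

lemma is_linear_minus:
  assumes "module K V" "module K W" "is_linear K V W h" "u \<in> carrier V" "v \<in> carrier V"
  shows "h (u \<ominus>\<^bsub>V\<^esub> v) = h u \<ominus>\<^bsub>W\<^esub> h v"
proof -
  interpret V: module K V by fact
  show ?thesis
    using assms by (simp add: a_minus_def is_linear_add[OF assms(3)] is_linear_uminus)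
qed

lemma is_linear_finsum:
  assumes "module K V" "module K W" "is_linear K V W h" "finite A" "f \<in> A \<rightarrow> carrier V"
  shows "h (\<Oplus>\<^bsub>V\<^esub>i\<in>A. f i) = (\<Oplus>\<^bsub>W\<^esub>i\<in>A. h (f i))"
proof -
  interpret V: module K V by fact
  interpret W: module K W by fact
  show ?thesis
    using assms(4,5)
  proof (induction A rule: finite_induct)
    case empty
    then show ?case using is_linear_zero[OF assms(1-3)] by simp
  next
    case (insert x F)
    then show ?case
      using is_linear_closed[OF assms(3)] by (simp add: is_linear_add[OF assms(3)] Pi_iff)
  qed
qed

lemma is_linear_plus:
  assumes "module K W" "is_linear K V W f" "is_linear K V W g" "module K V"
  shows "is_linear K V W (\<lambda>v. f v \<oplus>\<^bsub>W\<^esub> g v)"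
proof -
  interpret V: module K V by fact
  interpret W: module K W by fact
  show ?thesis
  proof (rule is_linearI)
    fix u v assume "u \<in> carrier V" "v \<in> carrier V"
    then show "f (u \<oplus>\<^bsub>V\<^esub> v) \<oplus>\<^bsub>W\<^esub> g (u \<oplus>\<^bsub>V\<^esub> v) = (f u \<oplus>\<^bsub>W\<^esub> g u) \<oplus>\<^bsub>W\<^esub> (f v \<oplus>\<^bsub>W\<^esub> g v)"
      using assms(2,3)
      by (simp add: is_linear_add[OF assms(2)] is_linear_add[OF assms(3)] is_linear_closed W.M.a_ac)
  qed (use assms in \<open>auto simp: is_linear_closed is_linear_smult W.smult_r_distr\<close>)
qed

lemma is_linear_scale:
  assumes "module K W" "is_linear K V W f" "a \<in> carrier K"
  shows "is_linear K V W (\<lambda>v. a \<odot>\<^bsub>W\<^esub> f v)"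
proof -
  interpret W: module K W by fact
  show ?thesis
  proof (rule is_linearI)
    fix b v assume "b \<in> carrier K" "v \<in> carrier V"
    then show "a \<odot>\<^bsub>W\<^esub> f (b \<odot>\<^bsub>V\<^esub> v) = b \<odot>\<^bsub>W\<^esub> (a \<odot>\<^bsub>W\<^esub> f v)"
      using assms
      by (simp add: is_linear_smult is_linear_closed flip: W.smult_assoc1)
        (simp add: W.R.m_comm)
  qed (use assms in \<open>auto simp: is_linear_closed is_linear_add W.smult_r_distr\<close>)
qed

section \<open>Vector spaces with a given basis\<close>

lemma carrier_free_module:
  "t \<in> carrier (free_module K B) \<longleftrightarrow> (\<forall>b. t b \<in> carrier K) \<and> {b. t b \<noteq> \<zero>\<^bsub>K\<^esub>} \<subseteq> B \<and> finite {b. t b \<noteq> \<zero>\<^bsub>K\<^esub>}"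
  by (auto simp: free_module_def)

lemma free_module_sel [simp]:
  "\<zero>\<^bsub>free_module K B\<^esub> = (\<lambda>_. \<zero>\<^bsub>K\<^esub>)"
  "s \<oplus>\<^bsub>free_module K B\<^esub> t = (\<lambda>b. s b \<oplus>\<^bsub>K\<^esub> t b)"
  "a \<odot>\<^bsub>free_module K B\<^esub> t = (\<lambda>b. a \<otimes>\<^bsub>K\<^esub> t b)"
  by (simp_all add: free_module_def)

lemma free_moduleI:
  assumes "\<And>b. t b \<in> carrier K" "\<And>b. b \<notin> A \<Longrightarrow> t b = \<zero>\<^bsub>K\<^esub>" "finite A" "A \<subseteq> B"
  shows "t \<in> carrier (free_module K B)"
proof -
  have "{b. t b \<noteq> \<zero>\<^bsub>K\<^esub>} \<subseteq> A" using assms(2) by auto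
  then show ?thesis using assms by (auto simp: carrier_free_module intro: finite_subset)
qed

lemma free_moduleD:
  assumes "t \<in> carrier (free_module K B)"
  shows "t b \<in> carrier K" "finite {b. t b \<noteq> \<zero>\<^bsub>K\<^esub>}" "b \<notin> B \<Longrightarrow> t b = \<zero>\<^bsub>K\<^esub>"
  using assms by (auto simp: carrier_free_module)

lemma module_free_module:
  fixes K (structure)
  assumes "cring K" shows "module K (free_module K B)"
proof -
  interpret cring K by fact
  let ?F = "free_module K B"
  note D = free_moduleD[where K = K and B = B]
  have add: "(\<lambda>b. s b \<oplus> t b) \<in> carrier ?F" if "s \<in> carrier ?F" "t \<in> carrier ?F" for s t
    using that
    by (intro free_moduleI[where A = "{b. s b \<noteq> \<zero>} \<union> {b. t b \<noteq> \<zero>}"]) (auto simp: carrier_free_module)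
  have sm: "(\<lambda>b. a \<otimes> t b) \<in> carrier ?F" if "a \<in> carrier K" "t \<in> carrier ?F" for a t
    using that by (intro free_moduleI[where A = "{b. t b \<noteq> \<zero>}"]) (auto simp: carrier_free_module)
  have "abelian_group ?F"
  proof (rule abelian_groupI)
    show "\<exists>s\<in>carrier ?F. s \<oplus>\<^bsub>?F\<^esub> t = \<zero>\<^bsub>?F\<^esub>" if "t \<in> carrier ?F" for t
    proof
      show "(\<lambda>b. (\<ominus> \<one>) \<otimes> t b) \<in> carrier ?F" using sm[of "\<ominus> \<one>"] that by simp
      show "(\<lambda>b. (\<ominus> \<one>) \<otimes> t b) \<oplus>\<^bsub>?F\<^esub> t = \<zero>\<^bsub>?F\<^esub>" using D(1)[OF that] by (simp add: l_minus l_neg)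
    qed
    show "\<zero>\<^bsub>?F\<^esub> \<in> carrier ?F" by (auto simp: carrier_free_module)
    fix x y z assume "x \<in> carrier ?F" "y \<in> carrier ?F" "z \<in> carrier ?F"
    then show "x \<oplus>\<^bsub>?F\<^esub> y \<oplus>\<^bsub>?F\<^esub> z = x \<oplus>\<^bsub>?F\<^esub> (y \<oplus>\<^bsub>?F\<^esub> z)" "x \<oplus>\<^bsub>?F\<^esub> y = y \<oplus>\<^bsub>?F\<^esub> x"
      using D(1) by (auto simp: a_assoc intro: a_comm)
  qed (simp_all add: add D(1))
  then show ?thesis
  proof (rule moduleI[OF assms])
  qed (simp_all add: sm D(1) l_distr r_distr m_assoc)
qed

lemma basis_elt_closed: "\<lbrakk>cring K; b \<in> B\<rbrakk> \<Longrightarrow> basis_elt K b \<in> carrier (free_module K B)"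
  by (rule free_moduleI[where A = "{b}"])
    (auto simp: basis_elt_def cring_def ring.ring_simprules)

text \<open>A finitely supported function arises from zero by adding finitely many scaled basis
  vectors. The underlying induction is over a finite set that merely contains the support, so
  clearing the coordinate \<open>c\<close> leads to the smaller set whether or not
  \<open>s c\<close> was zero.\<close>

lemma free_module_induct [consumes 2, case_names zero add]:
  fixes K (structure)
  assumes "cring K" and t: "t \<in> carrier (free_module K B)"
    and P0: "P (\<lambda>_. \<zero>\<^bsub>K\<^esub>)"
    and step: "\<And>a b s. \<lbrakk>a \<in> carrier K; b \<in> B; s \<in> carrier (free_module K B); P s\<rbrakk>
      \<Longrightarrow> P (a \<odot>\<^bsub>free_module K B\<^esub> basis_elt K b \<oplus>\<^bsub>free_module K B\<^esub> s)"
  shows "P t"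
proof -
  interpret cring K by fact
  have "P s" if "finite A" "s \<in> carrier (free_module K B)" "{b. s b \<noteq> \<zero>} \<subseteq> A" for A s
    using that
  proof (induction A arbitrary: s rule: finite_induct)
    case empty
    then have "s = (\<lambda>_. \<zero>)" by auto
    then show ?case using P0 by blast
  next
    case (insert c A)
    let ?s = "s(c := \<zero>)"
    have s: "?s \<in> carrier (free_module K B)"
      using insert.prems(1)
      by (intro free_moduleI[where A = "{b. s b \<noteq> \<zero>}"]) (auto simp: carrier_free_module)
    have P: "P ?s" using insert.prems by (intro insert.IH s) auto
    show ?case
    proof (cases "c \<in> B")
      case True
      have "s = s c \<odot>\<^bsub>free_module K B\<^esub> basis_elt K c \<oplus>\<^bsub>free_module K B\<^esub> ?s"
        using free_moduleD(1)[OF insert.prems(1)] by (auto simp: basis_elt_def)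
      then show ?thesis
        using step[OF free_moduleD(1)[OF insert.prems(1)] True s P] by metis
    next
      case False
      then have "?s = s" using free_moduleD(3)[OF insert.prems(1)] by auto
      then show ?thesis using P by simp
    qed
  qed
  from this[OF free_moduleD(2)[OF t] t] show ?thesis by simp
qed

text \<open>The principle behind most identities below: both sides are linear in a vector of a space
  with known basis, and on basis vectors the claim turns into an identity of arrows.\<close>

lemma free_module_ext:
  assumes "module K W" and f: "is_linear K (free_module K B) W f" and g: "is_linear K (free_module K B) W g"
    and eq: "\<And>b. b \<in> B \<Longrightarrow> f (basis_elt K b) = g (basis_elt K b)"
    and t: "t \<in> carrier (free_module K B)"
  shows "f t = g t"
proof -
  interpret W: module K W by fact
  have K: "cring K" by (rule W.R.cring_axioms)
  interpret F: module K "free_module K B" by (rule module_free_module[OF K])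
  show ?thesis
    using K t
  proof (induction rule: free_module_induct)
    case zero
    then show ?case
      using is_linear_zero[OF F.module_axioms assms(1) f] is_linear_zero[OF F.module_axioms assms(1) g] by simp
  next
    case (add a b s)
    then show ?case
      using basis_elt_closed[OF K, of b B]
      by (simp only: is_linear_add[OF f] is_linear_add[OF g] is_linear_smult[OF f]
          is_linear_smult[OF g] eq F.smult_closed)
  qed
qed

text \<open>\<open>free_lift\<close> sums over the exact support, which may shrink when vectors are
  added or scaled. Over a common finite superset the sums for \<open>s\<close>, \<open>t\<close> and
  their sum can be compared termwise.\<close>

lemma free_lift_superset:
  assumes "module K V" and t: "t \<in> carrier (free_module K B)" and "\<phi> \<in> B \<rightarrow> carrier V"
    and A: "finite A" "{b. t b \<noteq> \<zero>\<^bsub>K\<^esub>} \<subseteq> A" "A \<subseteq> B"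
  shows "free_lift K V \<phi> t = (\<Oplus>\<^bsub>V\<^esub>b\<in>A. t b \<odot>\<^bsub>V\<^esub> \<phi> b)"
proof -
  interpret V: module K V by fact
  show ?thesis
    unfolding free_lift_def
    using assms free_moduleD(1)[OF t]
    by (intro V.M.add.finprod_mono_neutral_cong_left) (auto simp: Pi_iff)
qed

lemma free_lift_linear:
  assumes V: "module K V" and \<phi>: "\<phi> \<in> B \<rightarrow> carrier V"
  shows "is_linear K (free_module K B) V (free_lift K V \<phi>)"
proof -
  interpret V: module K V by fact
  interpret F: module K "free_module K B" by (rule module_free_module[OF V.R.cring_axioms])
  note D = free_moduleD[where K = K and B = B]
  show ?thesis
  proof (rule is_linearI)
    fix t assume t: "t \<in> carrier (free_module K B)"
    then show "free_lift K V \<phi> t \<in> carrier V"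
      using \<phi> unfolding free_lift_def
      by (intro V.M.finsum_closed) (auto simp: carrier_free_module)
  next
    fix s t assume st: "s \<in> carrier (free_module K B)" "t \<in> carrier (free_module K B)"
    let ?A = "{b. s b \<noteq> \<zero>\<^bsub>K\<^esub>} \<union> {b. t b \<noteq> \<zero>\<^bsub>K\<^esub>}"
    have A: "finite ?A" "?A \<subseteq> B" using st by (auto simp: carrier_free_module)
    then have \<phi>A: "\<phi> b \<in> carrier V" if "b \<in> ?A" for b using that \<phi> by auto
    have "free_lift K V \<phi> (s \<oplus>\<^bsub>free_module K B\<^esub> t)
        = (\<Oplus>\<^bsub>V\<^esub>b\<in>?A. (s b \<oplus>\<^bsub>K\<^esub> t b) \<odot>\<^bsub>V\<^esub> \<phi> b)"
      using free_lift_superset[OF V F.M.a_closed[OF st] \<phi> A(1) _ A(2)] by fastforce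
    also have "\<dots> = (\<Oplus>\<^bsub>V\<^esub>b\<in>?A. s b \<odot>\<^bsub>V\<^esub> \<phi> b \<oplus>\<^bsub>V\<^esub> t b \<odot>\<^bsub>V\<^esub> \<phi> b)"
      using st \<phi>A D(1) by (intro V.M.finsum_cong') (auto simp: V.smult_l_distr)
    also have "\<dots> = (\<Oplus>\<^bsub>V\<^esub>b\<in>?A. s b \<odot>\<^bsub>V\<^esub> \<phi> b) \<oplus>\<^bsub>V\<^esub> (\<Oplus>\<^bsub>V\<^esub>b\<in>?A. t b \<odot>\<^bsub>V\<^esub> \<phi> b)"
      using st \<phi>A D(1) by (intro V.M.finsum_addf) auto
    also have "\<dots> = free_lift K V \<phi> s \<oplus>\<^bsub>V\<^esub> free_lift K V \<phi> t"
      using free_lift_superset[OF V st(1) \<phi> A(1) _ A(2)] free_lift_superset[OF V st(2) \<phi> A(1) _ A(2)]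
      by auto
    finally show "free_lift K V \<phi> (s \<oplus>\<^bsub>free_module K B\<^esub> t) = free_lift K V \<phi> s \<oplus>\<^bsub>V\<^esub> free_lift K V \<phi> t" .
  next
    fix a t assume at: "a \<in> carrier K" "t \<in> carrier (free_module K B)"
    let ?A = "{b. t b \<noteq> \<zero>\<^bsub>K\<^esub>}"
    have A: "finite ?A" "?A \<subseteq> B" using at by (auto simp: carrier_free_module)
    then have \<phi>A: "\<phi> b \<in> carrier V" if "b \<in> ?A" for b using that \<phi> by auto
    have "{b. a \<otimes>\<^bsub>K\<^esub> t b \<noteq> \<zero>\<^bsub>K\<^esub>} \<subseteq> ?A" using at(1) by auto
    then have "free_lift K V \<phi> (a \<odot>\<^bsub>free_module K B\<^esub> t) = (\<Oplus>\<^bsub>V\<^esub>b\<in>?A. (a \<otimes>\<^bsub>K\<^esub> t b) \<odot>\<^bsub>V\<^esub> \<phi> b)"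
      using free_lift_superset[OF V F.smult_closed[OF at] \<phi> A(1) _ A(2)] by simp
    also have "\<dots> = (\<Oplus>\<^bsub>V\<^esub>b\<in>?A. a \<odot>\<^bsub>V\<^esub> (t b \<odot>\<^bsub>V\<^esub> \<phi> b))"
      using at \<phi>A D(1) by (intro V.M.finsum_cong') (auto simp: V.smult_assoc1)
    also have "\<dots> = a \<odot>\<^bsub>V\<^esub> free_lift K V \<phi> t"
      unfolding free_lift_def using at \<phi>A D(1) A by (intro V.finsum_smult_ldistr[symmetric]) auto
    finally show "free_lift K V \<phi> (a \<odot>\<^bsub>free_module K B\<^esub> t) = a \<odot>\<^bsub>V\<^esub> free_lift K V \<phi> t" .
  qed
qed

lemma free_lift_basis:
  assumes "module K V" and "\<phi> b \<in> carrier V"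
  shows "free_lift K V \<phi> (basis_elt K b) = \<phi> b"
proof -
  interpret V: module K V by fact
  have "free_lift K V \<phi> (basis_elt K b) = (\<Oplus>\<^bsub>V\<^esub>b'\<in>{b}. basis_elt K b b' \<odot>\<^bsub>V\<^esub> \<phi> b')"
    using assms
    by (intro free_lift_superset[where B = "{b}"] basis_elt_closed V.R.cring_axioms) (auto simp: basis_elt_def split: if_splits)
  also have "\<dots> = \<phi> b" using assms by (simp add: basis_elt_def)
  finally show ?thesis .
qed

text \<open>Lets the image of a vector under an abstract linear map be read off as a finite sum over
  its support.\<close>

lemma linear_free_lift:
  assumes "module K W" and f: "is_linear K (free_module K B) W f"
    and t: "t \<in> carrier (free_module K B)"
  shows "f t = free_lift K W (\<lambda>b. f (basis_elt K b)) t"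
proof -
  interpret W: module K W by fact
  have c: "f (basis_elt K b) \<in> carrier W" if "b \<in> B" for b
    using that f basis_elt_closed[OF W.R.cring_axioms] is_linear_closed by metis
  show ?thesis
    by (rule free_module_ext[OF assms(1) f _ _ t])
      (use c assms(1) in \<open>auto intro!: free_lift_linear simp: free_lift_basis\<close>)
qed

lemma linear_free_lift_comp:
  assumes V: "module K V" and W: "module K W" and f: "is_linear K V W f"
    and \<phi>: "\<phi> \<in> B \<rightarrow> carrier V" and t: "t \<in> carrier (free_module K B)"
  shows "f (free_lift K V \<phi> t) = free_lift K W (\<lambda>b. f (\<phi> b)) t"
proof -
  have c: "f (\<phi> b) \<in> carrier W" if "b \<in> B" for b
    using that \<phi> is_linear_closed[OF f] by blast
  show ?thesis
    by (rule free_module_ext[OF W is_linear_comp[OF free_lift_linear[OF V \<phi>] f] _ _ t])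
      (use c V W \<phi> in \<open>auto intro!: free_lift_linear simp: free_lift_basis Pi_iff\<close>)
qed

lemma free_lift_cong:
  assumes "\<And>b. b \<in> B \<Longrightarrow> \<phi> b = \<psi> b" "module K V" "\<psi> \<in> B \<rightarrow> carrier V" "t \<in> carrier (free_module K B)"
  shows "free_lift K V \<phi> t = free_lift K V \<psi> t"
  by (rule free_module_ext[where B = B and W = V])
    (use assms in \<open>auto intro!: free_lift_linear simp: free_lift_basis Pi_iff\<close>)

text \<open>A finitely supported function is encoded by its graph over the support, a finite subset
  of \<open>B \<times> carrier K\<close>, and an infinite set has as many finite subsets as
  elements. This keeps free modules within the universe 'm.\<close>

lemma free_module_lepoll:
  assumes inf: "infinite (UNIV :: 'm set)" and B: "B \<lesssim> (UNIV :: 'm set)" and K: "carrier K \<lesssim> (UNIV :: 'm set)"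
  shows "carrier (free_module K B) \<lesssim> (UNIV :: 'm set)"
proof -
  have sq: "(UNIV :: 'm set) \<times> (UNIV :: 'm set) \<approx> (UNIV :: 'm set)"
    unfolding eqpoll_iff_card_of_ordIso by (rule card_of_Times_same_infinite[OF inf])
  have "B \<times> carrier K \<lesssim> (UNIV :: 'm set) \<times> (UNIV :: 'm set)" using B K by (rule times_lepoll_mono)
  then have "B \<times> carrier K \<lesssim> (UNIV :: 'm set)" using sq lepoll_trans2 by blast
  then have Fp: "Fpow (B \<times> carrier K) \<lesssim> Fpow (UNIV :: 'm set)"
    unfolding lepoll_def by (metis image_Fpow_mono inj_on_image_Fpow)
  have "carrier (free_module K B) \<lesssim> Fpow (B \<times> carrier K)"
    unfolding lepoll_def
  proof (intro exI conjI)
    let ?g = "\<lambda>t. (\<lambda>b. (b, t b)) ` {b. t b \<noteq> \<zero>\<^bsub>K\<^esub>}"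
    show "inj_on ?g (carrier (free_module K B))"
    proof (rule inj_onI)
      fix s t assume eq: "?g s = ?g t"
      have "(b, c) \<in> ?g u \<longleftrightarrow> u b \<noteq> \<zero>\<^bsub>K\<^esub> \<and> u b = c" for b c u by auto
      then have "s b \<noteq> \<zero>\<^bsub>K\<^esub> \<and> s b = c \<longleftrightarrow> t b \<noteq> \<zero>\<^bsub>K\<^esub> \<and> t b = c" for b c using eq by metis
      then show "s = t" by (intro ext) metis
    qed
    show "?g ` carrier (free_module K B) \<subseteq> Fpow (B \<times> carrier K)"
      by (auto simp: Fpow_def carrier_free_module)
  qed
  also note Fp
  also have "Fpow (UNIV :: 'm set) \<approx> (UNIV :: 'm set)" using inf by (rule eqpoll_Fpow)
  finally show ?thesis .
qed

section \<open>Quotients and tensor products\<close>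

text \<open>The module axioms pass to the image of a map that preserves the operations; negatives
  come from negatives upstairs. Quotients and transported copies both obtain their module structure
  this way.\<close>

lemma module_surj_image:
  assumes V: "module K V" and W: "carrier W = q ` carrier V"
    and zero: "q \<zero>\<^bsub>V\<^esub> = \<zero>\<^bsub>W\<^esub>"
    and add: "\<And>u v. \<lbrakk>u \<in> carrier V; v \<in> carrier V\<rbrakk> \<Longrightarrow> q (u \<oplus>\<^bsub>V\<^esub> v) = q u \<oplus>\<^bsub>W\<^esub> q v"
    and smult: "\<And>a v. \<lbrakk>a \<in> carrier K; v \<in> carrier V\<rbrakk> \<Longrightarrow> q (a \<odot>\<^bsub>V\<^esub> v) = a \<odot>\<^bsub>W\<^esub> q v"
  shows "module K W"
proof -
  interpret V: module K V by fact
  have "abelian_group W"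
  proof (rule abelian_groupI)
    fix x assume "x \<in> carrier W"
    then obtain v where v: "v \<in> carrier V" "x = q v" using W by auto
    have "q (\<ominus>\<^bsub>V\<^esub> v) \<oplus>\<^bsub>W\<^esub> q v = \<zero>\<^bsub>W\<^esub>"
      using v by (simp add: V.M.l_neg zero flip: add)
    then show "\<exists>y\<in>carrier W. y \<oplus>\<^bsub>W\<^esub> x = \<zero>\<^bsub>W\<^esub>" using v W by blast
  next
    show "\<zero>\<^bsub>W\<^esub> \<in> carrier W" using W zero V.M.zero_closed by (metis imageI)
  qed (auto simp: W zero[symmetric] V.M.a_assoc simp flip: add intro!: arg_cong[of _ _ q] V.M.a_comm)
  then show ?thesis
    by (rule moduleI[OF V.R.cring_axioms])
      (auto simp: W V.smult_l_distr V.smult_r_distr V.smult_assoc1 simp flip: add smult)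
qed

lemma submodule_kernel:
  assumes V: "module K V" and W: "module K W" and h: "is_linear K V W h"
  shows "submodule {v \<in> carrier V. h v = \<zero>\<^bsub>W\<^esub>} K V"
proof -
  interpret V: module K V by fact
  interpret W: module K W by fact
  show ?thesis
    using is_linear_zero[OF assms]
    by (intro V.submoduleI)
      (auto simp: is_linear_uminus[OF assms] is_linear_add[OF h] is_linear_smult[OF h])
qed

context
  fixes K :: "('k, 'c) ring_scheme" and V :: "('k, 'v) module" and N
  assumes V: "module K V" and N: "submodule N K V"
begin

interpretation V: module K V by (rule V)
interpretation N: submodule N K V by (rule N)
interpretation AN: abelian_subgroup N V
  by (intro abelian_subgroupI3 additive_subgroupI N.subgroup_axioms V.M.abelian_group_axioms)

lemma carrier_quotient_module:
  "carrier (quotient_module V N) = (\<lambda>v. N +>\<^bsub>V\<^esub> v) ` carrier V"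
  by (auto simp: quotient_module_def A_RCOSETS_def')

text \<open>Scalar multiplication in \<open>quotient_module\<close> is a union over all
  representatives of a coset; as \<open>N\<close> is closed under scalars, the cosets in this union
  coincide.\<close>

lemma quotient_map_smult:
  assumes "a \<in> carrier K" "v \<in> carrier V"
  shows "N +>\<^bsub>V\<^esub> a \<odot>\<^bsub>V\<^esub> v = a \<odot>\<^bsub>quotient_module V N\<^esub> (N +>\<^bsub>V\<^esub> v)"
proof -
  have "N +>\<^bsub>V\<^esub> a \<odot>\<^bsub>V\<^esub> u = N +>\<^bsub>V\<^esub> a \<odot>\<^bsub>V\<^esub> v" if u: "u \<in> N +>\<^bsub>V\<^esub> v" for u
  proof -
    from u obtain n where n: "n \<in> N" "u = n \<oplus>\<^bsub>V\<^esub> v" by (auto simp: a_r_coset_def')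
    then have "a \<odot>\<^bsub>V\<^esub> u = a \<odot>\<^bsub>V\<^esub> n \<oplus>\<^bsub>V\<^esub> a \<odot>\<^bsub>V\<^esub> v"
      using assms AN.a_Hcarr by (simp add: V.smult_r_distr)
    then have "a \<odot>\<^bsub>V\<^esub> u \<in> N +>\<^bsub>V\<^esub> a \<odot>\<^bsub>V\<^esub> v"
      using assms n by (auto simp: a_r_coset_def')
    then show ?thesis
      using AN.a_repr_independence'[OF _ V.smult_closed[OF assms]] by simp
  qed
  moreover have "v \<in> N +>\<^bsub>V\<^esub> v" using assms(2) by (rule AN.a_rcos_self)
  ultimately have "(\<Union>u\<in>N +>\<^bsub>V\<^esub> v. N +>\<^bsub>V\<^esub> a \<odot>\<^bsub>V\<^esub> u) = N +>\<^bsub>V\<^esub> a \<odot>\<^bsub>V\<^esub> v" by blast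
  then show ?thesis by (simp add: quotient_module_def)
qed

lemma module_quotient_module: "module K (quotient_module V N)"
  by (rule module_surj_image[OF V carrier_quotient_module])
    (use quotient_map_smult in \<open>auto simp: quotient_module_def AN.a_rcos_sum V.M.a_coset_add_zero AN.a_subset\<close>)

lemma quotient_map_linear: "is_linear K V (quotient_module V N) (\<lambda>v. N +>\<^bsub>V\<^esub> v)"
proof (rule is_linearI)
  show "N +>\<^bsub>V\<^esub> (u \<oplus>\<^bsub>V\<^esub> v) = (N +>\<^bsub>V\<^esub> u) \<oplus>\<^bsub>quotient_module V N\<^esub> (N +>\<^bsub>V\<^esub> v)"
    if "u \<in> carrier V" "v \<in> carrier V" for u v
    using that by (simp add: quotient_module_def AN.a_rcos_sum)
qed (simp_all add: carrier_quotient_module quotient_map_smult)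

lemma quotient_map_eq:
  assumes "u \<in> carrier V" "v \<in> carrier V" "u \<ominus>\<^bsub>V\<^esub> v \<in> N"
  shows "N +>\<^bsub>V\<^esub> u = N +>\<^bsub>V\<^esub> v"
proof -
  have "u \<in> N +>\<^bsub>V\<^esub> v" using AN.a_rcos_module_rev[OF assms(2,1)] assms(3) by (simp add: V.M.minus_eq)
  then show ?thesis using AN.a_repr_independence'[OF _ assms(2)] by simp
qed

text \<open>This singleton property gives \<open>the_elem\<close> in \<open>tensor_lift\<close> its
  meaning.\<close>

lemma linear_const_on_coset:
  assumes W: "module K W" and h: "is_linear K V W h" and N0: "\<And>n. n \<in> N \<Longrightarrow> h n = \<zero>\<^bsub>W\<^esub>"
    and v: "v \<in> carrier V"
  shows "h ` (N +>\<^bsub>V\<^esub> v) = {h v}"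
proof -
  interpret W: module K W by fact
  have "h (n \<oplus>\<^bsub>V\<^esub> v) = h v" if "n \<in> N" for n
    using that v N0 AN.a_Hcarr is_linear_closed[OF h v] by (simp add: is_linear_add[OF h])
  moreover have "v \<in> N +>\<^bsub>V\<^esub> v" using v by (rule AN.a_rcos_self)
  ultimately show ?thesis by (auto simp: a_r_coset_def')
qed

end

section \<open>Bilinear maps and the universal property of the tensor product\<close>

definition is_bilinear ::
    "('k, 'c) ring_scheme \<Rightarrow> ('k, 'v) module \<Rightarrow> ('k, 'w) module \<Rightarrow> ('k, 'u) module \<Rightarrow> ('v \<times> 'w \<Rightarrow> 'u) \<Rightarrow> bool"
  where "is_bilinear K V W U \<phi> \<longleftrightarrow>
    (\<forall>w\<in>carrier W. is_linear K V U (\<lambda>v. \<phi> (v, w))) \<and>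
    (\<forall>v\<in>carrier V. is_linear K W U (\<lambda>w. \<phi> (v, w)))"

lemma is_bilinearD:
  assumes "is_bilinear K V W U \<phi>"
  shows "w \<in> carrier W \<Longrightarrow> is_linear K V U (\<lambda>v. \<phi> (v, w))"
    and "v \<in> carrier V \<Longrightarrow> is_linear K W U (\<lambda>w. \<phi> (v, w))"
  using assms by (auto simp: is_bilinear_def)

lemma is_bilinear_closed:
  "\<lbrakk>is_bilinear K V W U \<phi>; v \<in> carrier V; w \<in> carrier W\<rbrakk> \<Longrightarrow> \<phi> (v, w) \<in> carrier U"
  by (auto simp: is_bilinear_def is_linear_def)

context
  fixes K :: "('k, 'c) ring_scheme" and V :: "('k, 'v) module" and W :: "('k, 'w) module"
  assumes V: "module K V" and W: "module K W"
begin

interpretation V: module K V by (rule V)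
interpretation W: module K W by (rule W)

private abbreviation "F \<equiv> free_module K (carrier V \<times> carrier W)"
private abbreviation "N \<equiv> tensor_kernel K V W"
private abbreviation "q \<equiv> (\<lambda>t. N +>\<^bsub>F\<^esub> t)"

interpretation F: module K F by (rule module_free_module[OF V.R.cring_axioms])

lemma basis_pair_closed: "\<lbrakk>v \<in> carrier V; w \<in> carrier W\<rbrakk> \<Longrightarrow> basis_elt K (v, w) \<in> carrier F"
  by (intro basis_elt_closed V.R.cring_axioms) auto

lemma tensor_relations_subset: "tensor_relations K V W \<subseteq> carrier F"
proof -
  \<comment> \<open>With the pointwise formulas switched off, the operations of the free module stay
    opaque and the abstract module rules apply.\<close>
  note [simp del] = free_module_sel
  show ?thesis
    unfolding tensor_relations_def Let_def
    by (intro Un_least subsetI; elim CollectE exE conjE; hypsubst)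
      (intro F.M.minus_closed F.M.a_closed F.smult_closed basis_pair_closed V.M.a_closed W.M.a_closed
        V.smult_closed W.smult_closed; assumption)+
qed

lemma submodule_tensor_kernel: "submodule N K F"
proof -
  let ?S = "{t. submodule t K F \<and> tensor_relations K V W \<subseteq> t}"
  have S: "submodule t K F" if "t \<in> ?S" for t using that by simp
  \<comment> \<open>The whole space belongs to the family, so the intersection is not the vacuous
    \<open>UNIV\<close> and stays inside the carrier.\<close>
  have C: "carrier F \<in> ?S"
    using tensor_relations_subset F.carrier_is_submodule by simp
  have "submodule (\<Inter>?S) K F"
  proof (rule F.submoduleI)
    show "\<Inter>?S \<subseteq> carrier F" using C by (rule Inter_lower)
    show "\<zero>\<^bsub>F\<^esub> \<in> \<Inter>?S"
    proof (rule InterI)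
      fix t assume "t \<in> ?S"
      from subgroup.one_closed[OF submodule.axioms(1)[OF S[OF this]]]
      show "\<zero>\<^bsub>F\<^esub> \<in> t" by (simp del: free_module_sel)
    qed
    show "\<ominus>\<^bsub>F\<^esub> a \<in> \<Inter>?S" if "a \<in> \<Inter>?S" for a
      by (rule InterI) (rule F.submoduleE(3)[OF S InterD[OF that]])
    show "a \<oplus>\<^bsub>F\<^esub> b \<in> \<Inter>?S" if "a \<in> \<Inter>?S" "b \<in> \<Inter>?S" for a b
      by (rule InterI) (rule F.submoduleE(5)[OF S InterD[OF that(1)] InterD[OF that(2)]])
    show "a \<odot>\<^bsub>F\<^esub> b \<in> \<Inter>?S" if "a \<in> carrier K" "b \<in> \<Inter>?S" for a b
      by (rule InterI) (rule F.submoduleE(4)[OF S that(1) InterD[OF that(2)]])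
  qed
  then show ?thesis by (simp add: tensor_kernel_def hull_def)
qed

lemma module_tensor: "module K (tensor_module K V W)"
  unfolding tensor_module_def by (rule module_quotient_module[OF F.module_axioms submodule_tensor_kernel])

lemma tensor_proj_linear: "is_linear K F (tensor_module K V W) q"
  unfolding tensor_module_def by (rule quotient_map_linear[OF F.module_axioms submodule_tensor_kernel])

lemma tensor_proj_eq:
  assumes "x \<ominus>\<^bsub>F\<^esub> y \<in> tensor_relations K V W" "x \<in> carrier F" "y \<in> carrier F"
  shows "q x = q y"
proof -
  have "tensor_relations K V W \<subseteq> N" unfolding tensor_kernel_def by (rule hull_subset)
  then have "x \<ominus>\<^bsub>F\<^esub> y \<in> N" using assms(1) by (rule subsetD)
  then show ?thesis by (rule quotient_map_eq[OF F.module_axioms submodule_tensor_kernel assms(2,3)])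
qed

lemma tensor_closed:
  "\<lbrakk>v \<in> carrier V; w \<in> carrier W\<rbrakk> \<Longrightarrow> tensor K V W v w \<in> carrier (tensor_module K V W)"
  unfolding tensor_def by (rule is_linear_closed[OF tensor_proj_linear basis_pair_closed])

text \<open>The four linearity laws are the four families in \<open>tensor_relations\<close>, read
  modulo the kernel they generate.\<close>

lemma tensor_bilinear: "is_bilinear K V W (tensor_module K V W) (\<lambda>(v, w). tensor K V W v w)"
proof -
  note [simp del] = free_module_sel
  note b = basis_pair_closed
  note qadd = is_linear_add[OF tensor_proj_linear]
  note qsm = is_linear_smult[OF tensor_proj_linear]
  note ac = F.M.a_closed F.smult_closed
  show ?thesis
    unfolding is_bilinear_def
  proof (intro conjI ballI is_linearI; (simp only: prod.case)?)
    fix w u v assume *: "w \<in> carrier W" "u \<in> carrier V" "v \<in> carrier V"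
    have "q (basis_elt K (u \<oplus>\<^bsub>V\<^esub> v, w)) = q (basis_elt K (u, w) \<oplus>\<^bsub>F\<^esub> basis_elt K (v, w))"
      using * by (intro tensor_proj_eq b ac V.M.a_closed) (auto simp: tensor_relations_def Let_def)
    then show "tensor K V W (u \<oplus>\<^bsub>V\<^esub> v) w = tensor K V W u w \<oplus>\<^bsub>tensor_module K V W\<^esub> tensor K V W v w"
      using * b by (simp add: qadd tensor_def)
  next
    fix w a v assume *: "w \<in> carrier W" "a \<in> carrier K" "v \<in> carrier V"
    have "q (basis_elt K (a \<odot>\<^bsub>V\<^esub> v, w)) = q (a \<odot>\<^bsub>F\<^esub> basis_elt K (v, w))"
      using * by (intro tensor_proj_eq b ac V.smult_closed) (auto simp: tensor_relations_def Let_def)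
    then show "tensor K V W (a \<odot>\<^bsub>V\<^esub> v) w = a \<odot>\<^bsub>tensor_module K V W\<^esub> tensor K V W v w"
      using * b by (simp add: qsm tensor_def)
  next
    fix v u w assume *: "v \<in> carrier V" "u \<in> carrier W" "w \<in> carrier W"
    have "q (basis_elt K (v, u \<oplus>\<^bsub>W\<^esub> w)) = q (basis_elt K (v, u) \<oplus>\<^bsub>F\<^esub> basis_elt K (v, w))"
      using * by (intro tensor_proj_eq b ac W.M.a_closed) (auto simp: tensor_relations_def Let_def)
    then show "tensor K V W v (u \<oplus>\<^bsub>W\<^esub> w) = tensor K V W v u \<oplus>\<^bsub>tensor_module K V W\<^esub> tensor K V W v w"
      using * b by (simp add: qadd tensor_def)
  next
    fix v a w assume *: "v \<in> carrier V" "a \<in> carrier K" "w \<in> carrier W"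
    have "q (basis_elt K (v, a \<odot>\<^bsub>W\<^esub> w)) = q (a \<odot>\<^bsub>F\<^esub> basis_elt K (v, w))"
      using * by (intro tensor_proj_eq b ac W.smult_closed) (auto simp: tensor_relations_def Let_def)
    then show "tensor K V W v (a \<odot>\<^bsub>W\<^esub> w) = a \<odot>\<^bsub>tensor_module K V W\<^esub> tensor K V W v w"
      using * b by (simp add: qsm tensor_def)
  qed (simp_all add: tensor_closed)
qed

lemma tensor_moduleE:
  assumes "T \<in> carrier (tensor_module K V W)"
  obtains t where "t \<in> carrier F" "T = q t"
  using assms carrier_quotient_module[OF F.module_axioms submodule_tensor_kernel]
  unfolding tensor_module_def by blast

text \<open>Pure tensors are the images of the basis of the free space on pairs, so agreement on
  them is agreement on a basis after pulling back along the projection.\<close>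

lemma tensor_ext:
  assumes U: "module K U" and f: "is_linear K (tensor_module K V W) U f" and g: "is_linear K (tensor_module K V W) U g"
    and eq: "\<And>v w. \<lbrakk>v \<in> carrier V; w \<in> carrier W\<rbrakk> \<Longrightarrow> f (tensor K V W v w) = g (tensor K V W v w)"
    and T: "T \<in> carrier (tensor_module K V W)"
  shows "f T = g T"
proof -
  obtain t where t: "t \<in> carrier F" "T = q t" using tensor_moduleE[OF T] .
  have "f (q t) = g (q t)"
    using eq unfolding tensor_def
    by (intro free_module_ext[OF U is_linear_comp[OF tensor_proj_linear f]
          is_linear_comp[OF tensor_proj_linear g] _ t(1)]) auto
  then show ?thesis using t by simp
qed

context
  fixes U :: "('k, 'u) module" and \<phi> :: "'v \<times> 'w \<Rightarrow> 'u"
  assumes U: "module K U" and \<phi>: "is_bilinear K V W U \<phi>"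
begin

interpretation U: module K U by (rule U)

private lemma \<phi>_closed: "\<phi> \<in> carrier V \<times> carrier W \<rightarrow> carrier U"
  using is_bilinear_closed[OF \<phi>] by auto

private lemma lift_linear: "is_linear K F U (free_lift K U \<phi>)"
  by (rule free_lift_linear[OF U \<phi>_closed])

private lemma lift_basis: "\<lbrakk>v \<in> carrier V; w \<in> carrier W\<rbrakk> \<Longrightarrow> free_lift K U \<phi> (basis_elt K (v, w)) = \<phi> (v, w)"
  using \<phi>_closed by (intro free_lift_basis U) auto

text \<open>The zero set of the linear extension is a submodule, and bilinearity of
  \<open>\<phi>\<close> puts the relations into it; minimality of the hull does the rest.\<close>

private lemma lift_kernel:
  assumes "t \<in> N" shows "free_lift K U \<phi> t = \<zero>\<^bsub>U\<^esub>"
proof -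
  note [simp del] = free_module_sel
  let ?L = "free_lift K U \<phi>"
  let ?Z = "{t \<in> carrier F. ?L t = \<zero>\<^bsub>U\<^esub>}"
  have *: "?L (x \<ominus>\<^bsub>F\<^esub> y) = \<zero>\<^bsub>U\<^esub>" if "x \<in> carrier F" "y \<in> carrier F" "?L x = ?L y" for x y
    using that is_linear_closed[OF lift_linear]
    by (simp add: is_linear_minus[OF F.module_axioms U lift_linear] U.M.minus_eq U.M.r_neg)
  have "tensor_relations K V W \<subseteq> ?Z"
    using tensor_relations_subset unfolding tensor_relations_def Let_def
    by (auto intro!: * basis_pair_closed F.M.a_closed F.smult_closed
        simp: lift_basis is_linear_add[OF lift_linear] is_linear_smult[OF lift_linear] basis_pair_closed
          is_linear_add[OF is_bilinearD(1)[OF \<phi>]] is_linear_add[OF is_bilinearD(2)[OF \<phi>]]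
          is_linear_smult[OF is_bilinearD(1)[OF \<phi>]] is_linear_smult[OF is_bilinearD(2)[OF \<phi>]])
  moreover have "submodule ?Z K F" by (rule submodule_kernel[OF F.module_axioms U lift_linear])
  ultimately have "N \<subseteq> ?Z" unfolding tensor_kernel_def by (rule hull_minimal)
  then show ?thesis using assms by blast
qed

private lemma tensor_lift_proj:
  assumes "t \<in> carrier F" shows "tensor_lift K U \<phi> (q t) = free_lift K U \<phi> t"
  unfolding tensor_lift_def
  using linear_const_on_coset[OF F.module_axioms submodule_tensor_kernel U lift_linear lift_kernel assms]
  by simp

lemma tensor_lift_tensor:
  "\<lbrakk>v \<in> carrier V; w \<in> carrier W\<rbrakk> \<Longrightarrow> tensor_lift K U \<phi> (tensor K V W v w) = \<phi> (v, w)"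
  unfolding tensor_def by (simp add: tensor_lift_proj basis_pair_closed lift_basis)

lemma tensor_lift_linear: "is_linear K (tensor_module K V W) U (tensor_lift K U \<phi>)"
proof (rule is_linearI)
  note [simp del] = free_module_sel
  fix S T assume "S \<in> carrier (tensor_module K V W)" "T \<in> carrier (tensor_module K V W)"
  then obtain s t where st: "s \<in> carrier F" "S = q s" "t \<in> carrier F" "T = q t"
    using tensor_moduleE by metis
  then show "tensor_lift K U \<phi> (S \<oplus>\<^bsub>tensor_module K V W\<^esub> T) = tensor_lift K U \<phi> S \<oplus>\<^bsub>U\<^esub> tensor_lift K U \<phi> T"
    using is_linear_add[OF tensor_proj_linear st(1,3)] F.M.a_closed[OF st(1,3)]
    by (simp add: tensor_lift_proj is_linear_add[OF lift_linear] flip: is_linear_add[OF tensor_proj_linear])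
next
  note [simp del] = free_module_sel
  fix a T assume a: "a \<in> carrier K" and "T \<in> carrier (tensor_module K V W)"
  then obtain t where t: "t \<in> carrier F" "T = q t"
    using tensor_moduleE by metis
  then show "tensor_lift K U \<phi> (a \<odot>\<^bsub>tensor_module K V W\<^esub> T) = a \<odot>\<^bsub>U\<^esub> tensor_lift K U \<phi> T"
    using a F.smult_closed[OF a t(1)]
    by (simp add: tensor_lift_proj is_linear_smult[OF lift_linear] flip: is_linear_smult[OF tensor_proj_linear])
next
  fix T assume "T \<in> carrier (tensor_module K V W)"
  then obtain t where "t \<in> carrier F" "T = q t" using tensor_moduleE by metis
  then show "tensor_lift K U \<phi> T \<in> carrier U"
    by (simp add: tensor_lift_proj is_linear_closed[OF lift_linear])
qed

end

end

section \<open>Modules over a linear category\<close>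

text \<open>The fragment of linear-category structure on which objectwise constructions with
  \<open>D\<close>-modules rest. Bilinearity of composition joins it in
  \<open>linearized_category\<close>.\<close>

locale prelinear_category =
  fixes K :: "('k, 'c) ring_scheme" and D :: "('k, 'o, 'v) lincat"
  assumes field_K: "field K"
    and module_LHom: "\<lbrakk>x \<in> LObj D; y \<in> LObj D\<rbrakk> \<Longrightarrow> module K (LHom D x y)"
    and LId_closed: "x \<in> LObj D \<Longrightarrow> LId D x \<in> carrier (LHom D x x)"
    and LComp_closed: "\<lbrakk>x \<in> LObj D; y \<in> LObj D; z \<in> LObj D; f \<in> carrier (LHom D x y); g \<in> carrier (LHom D y z)\<rbrakk>
      \<Longrightarrow> LComp D x y z g f \<in> carrier (LHom D x z)"
begin

lemma cring_K: "cring K"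
  using field_K by (simp add: field.axioms(1) domain.axioms(1))

lemma
  assumes "is_dmod K D M"
  shows dmod_module: "x \<in> LObj D \<Longrightarrow> module K (FObj M x)"
    and dmod_linear: "\<lbrakk>x \<in> LObj D; y \<in> LObj D; f \<in> carrier (LHom D x y)\<rbrakk>
      \<Longrightarrow> is_linear K (FObj M x) (FObj M y) (FMor M x y f)"
    and dmod_add: "\<lbrakk>x \<in> LObj D; y \<in> LObj D; f \<in> carrier (LHom D x y); g \<in> carrier (LHom D x y); v \<in> carrier (FObj M x)\<rbrakk>
      \<Longrightarrow> FMor M x y (f \<oplus>\<^bsub>LHom D x y\<^esub> g) v = FMor M x y f v \<oplus>\<^bsub>FObj M y\<^esub> FMor M x y g v"
    and dmod_smult: "\<lbrakk>x \<in> LObj D; y \<in> LObj D; a \<in> carrier K; f \<in> carrier (LHom D x y); v \<in> carrier (FObj M x)\<rbrakk>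
      \<Longrightarrow> FMor M x y (a \<odot>\<^bsub>LHom D x y\<^esub> f) v = a \<odot>\<^bsub>FObj M y\<^esub> FMor M x y f v"
    and dmod_id: "\<lbrakk>x \<in> LObj D; v \<in> carrier (FObj M x)\<rbrakk> \<Longrightarrow> FMor M x x (LId D x) v = v"
    and dmod_comp: "\<lbrakk>x \<in> LObj D; y \<in> LObj D; z \<in> LObj D; f \<in> carrier (LHom D x y); g \<in> carrier (LHom D y z);
        v \<in> carrier (FObj M x)\<rbrakk>
      \<Longrightarrow> FMor M x z (LComp D x y z g f) v = FMor M y z g (FMor M x y f v)"
  using assms
  by (auto simp: linear_functor_def Kmod_def is_linear_def hom_module_def Pi_iff compose_def restrict_def)

lemma dmod_closed:
  assumes "is_dmod K D M" "x \<in> LObj D" "y \<in> LObj D" "f \<in> carrier (LHom D x y)" "v \<in> carrier (FObj M x)"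
  shows "FMor M x y f v \<in> carrier (FObj M y)"
  using is_linear_closed[OF dmod_linear[OF assms(1-4)] assms(5)] .

lemma dmod_linear_mor:
  assumes "is_dmod K D M" "x \<in> LObj D" "y \<in> LObj D" "v \<in> carrier (FObj M x)"
  shows "is_linear K (LHom D x y) (FObj M y) (\<lambda>f. FMor M x y f v)"
  using assms by (intro is_linearI dmod_closed dmod_add dmod_smult)

end

text \<open>Restricting to carriers, here and in \<open>mk_nat\<close>, supplies the extensionality
  demanded by \<open>hom_module\<close> and \<open>nat_trans\<close>, so \<open>h\<close> may be any
  formula that is correct on the carriers.\<close>

definition mk_dmod :: "('o \<Rightarrow> ('k, 'm) module) \<Rightarrow> ('o \<Rightarrow> 'o \<Rightarrow> 'v \<Rightarrow> 'm \<Rightarrow> 'm) \<Rightarrow> ('k, 'o, 'v, 'm) dmod"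
  where "mk_dmod V h = \<lparr>FObj = V, FMor = (\<lambda>x y f. \<lambda>v\<in>carrier (V x). h x y f v)\<rparr>"

definition mk_nat :: "('k, 'o, 'v) lincat \<Rightarrow> ('k, 'o, 'v, 'm) dmod \<Rightarrow> ('o \<Rightarrow> 'm \<Rightarrow> 'n) \<Rightarrow> 'o \<Rightarrow> 'm \<Rightarrow> 'n"
  where "mk_nat D M h = (\<lambda>x\<in>LObj D. \<lambda>v\<in>carrier (FObj M x). h x v)"

lemma FObj_mk_dmod [simp]: "FObj (mk_dmod V h) = V"
  and FMor_mk_dmod [simp]: "v \<in> carrier (V x) \<Longrightarrow> FMor (mk_dmod V h) x y f v = h x y f v"
  by (simp_all add: mk_dmod_def)

lemma mk_nat_apply [simp]:
  "\<lbrakk>x \<in> LObj D; v \<in> carrier (FObj M x)\<rbrakk> \<Longrightarrow> mk_nat D M h x v = h x v"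
  by (simp add: mk_nat_def)

lemma mk_nat_cong:
  "(\<And>x v. \<lbrakk>x \<in> LObj D; v \<in> carrier (FObj M x)\<rbrakk> \<Longrightarrow> h x v = h' x v) \<Longrightarrow> mk_nat D M h = mk_nat D M h'"
  unfolding mk_nat_def by (intro restrict_ext) auto

lemma nat_comp_eq: "nat_comp D M \<tau> \<sigma> = mk_nat D M (\<lambda>x v. \<tau> x (\<sigma> x v))"
  by (simp add: nat_comp_def mk_nat_def compose_def)

lemma nat_trans_module_sel:
  "carrier (nat_trans_module K D M N) = nat_trans K D M N"
  "\<zero>\<^bsub>nat_trans_module K D M N\<^esub> = mk_nat D M (\<lambda>x v. \<zero>\<^bsub>FObj N x\<^esub>)"
  "\<sigma> \<oplus>\<^bsub>nat_trans_module K D M N\<^esub> \<tau> = mk_nat D M (\<lambda>x v. \<sigma> x v \<oplus>\<^bsub>FObj N x\<^esub> \<tau> x v)"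
  by (simp_all add: nat_trans_module_def hom_module_def mk_nat_def)

text \<open>Natural transformations are extensional over objects and over carriers, so their values
  there determine them as HOL functions. Equality becomes a pointwise test.\<close>

lemma nat_trans_eq_mk_nat: "\<tau> \<in> nat_trans K D M N \<Longrightarrow> \<tau> = mk_nat D M \<tau>"
  by (rule ext, rule ext)
    (auto simp: nat_trans_def mk_nat_def hom_module_def PiE_iff extensional_def restrict_def)

lemma nat_trans_eqI:
  assumes "\<sigma> \<in> nat_trans K D M N" "\<tau> \<in> nat_trans K D M N'"
    and "\<And>x v. \<lbrakk>x \<in> LObj D; v \<in> carrier (FObj M x)\<rbrakk> \<Longrightarrow> \<sigma> x v = \<tau> x v"
  shows "\<sigma> = \<tau>"
  using nat_trans_eq_mk_nat[OF assms(1)] nat_trans_eq_mk_nat[OF assms(2)] mk_nat_cong[of D M \<sigma> \<tau>] assms(3)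
  by simp

context prelinear_category
begin

lemma mk_dmodI:
  assumes "\<And>x. x \<in> LObj D \<Longrightarrow> module K (V x)"
    and "\<And>x y f. \<lbrakk>x \<in> LObj D; y \<in> LObj D; f \<in> carrier (LHom D x y)\<rbrakk> \<Longrightarrow> is_linear K (V x) (V y) (h x y f)"
    and "\<And>x y v. \<lbrakk>x \<in> LObj D; y \<in> LObj D; v \<in> carrier (V x)\<rbrakk> \<Longrightarrow> is_linear K (LHom D x y) (V y) (\<lambda>f. h x y f v)"
    and "\<And>x v. \<lbrakk>x \<in> LObj D; v \<in> carrier (V x)\<rbrakk> \<Longrightarrow> h x x (LId D x) v = v"
    and "\<And>x y z f g v. \<lbrakk>x \<in> LObj D; y \<in> LObj D; z \<in> LObj D; f \<in> carrier (LHom D x y); g \<in> carrier (LHom D y z);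
        v \<in> carrier (V x)\<rbrakk> \<Longrightarrow> h x z (LComp D x y z g f) v = h y z g (h x y f v)"
  shows "is_dmod K D (mk_dmod V h)"
  unfolding linear_functor_def
proof (intro conjI ballI)
  let ?M = "mk_dmod V h"
  show "FObj ?M \<in> LObj D \<rightarrow> LObj (Kmod K)"
    using assms(1) by (simp add: Kmod_def)
  fix x assume x: "x \<in> LObj D"
  show "FMor ?M x x (LId D x) = LId (Kmod K) (FObj ?M x)"
    using x assms(4) by (auto simp: mk_dmod_def Kmod_def)
  fix y assume y: "y \<in> LObj D"
  show "is_linear K (LHom D x y) (LHom (Kmod K) (FObj ?M x) (FObj ?M y)) (FMor ?M x y)"
  proof (rule is_linearI)
    fix f assume f: "f \<in> carrier (LHom D x y)"
    have "is_linear K (V x) (V y) (\<lambda>v\<in>carrier (V x). h x y f v)"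
      by (rule is_linear_cong[OF assms(2)[OF x y f] assms(1)[OF x]]) simp
    then show "FMor ?M x y f \<in> carrier (LHom (Kmod K) (FObj ?M x) (FObj ?M y))"
      by (simp add: mk_dmod_def Kmod_def hom_module_def)
  next
    fix f g assume "f \<in> carrier (LHom D x y)" "g \<in> carrier (LHom D x y)"
    then show "FMor ?M x y (f \<oplus>\<^bsub>LHom D x y\<^esub> g) = FMor ?M x y f
        \<oplus>\<^bsub>LHom (Kmod K) (FObj ?M x) (FObj ?M y)\<^esub> FMor ?M x y g"
      using is_linear_add[OF assms(3)[OF x y]] by (auto simp: mk_dmod_def Kmod_def hom_module_def)
  next
    fix a f assume "a \<in> carrier K" "f \<in> carrier (LHom D x y)"
    then show "FMor ?M x y (a \<odot>\<^bsub>LHom D x y\<^esub> f) =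
        a \<odot>\<^bsub>LHom (Kmod K) (FObj ?M x) (FObj ?M y)\<^esub> FMor ?M x y f"
      using is_linear_smult[OF assms(3)[OF x y]] by (auto simp: mk_dmod_def Kmod_def hom_module_def)
  qed
  fix z f g assume z: "z \<in> LObj D" and fg: "f \<in> carrier (LHom D x y)" "g \<in> carrier (LHom D y z)"
  show "FMor ?M x z (LComp D x y z g f) =
      LComp (Kmod K) (FObj ?M x) (FObj ?M y) (FObj ?M z)
        (FMor ?M y z g) (FMor ?M x y f)"
    using assms(5)[OF x y z fg] is_linear_closed[OF assms(2)[OF x y fg(1)]]
    by (auto simp: mk_dmod_def Kmod_def compose_def)
qed

lemma
  assumes "\<tau> \<in> nat_trans K D M N"
  shows nat_trans_linear: "x \<in> LObj D \<Longrightarrow> is_linear K (FObj M x) (FObj N x) (\<tau> x)"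
    and nat_trans_closed: "\<lbrakk>x \<in> LObj D; v \<in> carrier (FObj M x)\<rbrakk> \<Longrightarrow> \<tau> x v \<in> carrier (FObj N x)"
    and nat_trans_natural: "\<lbrakk>x \<in> LObj D; y \<in> LObj D; f \<in> carrier (LHom D x y); v \<in> carrier (FObj M x)\<rbrakk>
      \<Longrightarrow> \<tau> y (FMor M x y f v) = FMor N x y f (\<tau> x v)"
proof -
  show lin: "is_linear K (FObj M x) (FObj N x) (\<tau> x)" if "x \<in> LObj D" for x
    using assms that by (auto simp: nat_trans_def hom_module_def)
  show "\<tau> x v \<in> carrier (FObj N x)" if "x \<in> LObj D" "v \<in> carrier (FObj M x)"
    using is_linear_closed[OF lin] that by blast
  assume *: "x \<in> LObj D" "y \<in> LObj D" "f \<in> carrier (LHom D x y)" "v \<in> carrier (FObj M x)"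
  then have "compose (carrier (FObj M x)) (\<tau> y) (FMor M x y f) v = compose (carrier (FObj M x)) (FMor N x y f) (\<tau> x) v"
    using assms by (auto simp: nat_trans_def)
  then show "\<tau> y (FMor M x y f v) = FMor N x y f (\<tau> x v)"
    using * by (simp add: compose_def)
qed

lemma mk_natI:
  assumes "is_dmod K D M"
    and "\<And>x. x \<in> LObj D \<Longrightarrow> is_linear K (FObj M x) (FObj N x) (h x)"
    and "\<And>x y f v. \<lbrakk>x \<in> LObj D; y \<in> LObj D; f \<in> carrier (LHom D x y); v \<in> carrier (FObj M x)\<rbrakk>
      \<Longrightarrow> h y (FMor M x y f v) = FMor N x y f (h x v)"
  shows "mk_nat D M h \<in> nat_trans K D M N"
proof -
  have "is_linear K (FObj M x) (FObj N x) (\<lambda>v\<in>carrier (FObj M x). h x v)" if "x \<in> LObj D" for x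
    by (rule is_linear_cong[OF assms(2)[OF that] dmod_module[OF assms(1) that]]) simp
  then show ?thesis
    using assms(3) dmod_closed[OF assms(1)]
    by (auto simp: nat_trans_def mk_nat_def hom_module_def compose_def)
qed

lemma nat_comp_apply:
  "\<lbrakk>x \<in> LObj D; v \<in> carrier (FObj M x)\<rbrakk> \<Longrightarrow> nat_comp D M \<tau> \<sigma> x v = \<tau> x (\<sigma> x v)"
  by (simp add: nat_comp_eq)

lemma nat_comp_closed:
  assumes "is_dmod K D L" "\<sigma> \<in> nat_trans K D L M" "\<tau> \<in> nat_trans K D M N"
  shows "nat_comp D L \<tau> \<sigma> \<in> nat_trans K D L N"
  unfolding nat_comp_eq
  using assms nat_trans_closed[OF assms(2)]
  by (intro mk_natI is_linear_comp[OF nat_trans_linear[OF assms(2)] nat_trans_linear[OF assms(3)]])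
    (auto simp: nat_trans_natural[OF assms(2)] nat_trans_natural[OF assms(3)])

text \<open>One scalar suffices for the uses below: 1 gives sums of cochains and -1 gives
  differences such as 1 - t.\<close>

lemma nat_trans_lincomb:
  assumes M: "is_dmod K D M" and N: "is_dmod K D N"
    and \<sigma>: "\<sigma> \<in> nat_trans K D M N" and \<tau>: "\<tau> \<in> nat_trans K D M N" and a: "a \<in> carrier K"
  shows "mk_nat D M (\<lambda>x v. \<sigma> x v \<oplus>\<^bsub>FObj N x\<^esub> a \<odot>\<^bsub>FObj N x\<^esub> \<tau> x v) \<in> nat_trans K D M N"
proof (rule mk_natI[OF M])
  fix x assume x: "x \<in> LObj D"
  show "is_linear K (FObj M x) (FObj N x) (\<lambda>v. \<sigma> x v \<oplus>\<^bsub>FObj N x\<^esub> a \<odot>\<^bsub>FObj N x\<^esub> \<tau> x v)"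
    by (intro is_linear_plus is_linear_scale dmod_module[OF M x] dmod_module[OF N x]
        nat_trans_linear[OF \<sigma> x] nat_trans_linear[OF \<tau> x] a)
next
  fix x y f v assume *: "x \<in> LObj D" "y \<in> LObj D" "f \<in> carrier (LHom D x y)" "v \<in> carrier (FObj M x)"
  note lin = dmod_linear[OF N *(1-3)]
  have c: "\<sigma> x v \<in> carrier (FObj N x)" "\<tau> x v \<in> carrier (FObj N x)"
    using * nat_trans_closed[OF \<sigma>] nat_trans_closed[OF \<tau>] by auto
  then show "\<sigma> y (FMor M x y f v) \<oplus>\<^bsub>FObj N y\<^esub> a \<odot>\<^bsub>FObj N y\<^esub> \<tau> y (FMor M x y f v) =
      FMor N x y f (\<sigma> x v \<oplus>\<^bsub>FObj N x\<^esub> a \<odot>\<^bsub>FObj N x\<^esub> \<tau> x v)"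
    using a module.smult_closed[OF dmod_module[OF N *(1)] a c(2)]
    by (simp add: nat_trans_natural[OF \<sigma> *] nat_trans_natural[OF \<tau> *] is_linear_add[OF lin] is_linear_smult[OF lin])
qed

lemma mk_nat_id:
  assumes "is_dmod K D M" shows "mk_nat D M (\<lambda>x v. v) \<in> nat_trans K D M M"
  using assms by (intro mk_natI) (auto intro: is_linearI)

end

subsection \<open>Transport along injections\<close>

text \<open>Transport of structure along a map injective on the carrier. It moves modules into the
  value type over which projectivity quantifies.\<close>

definition copy_module :: "('v \<Rightarrow> 'w) \<Rightarrow> ('k, 'v) module \<Rightarrow> ('k, 'w) module"
  where "copy_module \<iota> V = (let r = inv_into (carrier V) \<iota> in
    \<lparr>carrier = \<iota> ` carrier V,
     monoid.mult = undefined, one = undefined,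
     ring.zero = \<iota> \<zero>\<^bsub>V\<^esub>,
     ring.add = (\<lambda>u v. \<iota> (r u \<oplus>\<^bsub>V\<^esub> r v)),
     module.smult = (\<lambda>a v. \<iota> (a \<odot>\<^bsub>V\<^esub> r v))\<rparr>)"

lemma carrier_copy_module: "carrier (copy_module \<iota> V) = \<iota> ` carrier V"
  by (simp add: copy_module_def Let_def)

lemma copy_linear:
  assumes "inj_on \<iota> (carrier V)"
  shows "is_linear K V (copy_module \<iota> V) \<iota>"
  using assms by (intro is_linearI) (auto simp: copy_module_def Let_def)

lemma module_copy:
  assumes "module K V" "inj_on \<iota> (carrier V)"
  shows "module K (copy_module \<iota> V)"
  using is_linear_add[OF copy_linear[OF assms(2), where K = K]] is_linear_smult[OF copy_linear[OF assms(2)]]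
  by (intro module_surj_image[OF assms(1) carrier_copy_module]) (auto simp: copy_module_def Let_def)

lemma copy_inv_linear:
  assumes "module K V" "inj_on \<iota> (carrier V)"
  shows "is_linear K (copy_module \<iota> V) V (inv_into (carrier V) \<iota>)"
  using assms module_add_closed[OF assms(1)] module.smult_closed[OF assms(1)]
  by (intro is_linearI) (auto simp: copy_module_def Let_def)

context prelinear_category
begin

definition copy_dmod :: "('o \<Rightarrow> 'm \<Rightarrow> 'n) \<Rightarrow> ('k, 'o, 'v, 'm) dmod \<Rightarrow> ('k, 'o, 'v, 'n) dmod"
  where "copy_dmod \<iota> M = mk_dmod (\<lambda>x. copy_module (\<iota> x) (FObj M x))
    (\<lambda>x y f w. \<iota> y (FMor M x y f (inv_into (carrier (FObj M x)) (\<iota> x) w)))"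

context
  fixes M :: "('k, 'o, 'v, 'm) dmod" and \<iota> :: "'o \<Rightarrow> 'm \<Rightarrow> 'n"
  assumes M: "is_dmod K D M" and \<iota>: "\<And>x. x \<in> LObj D \<Longrightarrow> inj_on (\<iota> x) (carrier (FObj M x))"
begin

private abbreviation "r x \<equiv> inv_into (carrier (FObj M x)) (\<iota> x)"

private abbreviation "cV x \<equiv> copy_module (\<iota> x) (FObj M x)"

private lemma copy_lin:
  assumes "x \<in> LObj D"
  shows "is_linear K (FObj M x) (cV x) (\<iota> x)"
    and "is_linear K (cV x) (FObj M x) (r x)"
  using assms by (auto intro!: copy_linear copy_inv_linear \<iota> dmod_module[OF M])

lemma copy_dmod: "is_dmod K D (copy_dmod \<iota> M)"
  unfolding copy_dmod_def
proof (rule mk_dmodI)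
  fix x y f assume *: "x \<in> LObj D" "y \<in> LObj D" "f \<in> carrier (LHom D x y)"
  show "is_linear K (cV x) (cV y) (\<lambda>w. \<iota> y (FMor M x y f (r x w)))"
    by (rule is_linear_comp[OF is_linear_comp[OF copy_lin(2) dmod_linear[OF M *]] copy_lin(1)]) fact+
next
  fix x y v assume *: "x \<in> LObj D" "y \<in> LObj D" "v \<in> carrier (cV x)"
  show "is_linear K (LHom D x y) (cV y) (\<lambda>f. \<iota> y (FMor M x y f (r x v)))"
    by (rule is_linear_comp[OF dmod_linear_mor[OF M] copy_lin(1)])
      (use * is_linear_closed[OF copy_lin(2)] in auto)
next
  fix x v assume "x \<in> LObj D" "v \<in> carrier (cV x)"
  then show "\<iota> x (FMor M x x (LId D x) (r x v)) = v"
    using \<iota> by (auto simp: carrier_copy_module dmod_id[OF M])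
next
  fix x y z f g v assume "x \<in> LObj D" "y \<in> LObj D" "z \<in> LObj D" "f \<in> carrier (LHom D x y)"
    "g \<in> carrier (LHom D y z)" "v \<in> carrier (cV x)"
  then show "\<iota> z (FMor M x z (LComp D x y z g f) (r x v)) = \<iota> z (FMor M y z g (r y (\<iota> y (FMor M x y f (r x v)))))"
    using \<iota> by (auto simp: carrier_copy_module dmod_comp[OF M] dmod_closed[OF M])
qed (use \<iota> in \<open>auto intro: module_copy dmod_module[OF M]\<close>)

lemma copy_dmod_to: "mk_nat D M \<iota> \<in> nat_trans K D M (copy_dmod \<iota> M)"
  using copy_lin \<iota> by (intro mk_natI M) (auto simp: copy_dmod_def carrier_copy_module)

lemma copy_dmod_from: "mk_nat D (copy_dmod \<iota> M) r \<in> nat_trans K D (copy_dmod \<iota> M) M"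
  using copy_lin \<iota> by (intro mk_natI copy_dmod) (auto simp: copy_dmod_def carrier_copy_module dmod_closed[OF M])

lemma copy_dmod_carrier: "carrier (FObj (copy_dmod \<iota> M) x) = \<iota> x ` carrier (FObj M x)"
  by (simp add: copy_dmod_def carrier_copy_module)

end

end

subsection \<open>Kernels\<close>

definition kernel_dmod :: "('k, 'o, 'v, 'm) dmod \<Rightarrow> ('o \<Rightarrow> 'm \<Rightarrow> 'n) \<Rightarrow> ('k, 'o, 'v, 'n) dmod \<Rightarrow> ('k, 'o, 'v, 'm) dmod"
  where "kernel_dmod M \<tau> N = mk_dmod
    (\<lambda>x. (FObj M x)\<lparr>carrier := {v \<in> carrier (FObj M x). \<tau> x v = \<zero>\<^bsub>FObj N x\<^esub>}\<rparr>) (FMor M)"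

lemma carrier_kernel_dmod: "carrier (FObj (kernel_dmod M \<tau> N) x) = {v \<in> carrier (FObj M x). \<tau> x v = \<zero>\<^bsub>FObj N x\<^esub>}"
  by (simp add: kernel_dmod_def)

lemma kernel_dmod_sel [simp]:
  "\<zero>\<^bsub>FObj (kernel_dmod M \<tau> N) x\<^esub> = \<zero>\<^bsub>FObj M x\<^esub>"
  "u \<oplus>\<^bsub>FObj (kernel_dmod M \<tau> N) x\<^esub> v = u \<oplus>\<^bsub>FObj M x\<^esub> v"
  "a \<odot>\<^bsub>FObj (kernel_dmod M \<tau> N) x\<^esub> v = a \<odot>\<^bsub>FObj M x\<^esub> v"
  by (simp_all add: kernel_dmod_def)

lemma FMor_kernel_dmod:
  "v \<in> carrier (FObj (kernel_dmod M \<tau> N) x) \<Longrightarrow> FMor (kernel_dmod M \<tau> N) x y f v = FMor M x y f v"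
  by (simp add: kernel_dmod_def)

context prelinear_category
begin

lemma kernel_dmod:
  assumes M: "is_dmod K D M" and N: "is_dmod K D N" and \<tau>: "\<tau> \<in> nat_trans K D M N"
  shows "is_dmod K D (kernel_dmod M \<tau> N)"
proof -
  let ?V = "\<lambda>x. (FObj M x)\<lparr>carrier := {v \<in> carrier (FObj M x). \<tau> x v = \<zero>\<^bsub>FObj N x\<^esub>}\<rparr>"
  show ?thesis
    unfolding kernel_dmod_def
  proof (rule mk_dmodI)
    fix x assume x: "x \<in> LObj D"
    show "module K (?V x)"
      using x M N \<tau>
      by (intro submodule.submodule_is_module submodule_kernel dmod_module nat_trans_linear)
  next
    fix x y f assume *: "x \<in> LObj D" "y \<in> LObj D" "f \<in> carrier (LHom D x y)"
    show "is_linear K (?V x) (?V y) (FMor M x y f)"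
      using * dmod_linear[OF M *] is_linear_zero[OF dmod_module[OF N *(1)] dmod_module[OF N *(2)] dmod_linear[OF N *]]
      by (intro is_linearI)
        (auto simp: dmod_closed[OF M] nat_trans_natural[OF \<tau>] is_linear_add is_linear_smult)
  next
    fix x y v assume *: "x \<in> LObj D" "y \<in> LObj D" "v \<in> carrier (?V x)"
    then have v: "v \<in> carrier (FObj M x)" "\<tau> x v = \<zero>\<^bsub>FObj N x\<^esub>" by auto
    have "FMor M x y f v \<in> {v \<in> carrier (FObj M y). \<tau> y v = \<zero>\<^bsub>FObj N y\<^esub>}" if f: "f \<in> carrier (LHom D x y)" for f
      using *(1,2) v f is_linear_zero[OF dmod_module[OF N *(1)] dmod_module[OF N *(2)] dmod_linear[OF N *(1,2) f]]
      by (simp add: dmod_closed[OF M] nat_trans_natural[OF \<tau>])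
    then show "is_linear K (LHom D x y) (?V y) (\<lambda>f. FMor M x y f v)"
      using *(1,2) v by (intro is_linearI) (auto simp: dmod_add[OF M] dmod_smult[OF M])
  qed (auto simp: dmod_id[OF M] dmod_comp[OF M])
qed

lemma kernel_dmod_incl:
  assumes M: "is_dmod K D M" and N: "is_dmod K D N" and \<tau>: "\<tau> \<in> nat_trans K D M N"
  shows "mk_nat D (kernel_dmod M \<tau> N) (\<lambda>x v. v) \<in> nat_trans K D (kernel_dmod M \<tau> N) M"
  by (intro mk_natI kernel_dmod[OF assms] is_linearI) (auto simp: carrier_kernel_dmod FMor_kernel_dmod)

text \<open>Extensionality concerns the source only, so the very same function
  \<open>\<sigma>\<close> serves as a map into \<open>M\<close> and as a map into the
  kernel.\<close>

lemma nat_trans_corestrict: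
  assumes L: "is_dmod K D L" and \<sigma>: "\<sigma> \<in> nat_trans K D L M"
    and z: "\<And>x v. \<lbrakk>x \<in> LObj D; v \<in> carrier (FObj L x)\<rbrakk> \<Longrightarrow> \<tau> x (\<sigma> x v) = \<zero>\<^bsub>FObj N x\<^esub>"
  shows "\<sigma> \<in> nat_trans K D L (kernel_dmod M \<tau> N)"
proof -
  have "mk_nat D L \<sigma> \<in> nat_trans K D L (kernel_dmod M \<tau> N)"
    using z nat_trans_closed[OF \<sigma>]
    by (intro mk_natI L is_linearI)
      (auto simp: carrier_kernel_dmod FMor_kernel_dmod is_linear_add[OF nat_trans_linear[OF \<sigma>]]
        is_linear_smult[OF nat_trans_linear[OF \<sigma>]] nat_trans_natural[OF \<sigma>])
  then show ?thesis using nat_trans_eq_mk_nat[OF \<sigma>] by simp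
qed

end

section \<open>Vanishing of the first Ext group\<close>

text \<open>\<open>inv_into\<close> picks some preimage under the surjection \<open>e\<close>; two
  preimages differ by an element of its kernel, which \<open>k\<close> kills, so the value of
  \<open>s\<close> does not depend on the choice.\<close>

lemma is_linear_factor:
  assumes P: "module K P" and A: "module K A" and Q: "module K Q"
    and e: "is_linear K P A e" "e ` carrier P = carrier A" and k: "is_linear K P Q k"
    and ker: "\<And>p. \<lbrakk>p \<in> carrier P; e p = \<zero>\<^bsub>A\<^esub>\<rbrakk> \<Longrightarrow> k p = \<zero>\<^bsub>Q\<^esub>"
  defines "s \<equiv> \<lambda>a. k (inv_into (carrier P) e a)"
  shows "is_linear K A Q s" and "\<And>p. p \<in> carrier P \<Longrightarrow> s (e p) = k p"
proof -
  interpret P: module K P by fact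
  interpret A: module K A by fact
  interpret Q: module K Q by fact
  have eq: "k p = k p'" if "p \<in> carrier P" "p' \<in> carrier P" "e p = e p'" for p p'
  proof -
    have "e (p \<ominus>\<^bsub>P\<^esub> p') = \<zero>\<^bsub>A\<^esub>"
      using that is_linear_closed[OF e(1)] by (simp add: is_linear_minus[OF P A e(1)] A.M.minus_eq A.M.r_neg)
    then have "k p \<ominus>\<^bsub>Q\<^esub> k p' = \<zero>\<^bsub>Q\<^esub>"
      using that ker[of "p \<ominus>\<^bsub>P\<^esub> p'"] by (simp add: is_linear_minus[OF P Q k])
    then show ?thesis
      using that is_linear_closed[OF k] Q.M.minus_equality[of "k p" "\<ominus>\<^bsub>Q\<^esub> k p'"] by (simp add: Q.M.minus_eq)
  qed
  show s: "s (e p) = k p" if "p \<in> carrier P" for p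
    unfolding s_def using that by (intro eq) (auto intro: inv_into_into f_inv_into_f)
  show "is_linear K A Q s"
  proof (rule is_linearI)
    fix a assume "a \<in> carrier A"
    then obtain p where "p \<in> carrier P" "a = e p" unfolding e(2)[symmetric] by blast
    then show "s a \<in> carrier Q" using s is_linear_closed[OF k] by simp
  next
    fix a b assume "a \<in> carrier A" "b \<in> carrier A"
    then obtain p p' where "p \<in> carrier P" "a = e p" "p' \<in> carrier P" "b = e p'"
      unfolding e(2)[symmetric] by blast
    then show "s (a \<oplus>\<^bsub>A\<^esub> b) = s a \<oplus>\<^bsub>Q\<^esub> s b"
      by (simp add: s is_linear_add[OF k] flip: is_linear_add[OF e(1)])
  next
    fix c a assume c: "c \<in> carrier K" and "a \<in> carrier A"
    then obtain p where "p \<in> carrier P" "a = e p" unfolding e(2)[symmetric] by blast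
    then show "s (c \<odot>\<^bsub>A\<^esub> a) = c \<odot>\<^bsub>Q\<^esub> s a"
      using c by (simp add: s is_linear_smult[OF k] flip: is_linear_smult[OF e(1)])
  qed
qed

context prelinear_category
begin

text \<open>An objectwise epimorphism is a cokernel of its kernel. Naturality of the factor is
  checked on elements of the form \<open>e x p\<close>, which are all elements. It is applied once
  to the augmentation and once to the first differential.\<close>

lemma nat_trans_factor:
  assumes P: "is_dmod K D P" and A: "is_dmod K D A" and Q: "is_dmod K D Q"
    and e: "e \<in> nat_trans K D P A" "dmod_epi D P A e" and k: "k \<in> nat_trans K D P Q"
    and ker: "\<And>x p. \<lbrakk>x \<in> LObj D; p \<in> carrier (FObj P x); e x p = \<zero>\<^bsub>FObj A x\<^esub>\<rbrakk> \<Longrightarrow> k x p = \<zero>\<^bsub>FObj Q x\<^esub>"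
  obtains s where "s \<in> nat_trans K D A Q"
    and "\<And>x p. \<lbrakk>x \<in> LObj D; p \<in> carrier (FObj P x)\<rbrakk> \<Longrightarrow> s x (e x p) = k x p"
proof -
  let ?s = "\<lambda>x a. k x (inv_into (carrier (FObj P x)) (e x) a)"
  have surj: "e x ` carrier (FObj P x) = carrier (FObj A x)" if "x \<in> LObj D" for x
    using e(2) that by (simp add: dmod_epi_def)
  note F' = is_linear_factor[OF dmod_module[OF P] dmod_module[OF A] dmod_module[OF Q]
      nat_trans_linear[OF e(1)] surj nat_trans_linear[OF k] ker]
  have F: "is_linear K (FObj A x) (FObj Q x) (?s x)"
    "\<And>p. p \<in> carrier (FObj P x) \<Longrightarrow> ?s x (e x p) = k x p" if "x \<in> LObj D" for x
    using F'(1)[OF that that that that that that that] F'(2)[OF that that that that that that that] by blast+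
  show thesis
  proof
    show "mk_nat D A ?s x (e x p) = k x p" if "x \<in> LObj D" "p \<in> carrier (FObj P x)" for x p
      using that F(2)[OF that] nat_trans_closed[OF e(1) that] by simp
    show "mk_nat D A ?s \<in> nat_trans K D A Q"
    proof (rule mk_natI[OF A])
      fix x y f a assume *: "x \<in> LObj D" "y \<in> LObj D" "f \<in> carrier (LHom D x y)" and "a \<in> carrier (FObj A x)"
      then obtain p where p: "p \<in> carrier (FObj P x)" "a = e x p" using surj by blast
      have "?s y (FMor A x y f a) = ?s y (e y (FMor P x y f p))"
        using * p by (simp add: nat_trans_natural[OF e(1)])
      also have "\<dots> = k y (FMor P x y f p)"
        by (rule F(2)[OF *(2) dmod_closed[OF P * p(1)]])
      also have "\<dots> = FMor Q x y f (?s x a)"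
        using * p F(2)[OF *(1) p(1)] by (simp add: nat_trans_natural[OF k])
      finally show "?s y (FMor A x y f a) = FMor Q x y f (?s x a)" .
    qed (use F(1) in auto)
  qed
qed

lemma projective_resolutionD:
  assumes "projective_resolution K D A R"
  shows "is_dmod K D (rterm R n)"
    and "projective_dmod K D (rterm R n)"
    and "rdiff R n \<in> nat_trans K D (rterm R (Suc n)) (rterm R n)"
    and "raug R \<in> nat_trans K D (rterm R 0) A"
    and "dmod_epi D (rterm R 0) A (raug R)"
    and "x \<in> LObj D \<Longrightarrow> rdiff R 0 x ` carrier (FObj (rterm R 1) x)
      = {m \<in> carrier (FObj (rterm R 0) x). raug R x m = \<zero>\<^bsub>FObj A x\<^esub>}"
    and "x \<in> LObj D \<Longrightarrow> rdiff R (Suc n) x ` carrier (FObj (rterm R (Suc (Suc n))) x)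
      = {m \<in> carrier (FObj (rterm R (Suc n)) x). rdiff R n x m = \<zero>\<^bsub>FObj (rterm R n) x\<^esub>}"
  using assms by (auto simp: projective_resolution_def projective_dmod_def exact_at_def)

lemma mk_nat_zero:
  assumes "is_dmod K D M" "is_dmod K D N"
  shows "mk_nat D M (\<lambda>x v. \<zero>\<^bsub>FObj N x\<^esub>) \<in> nat_trans K D M N"
proof (rule mk_natI[OF assms(1)])
  fix x assume "x \<in> LObj D"
  then interpret N: module K "FObj N x" by (rule dmod_module[OF assms(2)])
  show "is_linear K (FObj M x) (FObj N x) (\<lambda>v. \<zero>\<^bsub>FObj N x\<^esub>)" by (rule is_linearI) simp_all
qed (use is_linear_zero[OF dmod_module[OF assms(2)] dmod_module[OF assms(2)] dmod_linear[OF assms(2)]] in auto)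

text \<open>\<open>R\<close> is literally the resolution chosen inside \<open>Ext\<close>, whose
  elements unfold to cosets of the set of coboundaries. What remains is coset arithmetic with
  cochains.\<close>

lemma Ext1_trivial_iff:
  fixes A :: "('k, 'o, 'v, 'n) dmod" and B :: "('k, 'o, 'v, 'm) dmod"
  defines "R \<equiv> (SOME R :: ('k, 'o, 'v, 'm, 'n) resolution. projective_resolution K D A R)"
  assumes R: "projective_resolution K D A R" and B: "is_dmod K D B"
  shows "carrier (Ext K D 1 A B) = {\<zero>\<^bsub>Ext K D 1 A B\<^esub>}
    \<longleftrightarrow> ext_cocycles K D R B 1 \<subseteq> ext_coboundaries K D R B 1"
proof -
  let ?P = "rterm R" and ?Z = "ext_cocycles K D R B 1" and ?N = "ext_coboundaries K D R B 1"
  let ?plus = "\<lambda>\<sigma> \<tau>. mk_nat D (?P 1) (\<lambda>x v. \<sigma> x v \<oplus>\<^bsub>FObj B x\<^esub> \<tau> x v)"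
  let ?coset = "\<lambda>\<tau>. (\<lambda>\<sigma>. ?plus \<sigma> \<tau>) ` ?N"
  let ?zero = "mk_nat D (?P 1) (\<lambda>x v. \<zero>\<^bsub>FObj B x\<^esub>)"
  note P = projective_resolutionD(1)[OF R] and d = projective_resolutionD(3)[OF R]
  have d0: "rdiff R 0 \<in> nat_trans K D (?P 1) (?P 0)" using d[of 0] by simp
  have B_group: "abelian_group (FObj B x)" if "x \<in> LObj D" for x
    using module.axioms(2)[OF dmod_module[OF B that]] .
  have carr: "carrier (Ext K D 1 A B) = ?coset ` ?Z"
    unfolding Ext_def Let_def R_def[symmetric]
    by (auto simp: quotient_module_def A_RCOSETS_def' a_r_coset_def' nat_trans_module_sel simp del: ext_coboundaries.simps)
  have zero: "\<zero>\<^bsub>Ext K D 1 A B\<^esub> = ?N"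
    unfolding Ext_def Let_def R_def[symmetric] by (simp add: quotient_module_def)
  have N_iff: "\<sigma> \<in> ?N \<longleftrightarrow> (\<exists>\<sigma>'\<in>nat_trans K D (?P 0) B. \<sigma> = nat_comp D (?P 1) \<sigma>' (rdiff R 0))" for \<sigma>
    by auto
  have N_nt: "?N \<subseteq> nat_trans K D (?P 1) B"
    using nat_comp_closed[OF P d0] by auto
  have Z_nt: "?Z \<subseteq> nat_trans K D (?P 1) B" by (auto simp: ext_cocycles_def)
  have zero_Z: "?zero \<in> ?Z"
    using mk_nat_zero[OF P B] nat_trans_closed[OF d]
    by (auto simp: ext_cocycles_def nat_comp_eq nat_trans_module_sel intro!: mk_nat_cong)
  have zero_N: "?zero \<in> ?N"
    unfolding N_iff
    using mk_nat_zero[OF P B] nat_trans_closed[OF d0]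
    by (intro bexI[of _ "mk_nat D (?P 0) (\<lambda>x v. \<zero>\<^bsub>FObj B x\<^esub>)"]) (auto simp: nat_comp_eq intro!: mk_nat_cong)
  \<comment> \<open>Used with \<open>a\<close> equal to 1 and -1, for the two inclusions between a
    coset of a coboundary and the set of coboundaries.\<close>
  have N_comb: "mk_nat D (?P 1) (\<lambda>x v. \<sigma> x v \<oplus>\<^bsub>FObj B x\<^esub> a \<odot>\<^bsub>FObj B x\<^esub> \<tau> x v) \<in> ?N"
    if \<sigma>N: "\<sigma> \<in> ?N" and \<tau>N: "\<tau> \<in> ?N" and a: "a \<in> carrier K" for \<sigma> \<tau> a
  proof -
    obtain \<sigma>' \<tau>' where *: "\<sigma>' \<in> nat_trans K D (?P 0) B" "\<sigma> = nat_comp D (?P 1) \<sigma>' (rdiff R 0)"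
      "\<tau>' \<in> nat_trans K D (?P 0) B" "\<tau> = nat_comp D (?P 1) \<tau>' (rdiff R 0)"
      using \<sigma>N[unfolded N_iff] \<tau>N[unfolded N_iff] by blast
    show ?thesis
      unfolding N_iff
    proof
      show "mk_nat D (?P 0) (\<lambda>x v. \<sigma>' x v \<oplus>\<^bsub>FObj B x\<^esub> a \<odot>\<^bsub>FObj B x\<^esub> \<tau>' x v) \<in> nat_trans K D (?P 0) B"
        using * P B a by (intro nat_trans_lincomb)
    qed (use * nat_trans_closed[OF d0] in \<open>auto simp: nat_comp_eq intro!: mk_nat_cong\<close>)
  qed
  have val: "\<tau> x v \<in> carrier (FObj B x)" if "\<tau> \<in> ?N \<or> \<tau> \<in> ?Z" "x \<in> LObj D" "v \<in> carrier (FObj (?P 1) x)" for \<tau> x v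
  proof -
    have "\<tau> \<in> nat_trans K D (?P 1) B" using that(1) N_nt Z_nt by (elim disjE) (erule (1) subsetD[rotated])+
    then show ?thesis using that(2,3) by (rule nat_trans_closed)
  qed
  \<comment> \<open>Inserting the scalar 1 brings a plain sum into the shape of
    \<open>N_comb\<close>.\<close>
  have plus_eq: "?plus \<sigma> \<tau> = mk_nat D (?P 1) (\<lambda>x v. \<sigma> x v \<oplus>\<^bsub>FObj B x\<^esub> \<one>\<^bsub>K\<^esub> \<odot>\<^bsub>FObj B x\<^esub> \<tau> x v)"
    if "\<tau> \<in> ?N" for \<sigma> \<tau>
    by (rule mk_nat_cong) (metis that val module.smult_one[OF dmod_module[OF B]])
  have one_K: "\<one>\<^bsub>K\<^esub> \<in> carrier K" "\<ominus>\<^bsub>K\<^esub> \<one>\<^bsub>K\<^esub> \<in> carrier K"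
    using cring_K by (simp_all add: cring_def ring.ring_simprules)
  have coset_N: "?coset \<tau> = ?N" if \<tau>: "\<tau> \<in> ?N" for \<tau>
  proof
    show "?coset \<tau> \<subseteq> ?N"
    proof
      fix \<rho> assume "\<rho> \<in> ?coset \<tau>"
      then obtain \<sigma> where \<sigma>: "\<sigma> \<in> ?N" "\<rho> = ?plus \<sigma> \<tau>" by blast
      show "\<rho> \<in> ?N" unfolding \<sigma>(2) plus_eq[OF \<tau>] by (rule N_comb[OF \<sigma>(1) \<tau> one_K(1)])
    qed
    show "?N \<subseteq> ?coset \<tau>"
    proof
      fix \<sigma> assume \<sigma>: "\<sigma> \<in> ?N"
      let ?\<rho> = "mk_nat D (?P 1) (\<lambda>x v. \<sigma> x v \<oplus>\<^bsub>FObj B x\<^esub> (\<ominus>\<^bsub>K\<^esub> \<one>\<^bsub>K\<^esub>) \<odot>\<^bsub>FObj B x\<^esub> \<tau> x v)"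
      have "?\<rho> \<in> ?N" by (rule N_comb[OF \<sigma> \<tau> one_K(2)])
      moreover have "\<sigma> = ?plus ?\<rho> \<tau>"
      proof (rule nat_trans_eqI)
        show "\<sigma> \<in> nat_trans K D (?P 1) B" using N_nt \<sigma> by blast
        show "?plus ?\<rho> \<tau> \<in> nat_trans K D (?P 1) B"
          unfolding plus_eq[OF \<tau>] using N_comb[OF \<open>?\<rho> \<in> ?N\<close> \<tau> one_K(1)] by (rule subsetD[OF N_nt])
        fix x v assume *: "x \<in> LObj D" "v \<in> carrier (FObj (?P 1) x)"
        interpret Bx: module K "FObj B x" by (rule dmod_module[OF B *(1)])
        have c: "\<sigma> x v \<in> carrier (FObj B x)" "\<tau> x v \<in> carrier (FObj B x)"
          using val \<sigma> \<tau> * by blast+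
        then show "\<sigma> x v = ?plus ?\<rho> \<tau> x v"
          using * by (simp add: Bx.smult_l_minus Bx.M.a_assoc Bx.M.l_neg)
      qed
      ultimately show "\<sigma> \<in> ?coset \<tau>" by blast
    qed
  qed
  show ?thesis
    unfolding carr zero
  proof
    assume triv: "?coset ` ?Z = {?N}"
    show "?Z \<subseteq> ?N"
    proof
      fix \<tau> assume \<tau>: "\<tau> \<in> ?Z"
      \<comment> \<open>As zero is a coboundary, this places \<open>\<tau>\<close> in its own
        coset.\<close>
      have zero_plus: "?plus ?zero \<tau> = \<tau>"
      proof -
        have "?plus ?zero \<tau> = mk_nat D (?P 1) \<tau>"
          using val[of \<tau>] \<tau> abelian_monoid.l_zero[OF abelian_group.axioms(1)[OF B_group]]
          by (intro mk_nat_cong) simp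
        also have "\<dots> = \<tau>"
          using subsetD[OF Z_nt \<tau>] by (rule nat_trans_eq_mk_nat[symmetric])
        finally show ?thesis .
      qed
      have "?plus ?zero \<tau> \<in> ?coset \<tau>" using zero_N by (rule imageI)
      from back_subst[of "\<lambda>t. t \<in> ?coset \<tau>", OF this zero_plus] have "\<tau> \<in> ?coset \<tau>" .
      moreover have "?coset \<tau> \<in> ?coset ` ?Z" using \<tau> by (rule imageI)
      then have "?coset \<tau> = ?N" unfolding triv by (rule singletonD)
      ultimately show "\<tau> \<in> ?N" by (simp only:)
    qed
  next
    assume "?Z \<subseteq> ?N"
    then have "?coset ` ?Z = (\<lambda>_. ?N) ` ?Z" by (intro image_cong refl coset_N) (rule subsetD)
    also have "\<dots> = {?N}" by (rule image_constant[OF zero_Z])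
    finally show "?coset ` ?Z = {?N}" .
  qed
qed

text \<open>Provides 1 - t. It occurs with t a retraction onto the kernel of the augmentation, and
  with t = s e for a section s of the augmentation e.\<close>

lemma nat_trans_complement:
  assumes P: "is_dmod K D P" and t: "t \<in> nat_trans K D P P"
  obtains k where "k \<in> nat_trans K D P P"
    and "\<And>x p. \<lbrakk>x \<in> LObj D; p \<in> carrier (FObj P x)\<rbrakk>
      \<Longrightarrow> k x p = p \<oplus>\<^bsub>FObj P x\<^esub> (\<ominus>\<^bsub>K\<^esub> \<one>\<^bsub>K\<^esub>) \<odot>\<^bsub>FObj P x\<^esub> t x p"
proof
  have "\<ominus>\<^bsub>K\<^esub> \<one>\<^bsub>K\<^esub> \<in> carrier K" using cring_K by (simp add: cring_def ring.ring_simprules)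
  then show "mk_nat D P (\<lambda>x v. mk_nat D P (\<lambda>x v. v) x v \<oplus>\<^bsub>FObj P x\<^esub> (\<ominus>\<^bsub>K\<^esub> \<one>\<^bsub>K\<^esub>) \<odot>\<^bsub>FObj P x\<^esub> t x v) \<in> nat_trans K D P P"
    by (intro nat_trans_lincomb P mk_nat_id t)
qed simp

text \<open>Sections s of the augmentation e and retractions r of \<open>rterm R 0\<close> onto the
  kernel of e determine each other through s e = 1 - r. Vanishing of the first Ext produces r, and
  conversely r extends every map out of the kernel to \<open>rterm R 0\<close>.\<close>

lemma Ext1_vanishes_iff_splits:
  fixes A :: "('k, 'o, 'v, 'n) dmod"
  defines "R \<equiv> (SOME R :: ('k, 'o, 'v, 'm, 'n) resolution. projective_resolution K D A R)"
  assumes R: "projective_resolution K D A R" and A: "is_dmod K D A"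
  shows "(\<forall>B :: ('k, 'o, 'v, 'm) dmod. is_dmod K D B \<longrightarrow> carrier (Ext K D 1 A B) = {\<zero>\<^bsub>Ext K D 1 A B\<^esub>})
    \<longleftrightarrow> (\<exists>s \<in> nat_trans K D A (rterm R 0). \<forall>x\<in>LObj D. \<forall>a\<in>carrier (FObj A x). raug R x (s x a) = a)"
proof -
  let ?P = "rterm R" and ?e = "raug R"
  note P = projective_resolutionD(1)[OF R] and d = projective_resolutionD(3)[OF R]
    and e = projective_resolutionD(4)[OF R] and epi = projective_resolutionD(5)[OF R]
    and ex0 = projective_resolutionD(6)[OF R] and ex = projective_resolutionD(7)[OF R]
  have d0: "rdiff R 0 \<in> nat_trans K D (?P 1) (?P 0)" and d1: "rdiff R 1 \<in> nat_trans K D (?P (Suc 1)) (?P 1)"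
    using d[of 0] d[of 1] by simp_all
  have ex1: "rdiff R 1 x ` carrier (FObj (?P (Suc 1)) x)
      = {m \<in> carrier (FObj (?P 1) x). rdiff R 0 x m = \<zero>\<^bsub>FObj (?P 0) x\<^esub>}" if "x \<in> LObj D" for x
    using ex[OF that, of 0] by simp
  define Ker where "Ker = kernel_dmod (?P 0) ?e A"
  have Ker: "is_dmod K D Ker" unfolding Ker_def by (rule kernel_dmod[OF P A e])
  have d0K: "rdiff R 0 \<in> nat_trans K D (?P 1) Ker"
    unfolding Ker_def using ex0 by (intro nat_trans_corestrict P d0) blast
  have m1: "\<ominus>\<^bsub>K\<^esub> \<one>\<^bsub>K\<^esub> \<in> carrier K" using cring_K by (simp add: cring_def ring.ring_simprules)
  \<comment> \<open>The values of 1 - t at a vector fixed by t and at a vector killed by t.\<close>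
  have sub: "u \<oplus>\<^bsub>V\<^esub> (\<ominus>\<^bsub>K\<^esub> \<one>\<^bsub>K\<^esub>) \<odot>\<^bsub>V\<^esub> u = \<zero>\<^bsub>V\<^esub>" "u \<oplus>\<^bsub>V\<^esub> (\<ominus>\<^bsub>K\<^esub> \<one>\<^bsub>K\<^esub>) \<odot>\<^bsub>V\<^esub> \<zero>\<^bsub>V\<^esub> = u"
    if "module K V" "u \<in> carrier V" for V :: "('k, 'w) module" and u
  proof -
    interpret V: module K V by fact
    show "u \<oplus>\<^bsub>V\<^esub> (\<ominus>\<^bsub>K\<^esub> \<one>\<^bsub>K\<^esub>) \<odot>\<^bsub>V\<^esub> u = \<zero>\<^bsub>V\<^esub>" "u \<oplus>\<^bsub>V\<^esub> (\<ominus>\<^bsub>K\<^esub> \<one>\<^bsub>K\<^esub>) \<odot>\<^bsub>V\<^esub> \<zero>\<^bsub>V\<^esub> = u"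
      using that by (simp_all add: V.smult_l_minus V.M.r_neg)
  qed
  show ?thesis
  proof
    assume van: "\<forall>B :: ('k, 'o, 'v, 'm) dmod. is_dmod K D B \<longrightarrow> carrier (Ext K D 1 A B) = {\<zero>\<^bsub>Ext K D 1 A B\<^esub>}"
    \<comment> \<open>The first differential, corestricted to \<open>Ker\<close>, is a cocycle
      because it kills the image of the second. Vanishing is applied to it.\<close>
    have "rdiff R 0 \<in> ext_cocycles K D R Ker 1"
      using d0K ex1 nat_trans_closed[OF d1]
      by (auto simp: ext_cocycles_def nat_comp_eq nat_trans_module_sel Ker_def intro!: mk_nat_cong)
    then have "rdiff R 0 \<in> ext_coboundaries K D R Ker 1"
      using Ext1_trivial_iff[OF R[unfolded R_def] Ker] van Ker unfolding R_def by blast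
    then obtain \<sigma> where \<sigma>: "\<sigma> \<in> nat_trans K D (?P 0) Ker" and "rdiff R 0 = nat_comp D (?P 1) \<sigma> (rdiff R 0)"
      by auto
    \<comment> \<open>So \<open>\<sigma>\<close> is the identity on the image of
      \<open>rdiff R 0\<close>, which by exactness is all of \<open>Ker\<close>: it is a
      retraction.\<close>
    then have \<sigma>d: "\<sigma> x (rdiff R 0 x u) = rdiff R 0 x u" if "x \<in> LObj D" "u \<in> carrier (FObj (?P 1) x)" for x u
      using nat_comp_apply[OF that] by metis
    let ?\<sigma> = "nat_comp D (?P 0) (mk_nat D Ker (\<lambda>x v. v)) \<sigma>"
    have \<sigma>': "?\<sigma> \<in> nat_trans K D (?P 0) (?P 0)"
      using kernel_dmod_incl[OF P A e] \<sigma> unfolding Ker_def by (intro nat_comp_closed P) auto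
    have \<sigma>'_eq: "?\<sigma> x p = \<sigma> x p" if "x \<in> LObj D" "p \<in> carrier (FObj (?P 0) x)" for x p
      using that nat_trans_closed[OF \<sigma>] by (simp add: nat_comp_apply)
    obtain k where k: "k \<in> nat_trans K D (?P 0) (?P 0)"
      and "\<And>x p. \<lbrakk>x \<in> LObj D; p \<in> carrier (FObj (?P 0) x)\<rbrakk>
        \<Longrightarrow> k x p = p \<oplus>\<^bsub>FObj (?P 0) x\<^esub> (\<ominus>\<^bsub>K\<^esub> \<one>\<^bsub>K\<^esub>) \<odot>\<^bsub>FObj (?P 0) x\<^esub> ?\<sigma> x p"
      using nat_trans_complement[OF P \<sigma>'] by blast
    then have kp: "k x p = p \<oplus>\<^bsub>FObj (?P 0) x\<^esub> (\<ominus>\<^bsub>K\<^esub> \<one>\<^bsub>K\<^esub>) \<odot>\<^bsub>FObj (?P 0) x\<^esub> \<sigma> x p"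
      if "x \<in> LObj D" "p \<in> carrier (FObj (?P 0) x)" for x p
      using that \<sigma>'_eq by simp
    \<comment> \<open>\<open>k\<close> is 1 minus the retraction. It vanishes on the kernel of the
      augmentation and hence factors through it; the factor is the desired section.\<close>
    have "k x p = \<zero>\<^bsub>FObj (?P 0) x\<^esub>"
      if "x \<in> LObj D" "p \<in> carrier (FObj (?P 0) x)" and "?e x p = \<zero>\<^bsub>FObj A x\<^esub>" for x p
    proof -
      from that ex0[OF that(1)] obtain u where u: "u \<in> carrier (FObj (?P 1) x)" "p = rdiff R 0 x u" by blast
      then have "\<sigma> x p = p" using \<sigma>d that by auto
      then show ?thesis using kp[OF that(1,2)] sub(1)[OF dmod_module[OF P that(1)] that(2)] by simp
    qed
    from nat_trans_factor[OF P A P e epi k this]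
    obtain s where s: "s \<in> nat_trans K D A (?P 0)"
      and sk: "\<And>x p. x \<in> LObj D \<Longrightarrow> p \<in> carrier (FObj (?P 0) x) \<Longrightarrow> s x (?e x p) = k x p" by blast
    show "\<exists>s \<in> nat_trans K D A (?P 0). \<forall>x\<in>LObj D. \<forall>a\<in>carrier (FObj A x). ?e x (s x a) = a"
    proof (intro bexI[OF _ s] ballI)
      fix x a assume x: "x \<in> LObj D" and "a \<in> carrier (FObj A x)"
      then obtain p where p: "p \<in> carrier (FObj (?P 0) x)" "a = ?e x p"
        using epi by (auto simp: dmod_epi_def)
      have \<sigma>p: "\<sigma> x p \<in> carrier (FObj (?P 0) x)" "?e x (\<sigma> x p) = \<zero>\<^bsub>FObj A x\<^esub>"
        using nat_trans_closed[OF \<sigma> x p(1)] by (auto simp: Ker_def carrier_kernel_dmod)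
      have "?e x (k x p) = ?e x p \<oplus>\<^bsub>FObj A x\<^esub> (\<ominus>\<^bsub>K\<^esub> \<one>\<^bsub>K\<^esub>) \<odot>\<^bsub>FObj A x\<^esub> \<zero>\<^bsub>FObj A x\<^esub>"
        using kp[OF x p(1)] p(1) \<sigma>p m1 module.smult_closed[OF dmod_module[OF P x] m1 \<sigma>p(1)]
        by (simp add: is_linear_add[OF nat_trans_linear[OF e x]] is_linear_smult[OF nat_trans_linear[OF e x]])
      also have "\<dots> = ?e x p"
        using sub(2)[OF dmod_module[OF A x]] nat_trans_closed[OF e x p(1)] by simp
      finally show "?e x (s x a) = a" using sk[OF x p(1)] p(2) by simp
    qed
  next
    assume "\<exists>s \<in> nat_trans K D A (?P 0). \<forall>x\<in>LObj D. \<forall>a\<in>carrier (FObj A x). ?e x (s x a) = a"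
    then obtain s where s: "s \<in> nat_trans K D A (?P 0)"
      and es: "\<And>x a. \<lbrakk>x \<in> LObj D; a \<in> carrier (FObj A x)\<rbrakk> \<Longrightarrow> ?e x (s x a) = a" by blast
    \<comment> \<open>Here \<open>k\<close> is 1 - s e; it maps into the kernel of the augmentation
      and is the identity there.\<close>
    obtain k where k: "k \<in> nat_trans K D (?P 0) (?P 0)"
      and "\<And>x p. \<lbrakk>x \<in> LObj D; p \<in> carrier (FObj (?P 0) x)\<rbrakk>
        \<Longrightarrow> k x p = p \<oplus>\<^bsub>FObj (?P 0) x\<^esub> (\<ominus>\<^bsub>K\<^esub> \<one>\<^bsub>K\<^esub>) \<odot>\<^bsub>FObj (?P 0) x\<^esub> nat_comp D (?P 0) s ?e x p"
      using nat_trans_complement[OF P nat_comp_closed[OF P e s]] by blast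
    then have kp: "k x p = p \<oplus>\<^bsub>FObj (?P 0) x\<^esub> (\<ominus>\<^bsub>K\<^esub> \<one>\<^bsub>K\<^esub>) \<odot>\<^bsub>FObj (?P 0) x\<^esub> s x (?e x p)"
      if "x \<in> LObj D" "p \<in> carrier (FObj (?P 0) x)" for x p
      using that by (simp add: nat_comp_apply)
    have ek: "?e x (k x p) = \<zero>\<^bsub>FObj A x\<^esub>" if x: "x \<in> LObj D" and p: "p \<in> carrier (FObj (?P 0) x)" for x p
    proof -
      have ep: "?e x p \<in> carrier (FObj A x)" using nat_trans_closed[OF e x p] .
      have sp: "s x (?e x p) \<in> carrier (FObj (?P 0) x)" using nat_trans_closed[OF s x ep] .
      show ?thesis
        using kp[OF x p] p ep es[OF x ep] m1 sp module.smult_closed[OF dmod_module[OF P x] m1 sp]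
          sub(1)[OF dmod_module[OF A x] ep]
        by (simp add: is_linear_add[OF nat_trans_linear[OF e x]] is_linear_smult[OF nat_trans_linear[OF e x]])
    qed
    have kK: "k \<in> nat_trans K D (?P 0) Ker"
      unfolding Ker_def using ek by (intro nat_trans_corestrict P k) auto
    have e0: "?e x (rdiff R 0 x u) = \<zero>\<^bsub>FObj A x\<^esub>" if "x \<in> LObj D" "u \<in> carrier (FObj (?P 1) x)" for x u
      using that ex0 by blast
    have kd: "k x (rdiff R 0 x u) = rdiff R 0 x u" if x: "x \<in> LObj D" and u: "u \<in> carrier (FObj (?P 1) x)" for x u
    proof -
      have du: "rdiff R 0 x u \<in> carrier (FObj (?P 0) x)" using nat_trans_closed[OF d0 x u] .
      show ?thesis
        using kp[OF x du] e0[OF x u] sub(2)[OF dmod_module[OF P x] du]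
          is_linear_zero[OF dmod_module[OF A x] dmod_module[OF P x] nat_trans_linear[OF s x]] by simp
    qed
    show "\<forall>B :: ('k, 'o, 'v, 'm) dmod. is_dmod K D B \<longrightarrow> carrier (Ext K D 1 A B) = {\<zero>\<^bsub>Ext K D 1 A B\<^esub>}"
    proof (intro allI impI)
      fix B :: "('k, 'o, 'v, 'm) dmod" assume B: "is_dmod K D B"
      have "ext_cocycles K D R B 1 \<subseteq> ext_coboundaries K D R B 1"
      proof
        fix \<tau> assume "\<tau> \<in> ext_cocycles K D R B 1"
        then have \<tau>: "\<tau> \<in> nat_trans K D (?P 1) B"
          and "nat_comp D (?P (Suc 1)) \<tau> (rdiff R 1) = mk_nat D (?P (Suc 1)) (\<lambda>x v. \<zero>\<^bsub>FObj B x\<^esub>)"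
          by (auto simp: ext_cocycles_def nat_trans_module_sel)
        then have \<tau>d: "\<tau> x (rdiff R 1 x w) = \<zero>\<^bsub>FObj B x\<^esub>" if "x \<in> LObj D" "w \<in> carrier (FObj (?P (Suc 1)) x)" for x w
          using nat_comp_apply[OF that] mk_nat_apply[OF that] by metis
        have epiK: "dmod_epi D (?P 1) Ker (rdiff R 0)"
          using ex0 by (simp add: dmod_epi_def Ker_def carrier_kernel_dmod)
        have ker: "\<tau> x u = \<zero>\<^bsub>FObj B x\<^esub>" if x: "x \<in> LObj D" and u: "u \<in> carrier (FObj (?P 1) x)"
          "rdiff R 0 x u = \<zero>\<^bsub>FObj Ker x\<^esub>" for x u
        proof -
          have "u \<in> rdiff R 1 x ` carrier (FObj (?P (Suc 1)) x)"
            using u ex1[OF x] by (simp add: Ker_def)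
          then show ?thesis using \<tau>d[OF x] by blast
        qed
        \<comment> \<open>A cocycle kills the image of \<open>rdiff R 1\<close>, which is the kernel
          of \<open>rdiff R 0\<close>, so it descends to \<open>Ker\<close>.\<close>
        from nat_trans_factor[OF P Ker B d0K epiK \<tau> ker]
        obtain \<sigma> where \<sigma>: "\<sigma> \<in> nat_trans K D Ker B"
          and \<sigma>d: "\<And>x u. x \<in> LObj D \<Longrightarrow> u \<in> carrier (FObj (?P 1) x) \<Longrightarrow> \<sigma> x (rdiff R 0 x u) = \<tau> x u" by blast
        \<comment> \<open>Precomposing with the retraction \<open>k\<close> extends
          \<open>\<sigma>\<close> from \<open>Ker\<close> to all of \<open>?P 0\<close>, and along
          \<open>rdiff R 0\<close> the extension gives back \<open>\<tau>\<close>.\<close>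
        let ?\<sigma> = "nat_comp D (?P 0) \<sigma> k"
        have \<sigma>': "?\<sigma> \<in> nat_trans K D (?P 0) B" by (rule nat_comp_closed[OF P kK \<sigma>])
        have "nat_comp D (?P 1) ?\<sigma> (rdiff R 0) = \<tau>"
          by (rule nat_trans_eqI[OF nat_comp_closed[OF P d0 \<sigma>'] \<tau>])
            (simp add: nat_comp_apply kd \<sigma>d nat_trans_closed[OF d0])
        then show "\<tau> \<in> ext_coboundaries K D R B 1" using \<sigma>' by auto
      qed
      then show "carrier (Ext K D 1 A B) = {\<zero>\<^bsub>Ext K D 1 A B\<^esub>}"
        using Ext1_trivial_iff[OF R[unfolded R_def] B] unfolding R_def by blast
    qed
  qed
qed

end

section \<open>Linearized categories and enough projectives\<close>

text \<open>For fixed \<open>u\<close> and \<open>v\<close>, the law to be shown equates two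
  expressions that are linear in the coefficients \<open>s\<close>, so basis vectors
  suffice.\<close>

lemma free_lift_linear_param:
  assumes U: "module K U" and V: "module K V"
    and \<phi>: "\<And>b. b \<in> B \<Longrightarrow> is_linear K U V (\<phi> b)" and s: "s \<in> carrier (free_module K B)"
  shows "is_linear K U V (\<lambda>u. free_lift K V (\<lambda>b. \<phi> b u) s)"
proof -
  interpret U: module K U by fact
  interpret V: module K V by fact
  have F: "module K (free_module K B)" by (rule module_free_module[OF U.R.cring_axioms])
  have cl: "(\<lambda>b. \<phi> b u) \<in> B \<rightarrow> carrier V" if "u \<in> carrier U" for u
    using \<phi> that by (auto intro: is_linear_closed)
  note lin = free_lift_linear[OF V cl]
  have cl': "\<phi> b u \<in> carrier V" if "b \<in> B" "u \<in> carrier U" for b u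
    using is_linear_closed[OF \<phi>] that by blast
  show ?thesis
  proof (rule is_linearI)
    fix u assume "u \<in> carrier U"
    then show "free_lift K V (\<lambda>b. \<phi> b u) s \<in> carrier V" by (rule is_linear_closed[OF lin s])
  next
    fix u v assume uv: "u \<in> carrier U" "v \<in> carrier U"
    show "free_lift K V (\<lambda>b. \<phi> b (u \<oplus>\<^bsub>U\<^esub> v)) s = free_lift K V (\<lambda>b. \<phi> b u) s \<oplus>\<^bsub>V\<^esub> free_lift K V (\<lambda>b. \<phi> b v) s"
      by (rule free_module_ext[OF V lin[OF U.M.a_closed[OF uv]] is_linear_plus[OF V lin[OF uv(1)] lin[OF uv(2)] F] _ s])
        (use uv in \<open>simp add: free_lift_basis[OF V] cl' is_linear_add[OF \<phi>]\<close>)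
  next
    fix a u assume au: "a \<in> carrier K" "u \<in> carrier U"
    show "free_lift K V (\<lambda>b. \<phi> b (a \<odot>\<^bsub>U\<^esub> u)) s = a \<odot>\<^bsub>V\<^esub> free_lift K V (\<lambda>b. \<phi> b u) s"
      by (rule free_module_ext[OF V lin[OF U.smult_closed[OF au]] is_linear_scale[OF V lin[OF au(2)] au(1)] _ s])
        (use au in \<open>simp add: free_lift_basis[OF V] cl' is_linear_smult[OF \<phi>]\<close>)
  qed
qed

text \<open>Injections of the base and of each fibre combine into one injection into the square of
  'm, which is equipollent to 'm.\<close>

lemma Sigma_lepoll_UNIV:
  assumes infinite_univ: "infinite (UNIV :: 'm set)" and "A \<lesssim> (UNIV :: 'm set)" and "\<And>a. a \<in> A \<Longrightarrow> B a \<lesssim> (UNIV :: 'm set)"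
  shows "Sigma A B \<lesssim> (UNIV :: 'm set)"
proof -
  have "Sigma A B \<lesssim> (UNIV :: 'm set) \<times> (UNIV :: 'm set)"
  proof -
    obtain f :: "_ \<Rightarrow> 'm" where f: "inj_on f A" using assms(2) by (auto simp: lepoll_def)
    obtain g :: "_ \<Rightarrow> _ \<Rightarrow> 'm" where g: "\<And>a. a \<in> A \<Longrightarrow> inj_on (g a) (B a)"
      using assms(3) unfolding lepoll_def by metis
    have "inj_on (\<lambda>(a, b). (f a, g a b)) (Sigma A B)"
      using f g by (auto simp: inj_on_def)
    then show ?thesis unfolding lepoll_def by (intro exI conjI) auto
  qed
  also have "(UNIV :: 'm set) \<times> (UNIV :: 'm set) \<approx> (UNIV :: 'm set)"
    unfolding eqpoll_iff_card_of_ordIso by (rule card_of_Times_same_infinite[OF infinite_univ])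
  finally show ?thesis .
qed

text \<open>
  \<open>D\<close> is identified with the linearization of \<open>E\<close>: \<open>\<beta>\<close> embeds the arrows of \<open>E\<close> as bases of the
  Hom spaces, and \<open>\<kappa>\<close> takes coordinates.
\<close>

locale linearized_category = prelinear_category K D + small_category E
  for K :: "('k, 'c) ring_scheme" and D :: "('k, 'o, 'v) lincat" and E :: "('o, 'b) cat" +
  fixes \<beta> :: "'o \<Rightarrow> 'o \<Rightarrow> 'b \<Rightarrow> 'v" and \<kappa> :: "'o \<Rightarrow> 'o \<Rightarrow> 'v \<Rightarrow> 'b \<Rightarrow> 'k"
  assumes Obj_E: "Obj E = LObj D"
    and basis_closed: "\<lbrakk>x \<in> LObj D; y \<in> LObj D; b \<in> Hom E x y\<rbrakk> \<Longrightarrow> \<beta> x y b \<in> carrier (LHom D x y)"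
    and coord_linear: "\<lbrakk>x \<in> LObj D; y \<in> LObj D\<rbrakk> \<Longrightarrow> is_linear K (LHom D x y) (free_module K (Hom E x y)) (\<kappa> x y)"
    and coord_basis: "\<lbrakk>x \<in> LObj D; y \<in> LObj D; b \<in> Hom E x y\<rbrakk> \<Longrightarrow> \<kappa> x y (\<beta> x y b) = basis_elt K b"
    and coord_expand: "\<lbrakk>x \<in> LObj D; y \<in> LObj D; T \<in> carrier (LHom D x y)\<rbrakk>
      \<Longrightarrow> free_lift K (LHom D x y) (\<beta> x y) (\<kappa> x y T) = T"
    and LId_basis: "x \<in> LObj D \<Longrightarrow> LId D x = \<beta> x x (Id E x)"
    and LComp_basis: "\<lbrakk>x \<in> LObj D; y \<in> LObj D; z \<in> LObj D; b \<in> Hom E x y; c \<in> Hom E y z\<rbrakk>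
      \<Longrightarrow> LComp D x y z (\<beta> y z c) (\<beta> x y b) = \<beta> x z (Comp E x y z c b)"
    and LComp_linear_left: "\<lbrakk>x \<in> LObj D; y \<in> LObj D; z \<in> LObj D; f \<in> carrier (LHom D x y)\<rbrakk>
      \<Longrightarrow> is_linear K (LHom D y z) (LHom D x z) (\<lambda>g. LComp D x y z g f)"
    and LComp_linear_right: "\<lbrakk>x \<in> LObj D; y \<in> LObj D; z \<in> LObj D; g \<in> carrier (LHom D y z)\<rbrakk>
      \<Longrightarrow> is_linear K (LHom D x y) (LHom D x z) (\<lambda>f. LComp D x y z g f)"
begin

text \<open>By \<open>coord_expand\<close> every morphism is the linear combination of arrows given
  by its coordinates, so \<open>free_module_ext\<close> carries over to the Hom spaces of
  \<open>D\<close>.\<close>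

lemma LHom_ext:
  assumes xy: "x \<in> LObj D" "y \<in> LObj D" and W: "module K W"
    and f: "is_linear K (LHom D x y) W f" and g: "is_linear K (LHom D x y) W g"
    and eq: "\<And>b. b \<in> Hom E x y \<Longrightarrow> f (\<beta> x y b) = g (\<beta> x y b)"
    and T: "T \<in> carrier (LHom D x y)"
  shows "f T = g T"
proof -
  note L = module_LHom[OF xy]
  have \<beta>: "\<beta> x y \<in> Hom E x y \<rightarrow> carrier (LHom D x y)" using basis_closed[OF xy] by blast
  have \<kappa>: "\<kappa> x y T \<in> carrier (free_module K (Hom E x y))" by (rule is_linear_closed[OF coord_linear[OF xy] T])
  have "f T = free_lift K W (\<lambda>b. f (\<beta> x y b)) (\<kappa> x y T)"
    using linear_free_lift_comp[OF L W f \<beta> \<kappa>] coord_expand[OF xy T] by simp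
  also have "\<dots> = free_lift K W (\<lambda>b. g (\<beta> x y b)) (\<kappa> x y T)"
    using eq \<beta> is_linear_closed[OF g] by (intro free_lift_cong[OF _ W _ \<kappa>]) auto
  also have "\<dots> = g T"
    using linear_free_lift_comp[OF L W g \<beta> \<kappa>] coord_expand[OF xy T] by simp
  finally show ?thesis .
qed

text \<open>Functoriality is bilinear in the two morphisms. It is extended from arrows to morphisms
  one argument at a time: first in \<open>f\<close> with the other an arrow, then in
  \<open>g\<close>.\<close>

lemma mk_dmod_basisI:
  assumes V: "\<And>x. x \<in> LObj D \<Longrightarrow> module K (V x)"
    and lin: "\<And>x y f. \<lbrakk>x \<in> LObj D; y \<in> LObj D; f \<in> carrier (LHom D x y)\<rbrakk> \<Longrightarrow> is_linear K (V x) (V y) (h x y f)"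
    and lin': "\<And>x y v. \<lbrakk>x \<in> LObj D; y \<in> LObj D; v \<in> carrier (V x)\<rbrakk> \<Longrightarrow> is_linear K (LHom D x y) (V y) (\<lambda>f. h x y f v)"
    and id: "\<And>x v. \<lbrakk>x \<in> LObj D; v \<in> carrier (V x)\<rbrakk> \<Longrightarrow> h x x (\<beta> x x (Id E x)) v = v"
    and comp: "\<And>x y z f g v. \<lbrakk>x \<in> LObj D; y \<in> LObj D; z \<in> LObj D; f \<in> Hom E x y; g \<in> Hom E y z; v \<in> carrier (V x)\<rbrakk>
      \<Longrightarrow> h x z (\<beta> x z (Comp E x y z g f)) v = h y z (\<beta> y z g) (h x y (\<beta> x y f) v)"
  shows "is_dmod K D (mk_dmod V h)"
proof (rule mk_dmodI[OF V lin lin'])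
  fix x y z f g v
  assume x: "x \<in> LObj D" and y: "y \<in> LObj D" and z: "z \<in> LObj D"
    and f: "f \<in> carrier (LHom D x y)" and g: "g \<in> carrier (LHom D y z)" and v: "v \<in> carrier (V x)"
  have cl: "h x y f v \<in> carrier (V y)" if "f \<in> carrier (LHom D x y)" for f
    using lin[OF x y that] v by (rule is_linear_closed)
  have "h x z (LComp D x y z (\<beta> y z c) f) v = h y z (\<beta> y z c) (h x y f v)" if c: "c \<in> Hom E y z" for c
  proof (rule LHom_ext[OF x y V[OF z] _ _ _ f])
    show "is_linear K (LHom D x y) (V z) (\<lambda>f. h x z (LComp D x y z (\<beta> y z c) f) v)"
      by (rule is_linear_comp[OF LComp_linear_right[OF x y z basis_closed[OF y z c]] lin'[OF x z v]])
    show "is_linear K (LHom D x y) (V z) (\<lambda>f. h y z (\<beta> y z c) (h x y f v))"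
      by (rule is_linear_comp[OF lin'[OF x y v] lin[OF y z basis_closed[OF y z c]]])
  qed (simp add: LComp_basis comp x y z c v)
  then show "h x z (LComp D x y z g f) v = h y z g (h x y f v)"
    by (rule LHom_ext[OF y z V[OF z] is_linear_comp[OF LComp_linear_left[OF x y z f] lin'[OF x z v]]
          lin'[OF y z cl[OF f]] _ g])
qed (use id in \<open>simp_all add: LId_basis\<close>)

lemma mk_nat_basisI:
  assumes M: "is_dmod K D M" and N: "is_dmod K D N"
    and lin: "\<And>x. x \<in> LObj D \<Longrightarrow> is_linear K (FObj M x) (FObj N x) (h x)"
    and nat: "\<And>x y b v. \<lbrakk>x \<in> LObj D; y \<in> LObj D; b \<in> Hom E x y; v \<in> carrier (FObj M x)\<rbrakk>
      \<Longrightarrow> h y (FMor M x y (\<beta> x y b) v) = FMor N x y (\<beta> x y b) (h x v)"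
  shows "mk_nat D M h \<in> nat_trans K D M N"
proof (rule mk_natI[OF M lin])
  fix x y f v assume x: "x \<in> LObj D" and y: "y \<in> LObj D" and f: "f \<in> carrier (LHom D x y)" and v: "v \<in> carrier (FObj M x)"
  show "h y (FMor M x y f v) = FMor N x y f (h x v)"
    by (rule LHom_ext[OF x y dmod_module[OF N y] is_linear_comp[OF dmod_linear_mor[OF M x y v] lin[OF y]]
          dmod_linear_mor[OF N x y is_linear_closed[OF lin[OF x] v]] nat[OF x y _ v] f])
qed

subsection \<open>Free modules\<close>

text \<open>This and the next two definitions describe the direct sum over \<open>i\<close> of the
  representable modules at \<open>p i\<close>, by its basis of pairs of an index and an arrow out of
  \<open>p i\<close>. Arrows of \<open>E\<close> act on the basis by postcomposition.\<close>

definition free_basis :: "'i set \<Rightarrow> ('i \<Rightarrow> 'o) \<Rightarrow> 'o \<Rightarrow> ('i \<times> 'b) set"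
  where "free_basis I p x = (SIGMA i:I. Hom E (p i) x)"

definition free_act :: "'i set \<Rightarrow> ('i \<Rightarrow> 'o) \<Rightarrow> 'o \<Rightarrow> 'o \<Rightarrow> 'b \<Rightarrow> ('i \<times> 'b \<Rightarrow> 'k) \<Rightarrow> 'i \<times> 'b \<Rightarrow> 'k"
  where "free_act I p x y b = free_lift K (free_module K (free_basis I p y))
    (\<lambda>(i, c). basis_elt K (i, Comp E (p i) x y b c))"

definition free_dmod :: "'i set \<Rightarrow> ('i \<Rightarrow> 'o) \<Rightarrow> ('k, 'o, 'v, 'i \<times> 'b \<Rightarrow> 'k) dmod"
  where "free_dmod I p = mk_dmod (\<lambda>x. free_module K (free_basis I p x))
    (\<lambda>x y T t. free_lift K (free_module K (free_basis I p y)) (\<lambda>b. free_act I p x y b t) (\<kappa> x y T))"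

lemma FObj_free_dmod: "FObj (free_dmod I p) x = free_module K (free_basis I p x)"
  by (simp add: free_dmod_def)

context
  fixes I :: "'i set" and p :: "'i \<Rightarrow> 'o"
  assumes p: "\<And>i. i \<in> I \<Longrightarrow> p i \<in> LObj D"
begin

private abbreviation "F x \<equiv> free_module K (free_basis I p x)"

private lemma F: "module K (F x)"
  by (rule module_free_module[OF cring_K])

private lemma act_basis_closed:
  assumes "x \<in> LObj D" "y \<in> LObj D" "b \<in> Hom E x y" "i \<in> I" "c \<in> Hom E (p i) x"
  shows "basis_elt K (i, Comp E (p i) x y b c) \<in> carrier (F y)"
  using assms p by (intro basis_elt_closed cring_K) (auto simp: free_basis_def Obj_E intro!: Comp_in)

lemma free_act_linear:
  assumes "x \<in> LObj D" "y \<in> LObj D" "b \<in> Hom E x y"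
  shows "is_linear K (F x) (F y) (free_act I p x y b)"
  unfolding free_act_def
  using act_basis_closed[OF assms] by (intro free_lift_linear F) (auto simp: free_basis_def)

lemma free_act_basis:
  assumes "x \<in> LObj D" "y \<in> LObj D" "b \<in> Hom E x y" "i \<in> I" "c \<in> Hom E (p i) x"
  shows "free_act I p x y b (basis_elt K (i, c)) = basis_elt K (i, Comp E (p i) x y b c)"
  unfolding free_act_def using act_basis_closed[OF assms] by (simp add: free_lift_basis[OF F])

private lemma mor_basis:
  assumes "x \<in> LObj D" "y \<in> LObj D" "b \<in> Hom E x y" "t \<in> carrier (F x)"
  shows "free_lift K (F y) (\<lambda>b. free_act I p x y b t) (\<kappa> x y (\<beta> x y b)) = free_act I p x y b t"
  using assms is_linear_closed[OF free_act_linear] by (simp add: coord_basis free_lift_basis[OF F])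

lemma FMor_free_dmod:
  assumes "x \<in> LObj D" "y \<in> LObj D" "b \<in> Hom E x y" "t \<in> carrier (FObj (free_dmod I p) x)"
  shows "FMor (free_dmod I p) x y (\<beta> x y b) t = free_act I p x y b t"
  using assms mor_basis by (simp add: free_dmod_def)

lemma free_dmod: "is_dmod K D (free_dmod I p)"
  unfolding free_dmod_def
proof (rule mk_dmod_basisI)
  fix x y f assume *: "x \<in> LObj D" "y \<in> LObj D" "f \<in> carrier (LHom D x y)"
  show "is_linear K (F x) (F y) (\<lambda>t. free_lift K (F y) (\<lambda>b. free_act I p x y b t) (\<kappa> x y f))"
    by (rule free_lift_linear_param[OF F F free_act_linear[OF *(1,2)] is_linear_closed[OF coord_linear[OF *(1,2)] *(3)]])
next
  fix x y t assume *: "x \<in> LObj D" "y \<in> LObj D" "t \<in> carrier (F x)"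
  have "(\<lambda>b. free_act I p x y b t) \<in> Hom E x y \<rightarrow> carrier (F y)"
    using is_linear_closed[OF free_act_linear[OF *(1,2)] *(3)] by blast
  then show "is_linear K (LHom D x y) (F y) (\<lambda>f. free_lift K (F y) (\<lambda>b. free_act I p x y b t) (\<kappa> x y f))"
    by (rule is_linear_comp[OF coord_linear[OF *(1,2)] free_lift_linear[OF F]])
next
  fix x t assume x: "x \<in> LObj D" and t: "t \<in> carrier (F x)"
  have Id: "Id E x \<in> Hom E x x" using x by (simp add: Obj_E Id_in)
  have "free_act I p x x (Id E x) t = t"
    by (rule free_module_ext[OF F free_act_linear[OF x x Id] _ _ t])
      (use x p Id in \<open>auto intro!: is_linearI simp: free_basis_def free_act_basis Id_Comp Obj_E\<close>)
  then show "free_lift K (F x) (\<lambda>b. free_act I p x x b t) (\<kappa> x x (\<beta> x x (Id E x))) = t"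
    using mor_basis[OF x x Id t] by simp
next
  fix x y z f g t
  assume x: "x \<in> LObj D" and y: "y \<in> LObj D" and z: "z \<in> LObj D" and f: "f \<in> Hom E x y" and g: "g \<in> Hom E y z"
    and t: "t \<in> carrier (F x)"
  have gf: "Comp E x y z g f \<in> Hom E x z" using x y z f g by (intro Comp_in) (simp_all add: Obj_E)
  have ft: "free_act I p x y f t \<in> carrier (F y)" by (rule is_linear_closed[OF free_act_linear[OF x y f] t])
  have "free_act I p x z (Comp E x y z g f) t = free_act I p y z g (free_act I p x y f t)"
  proof (rule free_module_ext[OF F free_act_linear[OF x z gf] is_linear_comp[OF free_act_linear[OF x y f] free_act_linear[OF y z g]] _ t])
    fix b assume "b \<in> free_basis I p x"
    then obtain i c where "b = (i, c)" "i \<in> I" "c \<in> Hom E (p i) x" by (auto simp: free_basis_def)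
    then show "free_act I p x z (Comp E x y z g f) (basis_elt K b) = free_act I p y z g (free_act I p x y f (basis_elt K b))"
      using x y z f g gf p
      by (simp add: free_act_basis Comp_in Obj_E Comp_assoc)
  qed
  then show "free_lift K (F z) (\<lambda>b. free_act I p x z b t) (\<kappa> x z (\<beta> x z (Comp E x y z g f))) =
      free_lift K (F z) (\<lambda>b. free_act I p y z b (free_lift K (F y) (\<lambda>b. free_act I p x y b t) (\<kappa> x y (\<beta> x y f)))) (\<kappa> y z (\<beta> y z g))"
    using mor_basis[OF x z gf t] mor_basis[OF x y f t] mor_basis[OF y z g ft] by simp
qed (rule F)

text \<open>The universal element, in the sense of Yoneda, of the summand represented by
  \<open>p i\<close>.\<close>

definition free_gen :: "'i \<Rightarrow> 'i \<times> 'b \<Rightarrow> 'k"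
  where "free_gen i = basis_elt K (i, Id E (p i))"

lemma free_gen_closed: "i \<in> I \<Longrightarrow> free_gen i \<in> carrier (FObj (free_dmod I p) (p i))"
  unfolding free_gen_def FObj_free_dmod
  using p by (intro basis_elt_closed cring_K) (auto simp: free_basis_def Obj_E Id_in)

lemma FMor_free_gen:
  assumes "x \<in> LObj D" "i \<in> I" "b \<in> Hom E (p i) x"
  shows "FMor (free_dmod I p) (p i) x (\<beta> (p i) x b) (free_gen i) = basis_elt K (i, b)"
  using assms p[OF assms(2)] free_gen_closed[OF assms(2)]
  by (simp add: FMor_free_dmod free_gen_def free_act_basis Id_in Obj_E Comp_Id)

text \<open>Every basis element is the image of a generator under an arrow, so naturality forces the
  remaining values.\<close>

lemma free_dmod_ext:
  assumes N: "is_dmod K D N" and \<sigma>: "\<sigma> \<in> nat_trans K D (free_dmod I p) N" and \<tau>: "\<tau> \<in> nat_trans K D (free_dmod I p) N"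
    and eq: "\<And>i. i \<in> I \<Longrightarrow> \<sigma> (p i) (free_gen i) = \<tau> (p i) (free_gen i)"
  shows "\<sigma> = \<tau>"
proof (rule nat_trans_eqI[OF \<sigma> \<tau>])
  fix x t assume x: "x \<in> LObj D" and t: "t \<in> carrier (FObj (free_dmod I p) x)"
  note lin = nat_trans_linear[OF \<sigma> x, unfolded FObj_free_dmod] nat_trans_linear[OF \<tau> x, unfolded FObj_free_dmod]
  show "\<sigma> x t = \<tau> x t"
  proof (rule free_module_ext[OF dmod_module[OF N x] lin _ t[unfolded FObj_free_dmod]])
    fix b assume "b \<in> free_basis I p x"
    then obtain i c where b: "b = (i, c)" "i \<in> I" "c \<in> Hom E (p i) x" by (auto simp: free_basis_def)
    have pi: "p i \<in> LObj D" by (rule p[OF b(2)])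
    have \<beta>: "\<beta> (p i) x c \<in> carrier (LHom D (p i) x)" by (rule basis_closed[OF pi x b(3)])
    show "\<sigma> x (basis_elt K b) = \<tau> x (basis_elt K b)"
      using nat_trans_natural[OF \<sigma> pi x \<beta> free_gen_closed[OF b(2)]]
        nat_trans_natural[OF \<tau> pi x \<beta> free_gen_closed[OF b(2)]] eq[OF b(2)] FMor_free_gen[OF x b(2,3)] b(1)
      by simp
  qed
qed

text \<open>The existence half of Yoneda for sums of representables. Naturality on basis elements is
  the composition law of \<open>N\<close>.\<close>

lemma free_dmod_extend:
  assumes N: "is_dmod K D N" and m: "\<And>i. i \<in> I \<Longrightarrow> m i \<in> carrier (FObj N (p i))"
  defines "\<psi> \<equiv> mk_nat D (free_dmod I p) (\<lambda>x. free_lift K (FObj N x) (\<lambda>(i, b). FMor N (p i) x (\<beta> (p i) x b) (m i)))"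
  shows "\<psi> \<in> nat_trans K D (free_dmod I p) N"
    and "\<And>x i b. \<lbrakk>x \<in> LObj D; i \<in> I; b \<in> Hom E (p i) x\<rbrakk> \<Longrightarrow> \<psi> x (basis_elt K (i, b)) = FMor N (p i) x (\<beta> (p i) x b) (m i)"
    and "\<And>i. i \<in> I \<Longrightarrow> \<psi> (p i) (free_gen i) = m i"
  unfolding \<psi>_def
proof -
  let ?h = "\<lambda>x. free_lift K (FObj N x) (\<lambda>(i, b). FMor N (p i) x (\<beta> (p i) x b) (m i))"
  have cl: "FMor N (p i) x (\<beta> (p i) x b) (m i) \<in> carrier (FObj N x)"
    if "x \<in> LObj D" "i \<in> I" "b \<in> Hom E (p i) x" for x i b
    using that p by (intro dmod_closed[OF N] basis_closed m) auto
  have lin: "is_linear K (F x) (FObj N x) (?h x)" if "x \<in> LObj D" for x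
    using cl[OF that] by (intro free_lift_linear dmod_module[OF N] that) (auto simp: free_basis_def)
  have hb: "?h x (basis_elt K (i, b)) = FMor N (p i) x (\<beta> (p i) x b) (m i)"
    if "x \<in> LObj D" "i \<in> I" "b \<in> Hom E (p i) x" for x i b
    using cl[OF that] by (simp add: free_lift_basis[OF dmod_module[OF N that(1)]])
  show "mk_nat D (free_dmod I p) ?h \<in> nat_trans K D (free_dmod I p) N"
  proof (rule mk_nat_basisI[OF free_dmod N])
    fix x y b t assume x: "x \<in> LObj D" and y: "y \<in> LObj D" and b: "b \<in> Hom E x y" and t: "t \<in> carrier (FObj (free_dmod I p) x)"
    note \<beta> = basis_closed[OF x y b]
    have "?h y (free_act I p x y b t) = FMor N x y (\<beta> x y b) (?h x t)"
    proof (rule free_module_ext[OF dmod_module[OF N y] is_linear_comp[OF free_act_linear[OF x y b] lin[OF y]]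
          is_linear_comp[OF lin[OF x] dmod_linear[OF N x y \<beta>]] _ t[unfolded FObj_free_dmod]])
      fix c assume "c \<in> free_basis I p x"
      then obtain i a where c: "c = (i, a)" "i \<in> I" "a \<in> Hom E (p i) x" by (auto simp: free_basis_def)
      have pi: "p i \<in> LObj D" by (rule p[OF c(2)])
      have ba: "Comp E (p i) x y b a \<in> Hom E (p i) y" using pi x y c b by (intro Comp_in) (auto simp: Obj_E)
      show "?h y (free_act I p x y b (basis_elt K c)) = FMor N x y (\<beta> x y b) (?h x (basis_elt K c))"
        using pi x y b c ba m basis_closed[OF pi x c(3)] \<beta>
        by (simp only: free_act_basis hb LComp_basis[symmetric] dmod_comp[OF N])
    qed
    then show "?h y (FMor (free_dmod I p) x y (\<beta> x y b) t) = FMor N x y (\<beta> x y b) (?h x t)"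
      by (simp add: FMor_free_dmod[OF x y b t])
  qed (use lin in \<open>simp add: FObj_free_dmod\<close>)
  show **: "mk_nat D (free_dmod I p) ?h x (basis_elt K (i, b)) = FMor N (p i) x (\<beta> (p i) x b) (m i)"
    if *: "x \<in> LObj D" "i \<in> I" "b \<in> Hom E (p i) x" for x i b
  proof -
    have "basis_elt K (i, b) \<in> carrier (F x)"
      using * by (intro basis_elt_closed cring_K) (auto simp: free_basis_def)
    then show ?thesis using hb[OF *] * by (simp add: FObj_free_dmod)
  qed
  show "mk_nat D (free_dmod I p) ?h (p i) (free_gen i) = m i" if "i \<in> I" for i
    using **[OF p[OF that] that] that p[OF that] m[OF that] dmod_id[OF N p[OF that] m[OF that]]
    by (simp add: free_gen_def Id_in Obj_E LId_basis)
qed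

text \<open>Preimages are chosen for the images of the generators only; naturality propagates the
  choice. \<open>M\<close> and \<open>N\<close> may have elements of different types here, unlike in
  \<open>projective_dmod\<close>.\<close>

lemma free_dmod_lift:
  assumes M: "is_dmod K D M" and N: "is_dmod K D N" and \<pi>: "\<pi> \<in> nat_trans K D M N" and epi: "dmod_epi D M N \<pi>"
    and \<phi>: "\<phi> \<in> nat_trans K D (free_dmod I p) N"
  obtains \<psi> where "\<psi> \<in> nat_trans K D (free_dmod I p) M" and "nat_comp D (free_dmod I p) \<pi> \<psi> = \<phi>"
proof -
  have "\<exists>m. m \<in> carrier (FObj M (p i)) \<and> \<pi> (p i) m = \<phi> (p i) (free_gen i)" if "i \<in> I" for i
    using nat_trans_closed[OF \<phi> p[OF that] free_gen_closed[OF that]] epi p[OF that]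
    unfolding dmod_epi_def by (metis imageE)
  then obtain m where m: "\<And>i. i \<in> I \<Longrightarrow> m i \<in> carrier (FObj M (p i))"
    "\<And>i. i \<in> I \<Longrightarrow> \<pi> (p i) (m i) = \<phi> (p i) (free_gen i)" by metis
  obtain \<psi> where \<psi>: "\<psi> \<in> nat_trans K D (free_dmod I p) M" "\<And>i. i \<in> I \<Longrightarrow> \<psi> (p i) (free_gen i) = m i"
    using free_dmod_extend(1,3)[OF M m(1)] by blast
  have "nat_comp D (free_dmod I p) \<pi> \<psi> = \<phi>"
    by (rule free_dmod_ext[OF N nat_comp_closed[OF free_dmod \<psi>(1) \<pi>] \<phi>])
      (simp add: nat_comp_apply p free_gen_closed \<psi>(2) m(2))
  with \<psi>(1) show thesis by (rule that)
qed

text \<open>The copy is isomorphic to the free module by \<open>?to\<close> and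
  \<open>?from\<close>, so a lift for the free module gives one for the copy. Copying is what puts
  the elements into the type 'm of the test modules.\<close>

lemma projective_copy_free_dmod:
  fixes \<iota> :: "'o \<Rightarrow> ('i \<times> 'b \<Rightarrow> 'k) \<Rightarrow> 'm"
  assumes \<iota>: "\<And>x. x \<in> LObj D \<Longrightarrow> inj_on (\<iota> x) (carrier (FObj (free_dmod I p) x))"
  shows "projective_dmod K D (copy_dmod \<iota> (free_dmod I p))"
  unfolding projective_dmod_def
proof (intro conjI allI impI)
  let ?F = "free_dmod I p" and ?P = "copy_dmod \<iota> (free_dmod I p)"
  let ?to = "mk_nat D ?F \<iota>" and ?from = "mk_nat D ?P (\<lambda>x. inv_into (carrier (FObj ?F x)) (\<iota> x))"
  show P: "is_dmod K D ?P" by (rule copy_dmod[OF free_dmod \<iota>])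
  have to: "?to \<in> nat_trans K D ?F ?P" by (rule copy_dmod_to[OF free_dmod \<iota>])
  have retract: "?from \<in> nat_trans K D ?P ?F" by (rule copy_dmod_from[OF free_dmod \<iota>])
  fix M N :: "('k, 'o, 'v, 'm) dmod" and \<pi> \<phi>
  assume "is_dmod K D M \<and> is_dmod K D N \<and> \<pi> \<in> nat_trans K D M N \<and> dmod_epi D M N \<pi> \<and> \<phi> \<in> nat_trans K D ?P N"
  then have M: "is_dmod K D M" and N: "is_dmod K D N" and \<pi>: "\<pi> \<in> nat_trans K D M N" "dmod_epi D M N \<pi>"
    and \<phi>: "\<phi> \<in> nat_trans K D ?P N" by auto
  obtain \<psi> where \<psi>: "\<psi> \<in> nat_trans K D ?F M" and eq: "nat_comp D ?F \<pi> \<psi> = nat_comp D ?F \<phi> ?to"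
    using free_dmod_lift[OF M N \<pi> nat_comp_closed[OF free_dmod to \<phi>]] .
  show "\<exists>\<psi>\<in>nat_trans K D ?P M. nat_comp D ?P \<pi> \<psi> = \<phi>"
  proof
    show \<psi>': "nat_comp D ?P \<psi> ?from \<in> nat_trans K D ?P M" by (rule nat_comp_closed[OF P retract \<psi>])
    show "nat_comp D ?P \<pi> (nat_comp D ?P \<psi> ?from) = \<phi>"
    proof (rule nat_trans_eqI[OF nat_comp_closed[OF P \<psi>' \<pi>(1)] \<phi>])
      fix x v assume x: "x \<in> LObj D" and v: "v \<in> carrier (FObj ?P x)"
      then obtain t where t: "t \<in> carrier (FObj ?F x)" "v = \<iota> x t"
        by (auto simp: copy_dmod_carrier[OF free_dmod \<iota>])
      have "\<pi> x (\<psi> x t) = \<phi> x (\<iota> x t)"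
        using eq nat_comp_apply[OF x t(1), of \<pi> \<psi>] nat_comp_apply[OF x t(1), of \<phi> ?to] x t(1) by simp
      then show "nat_comp D ?P \<pi> (nat_comp D ?P \<psi> ?from) x v = \<phi> x v"
        using x v t \<iota>[OF x] by (simp add: nat_comp_apply)
    qed
  qed
qed

end

text \<open>\<open>projective_dmod\<close> speaks about test modules with the same value type as
  \<open>P\<close>. Both modules are therefore copied into that type, the lift is found there and
  carried back, and injectivity of \<open>\<kappa>\<close> recovers the original equation.\<close>

lemma projective_lift:
  fixes P :: "('k, 'o, 'v, 'm) dmod" and M :: "('k, 'o, 'v, 'n) dmod" and N :: "('k, 'o, 'v, 'l) dmod"
  assumes P: "projective_dmod K D P"
    and M: "is_dmod K D M" "\<And>x. x \<in> LObj D \<Longrightarrow> carrier (FObj M x) \<lesssim> (UNIV :: 'm set)"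
    and N: "is_dmod K D N" "\<And>x. x \<in> LObj D \<Longrightarrow> carrier (FObj N x) \<lesssim> (UNIV :: 'm set)"
    and \<pi>: "\<pi> \<in> nat_trans K D M N" and epi: "dmod_epi D M N \<pi>" and \<phi>: "\<phi> \<in> nat_trans K D P N"
  obtains \<psi> where "\<psi> \<in> nat_trans K D P M"
    and "\<And>x v. \<lbrakk>x \<in> LObj D; v \<in> carrier (FObj P x)\<rbrakk> \<Longrightarrow> \<pi> x (\<psi> x v) = \<phi> x v"
proof -
  obtain \<iota> :: "'o \<Rightarrow> 'n \<Rightarrow> 'm" where \<iota>: "\<And>x. x \<in> LObj D \<Longrightarrow> inj_on (\<iota> x) (carrier (FObj M x))"
    using M(2) unfolding lepoll_def by metis
  obtain \<kappa> :: "'o \<Rightarrow> 'l \<Rightarrow> 'm" where \<kappa>: "\<And>x. x \<in> LObj D \<Longrightarrow> inj_on (\<kappa> x) (carrier (FObj N x))"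
    using N(2) unfolding lepoll_def by metis
  let ?M = "copy_dmod \<iota> M" and ?N = "copy_dmod \<kappa> N"
  let ?from = "mk_nat D ?M (\<lambda>x. inv_into (carrier (FObj M x)) (\<iota> x))" and ?to = "mk_nat D N \<kappa>"
  have PD: "is_dmod K D P" using P by (simp add: projective_dmod_def)
  have M': "is_dmod K D ?M" by (rule copy_dmod[OF M(1) \<iota>])
  have N': "is_dmod K D ?N" by (rule copy_dmod[OF N(1) \<kappa>])
  have retract: "?from \<in> nat_trans K D ?M M" by (rule copy_dmod_from[OF M(1) \<iota>])
  have to: "?to \<in> nat_trans K D N ?N" by (rule copy_dmod_to[OF N(1) \<kappa>])
  let ?\<pi> = "nat_comp D ?M ?to (nat_comp D ?M \<pi> ?from)"
  have \<pi>': "?\<pi> \<in> nat_trans K D ?M ?N" by (rule nat_comp_closed[OF M' nat_comp_closed[OF M' retract \<pi>] to])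
  have \<pi>'_eq: "?\<pi> x (\<iota> x m) = \<kappa> x (\<pi> x m)" if "x \<in> LObj D" "m \<in> carrier (FObj M x)" for x m
  proof -
    have "\<iota> x m \<in> carrier (FObj ?M x)" using that by (simp add: copy_dmod_carrier[OF M(1) \<iota>])
    then show ?thesis
      using that \<iota> nat_trans_closed[OF \<pi>] by (simp add: nat_comp_apply)
  qed
  have epi': "dmod_epi D ?M ?N ?\<pi>"
    unfolding dmod_epi_def
  proof
    fix x assume x: "x \<in> LObj D"
    have "?\<pi> x ` \<iota> x ` carrier (FObj M x) = \<kappa> x ` \<pi> x ` carrier (FObj M x)"
      using \<pi>'_eq[OF x] by (simp add: image_image)
    then show "?\<pi> x ` carrier (FObj ?M x) = carrier (FObj ?N x)"
      using epi x by (simp add: copy_dmod_carrier[OF M(1) \<iota>] copy_dmod_carrier[OF N(1) \<kappa>] dmod_epi_def)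
  qed
  obtain \<psi> where \<psi>: "\<psi> \<in> nat_trans K D P ?M" and eq: "nat_comp D P ?\<pi> \<psi> = nat_comp D P ?to \<phi>"
    using P M' N' \<pi>' epi' nat_comp_closed[OF PD \<phi> to] unfolding projective_dmod_def by blast
  show thesis
  proof
    show "nat_comp D P ?from \<psi> \<in> nat_trans K D P M" by (rule nat_comp_closed[OF PD \<psi> retract])
    fix x v assume x: "x \<in> LObj D" and v: "v \<in> carrier (FObj P x)"
    have \<psi>v: "\<psi> x v \<in> carrier (FObj ?M x)" by (rule nat_trans_closed[OF \<psi> x v])
    then obtain m where m: "m \<in> carrier (FObj M x)" "\<psi> x v = \<iota> x m" by (auto simp: copy_dmod_carrier[OF M(1) \<iota>])
    have \<phi>v: "\<phi> x v \<in> carrier (FObj N x)" by (rule nat_trans_closed[OF \<phi> x v])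
    have "?\<pi> x (\<psi> x v) = \<kappa> x (\<phi> x v)"
      using eq nat_comp_apply[OF x v, of ?\<pi> \<psi>] nat_comp_apply[OF x v, of ?to \<phi>] x \<phi>v by simp
    then have "\<kappa> x (\<pi> x m) = \<kappa> x (\<phi> x v)" using \<pi>'_eq[OF x m(1)] m(2) by simp
    then have "\<pi> x m = \<phi> x v"
      using inj_onD[OF \<kappa>[OF x] _ nat_trans_closed[OF \<pi> x m(1)] \<phi>v] by blast
    moreover have "nat_comp D P ?from \<psi> x v = m"
      using x v \<psi>v m \<iota>[OF x] by (simp add: nat_comp_apply)
    ultimately show "\<pi> x (nat_comp D P ?from \<psi> x v) = \<phi> x v" by simp
  qed
qed

end

section \<open>Free covers and resolutions within a fixed value type\<close>

locale small_linearized_category = linearized_category K D E \<beta> \<kappa>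
  for K :: "('k, 'c) ring_scheme" and D :: "('k, 'o, 'v) lincat" and E :: "('o, 'b) cat" and \<beta> \<kappa> +
  assumes infinite_univ: "infinite (UNIV :: 'm set)"
    and K_small: "carrier K \<lesssim> (UNIV :: 'm set)"
    and Obj_small: "LObj D \<lesssim> (UNIV :: 'm set)"
    and Hom_small: "\<lbrakk>x \<in> LObj D; y \<in> LObj D\<rbrakk> \<Longrightarrow> Hom E x y \<lesssim> (UNIV :: 'm set)"
begin

lemma free_dmod_small:
  assumes "\<And>i. i \<in> I \<Longrightarrow> p i \<in> LObj D" "I \<lesssim> (UNIV :: 'm set)" "x \<in> LObj D"
  shows "carrier (FObj (free_dmod I p) x) \<lesssim> (UNIV :: 'm set)"
  unfolding FObj_free_dmod free_basis_def
  using assms by (intro free_module_lepoll infinite_univ K_small Sigma_lepoll_UNIV Hom_small)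

text \<open>The free module with one generator for each element of \<open>A\<close> maps onto
  \<open>A\<close> by evaluation. The size bounds allow it to be copied into 'm.\<close>

lemma enough_projectives:
  fixes A :: "('k, 'o, 'v, 'n) dmod"
  assumes A: "is_dmod K D A" and small: "\<And>x. x \<in> LObj D \<Longrightarrow> carrier (FObj A x) \<lesssim> (UNIV :: 'm set)"
  obtains P :: "('k, 'o, 'v, 'm) dmod" and e
  where "projective_dmod K D P" "e \<in> nat_trans K D P A" "dmod_epi D P A e"
proof -
  define I where "I = (SIGMA x:LObj D. carrier (FObj A x))"
  have p: "\<And>i. i \<in> I \<Longrightarrow> fst i \<in> LObj D" and m: "\<And>i. i \<in> I \<Longrightarrow> snd i \<in> carrier (FObj A (fst i))"
    by (auto simp: I_def)
  have I: "I \<lesssim> (UNIV :: 'm set)" unfolding I_def by (intro Sigma_lepoll_UNIV infinite_univ Obj_small small)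
  have "\<exists>f :: _ \<Rightarrow> 'm. inj_on f (carrier (FObj (free_dmod I fst) x))" if "x \<in> LObj D" for x
    using free_dmod_small[OF p I that] unfolding lepoll_def by auto
  then obtain \<iota> :: "'o \<Rightarrow> _ \<Rightarrow> 'm" where \<iota>: "\<And>x. x \<in> LObj D \<Longrightarrow> inj_on (\<iota> x) (carrier (FObj (free_dmod I fst) x))"
    by metis
  let ?F = "free_dmod I fst" let ?P = "copy_dmod \<iota> ?F"
  let ?from = "mk_nat D ?P (\<lambda>x. inv_into (carrier (FObj ?F x)) (\<iota> x))"
  have F: "is_dmod K D ?F" by (rule free_dmod[OF p])
  have P: "is_dmod K D ?P" by (rule copy_dmod[OF F \<iota>])
  have retract: "?from \<in> nat_trans K D ?P ?F" by (rule copy_dmod_from[OF F \<iota>])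
  define \<psi> where "\<psi> = mk_nat D ?F (\<lambda>x. free_lift K (FObj A x) (\<lambda>(i, b). FMor A (fst i) x (\<beta> (fst i) x b) (snd i)))"
  note ext = free_dmod_extend[where I = I and p = fst and m = snd, OF p A m, folded \<psi>_def]
  have \<psi>: "\<psi> \<in> nat_trans K D ?F A" by (rule ext(1))
  have \<psi>m: "\<psi> (fst i) (free_gen fst i) = snd i" if "i \<in> I" for i by (rule ext(3)) (simp_all add: that)
  show thesis
  proof
    show "projective_dmod K D ?P" by (rule projective_copy_free_dmod[OF p \<iota>])
    show e: "nat_comp D ?P \<psi> ?from \<in> nat_trans K D ?P A" by (rule nat_comp_closed[OF P retract \<psi>])
    show "dmod_epi D ?P A (nat_comp D ?P \<psi> ?from)"
      unfolding dmod_epi_def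
    proof (intro ballI equalityI subsetI)
      fix x a assume x: "x \<in> LObj D" and a: "a \<in> carrier (FObj A x)"
      then have i: "(x, a) \<in> I" by (simp add: I_def)
      let ?g = "free_gen fst (x, a)"
      have g: "?g \<in> carrier (FObj ?F x)" using free_gen_closed[where p = fst and I = I, OF p i] by simp
      then have c: "\<iota> x ?g \<in> carrier (FObj ?P x)" by (simp add: copy_dmod_carrier[OF F \<iota>])
      have "a = nat_comp D ?P \<psi> ?from x (\<iota> x ?g)"
        using x c g \<iota>[OF x] \<psi>m[OF i] by (simp add: nat_comp_apply)
      then show "a \<in> nat_comp D ?P \<psi> ?from x ` carrier (FObj ?P x)" using c by (rule image_eqI)
    qed (use nat_trans_closed[OF e] in auto)
  qed
qed

lemma projective_resolution_exists:
  fixes A :: "('k, 'o, 'v, 'n) dmod"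
  assumes A: "is_dmod K D A" and small: "\<And>x. x \<in> LObj D \<Longrightarrow> carrier (FObj A x) \<lesssim> (UNIV :: 'm set)"
  shows "\<exists>R :: ('k, 'o, 'v, 'm, 'n) resolution. projective_resolution K D A R"
proof -
  obtain P0 :: "('k, 'o, 'v, 'm) dmod" and e0 where P0: "projective_dmod K D P0"
    and e0: "e0 \<in> nat_trans K D P0 A" "dmod_epi D P0 A e0"
    by (rule enough_projectives[OF A small])
  \<comment> \<open>The hypothesis on \<open>N\<close> sits inside the implication so that choice
    yields total functions on all modules.\<close>
  have "\<forall>N :: ('k, 'o, 'v, 'm) dmod. \<exists>(P :: ('k, 'o, 'v, 'm) dmod) e.
      is_dmod K D N \<longrightarrow> projective_dmod K D P \<and> e \<in> nat_trans K D P N \<and> dmod_epi D P N e"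
    using enough_projectives by (metis subset_UNIV subset_imp_lepoll)
  then obtain cP :: "('k, 'o, 'v, 'm) dmod \<Rightarrow> ('k, 'o, 'v, 'm) dmod" and ce
    where "\<forall>N. is_dmod K D N \<longrightarrow> projective_dmod K D (cP N) \<and> ce N \<in> nat_trans K D (cP N) N \<and> dmod_epi D (cP N) N (ce N)"
    by metis
  then have cP: "projective_dmod K D (cP N)" and ce: "ce N \<in> nat_trans K D (cP N) N"
    and epi: "dmod_epi D (cP N) N (ce N)" if "is_dmod K D N" for N
    using that by auto
  have cPD: "is_dmod K D (cP N)" if "is_dmod K D N" for N using cP[OF that] by (simp add: projective_dmod_def)
  have P0D: "is_dmod K D P0" using P0 by (simp add: projective_dmod_def)
  \<comment> \<open>The state is a pair: the current term and the kernel of the map out of it. The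
    next term covers this kernel, and the differential is the cover followed by the
    inclusion.\<close>
  define S where "S n = rec_nat (P0, kernel_dmod P0 e0 A) (\<lambda>_ (_, N). (cP N, kernel_dmod (cP N) (ce N) N)) n" for n
  define Q where "Q n = fst (S n)" for n
  define N where "N n = snd (S n)" for n
  have Q0: "Q 0 = P0" and N0: "N 0 = kernel_dmod P0 e0 A"
    by (simp_all add: Q_def N_def S_def)
  have QS: "Q (Suc n) = cP (N n)" and NS: "N (Suc n) = kernel_dmod (cP (N n)) (ce (N n)) (N n)" for n
    by (simp_all add: Q_def N_def S_def split: prod.split)
  have ND: "is_dmod K D (N n)" for n
    by (induction n) (auto simp: N0 NS intro!: kernel_dmod P0D A e0 cPD ce)
  have QP: "projective_dmod K D (Q n)" for n
    by (cases n) (auto simp: Q0 QS intro: P0 cP ND)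
  have QD: "is_dmod K D (Q n)" for n using QP by (simp add: projective_dmod_def)
  have incl: "mk_nat D (N n) (\<lambda>x v. v) \<in> nat_trans K D (N n) (Q n)" for n
    by (cases n) (auto simp: N0 NS Q0 QS intro!: kernel_dmod_incl P0D A e0 cPD ce ND)
  define d where "d n = nat_comp D (Q (Suc n)) (mk_nat D (N n) (\<lambda>x v. v)) (ce (N n))" for n
  have ceQ: "ce (N n) \<in> nat_trans K D (Q (Suc n)) (N n)" for n unfolding QS by (rule ce[OF ND])
  have d: "d n \<in> nat_trans K D (Q (Suc n)) (Q n)" for n
    unfolding d_def by (rule nat_comp_closed[OF QD ceQ incl])
  have d_eq: "d n x v = ce (N n) x v" if "x \<in> LObj D" "v \<in> carrier (FObj (Q (Suc n)) x)" for n x v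
    using that nat_trans_closed[OF ceQ that] by (simp add: d_def nat_comp_apply)
  have d_image: "d n x ` carrier (FObj (Q (Suc n)) x) = carrier (FObj (N n) x)" if x: "x \<in> LObj D" for n x
  proof -
    have "d n x ` carrier (FObj (Q (Suc n)) x) = ce (N n) x ` carrier (FObj (Q (Suc n)) x)"
      using d_eq[OF x] by (intro image_cong refl)
    then show ?thesis using epi[OF ND, of n] x by (simp add: dmod_epi_def QS)
  qed
  \<comment> \<open>A kernel shares the zero of its ambient module, so vanishing of the cover and
    vanishing of the differential are the same condition.\<close>
  have zero: "\<zero>\<^bsub>FObj (N n) x\<^esub> = \<zero>\<^bsub>FObj (Q n) x\<^esub>" for n x
    by (cases n) (simp_all add: N0 NS Q0 QS)
  have "e0 \<in> nat_trans K D (Q 0) A" "dmod_epi D (Q 0) A e0"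
    using e0 by (simp_all add: Q0)
  moreover have "d 0 x ` carrier (FObj (Q 1) x) = {m \<in> carrier (FObj (Q 0) x). e0 x m = \<zero>\<^bsub>FObj A x\<^esub>}"
    if "x \<in> LObj D" for x
    using d_image[OF that, of 0] by (simp add: N0 Q0 carrier_kernel_dmod)
  moreover have "d (Suc n) x ` carrier (FObj (Q (Suc (Suc n))) x)
      = {m \<in> carrier (FObj (Q (Suc n)) x). d n x m = \<zero>\<^bsub>FObj (Q n) x\<^esub>}" if x: "x \<in> LObj D" for n x
    using d_image[OF x, of "Suc n"] d_eq[OF x] zero[of n x] by (auto simp: NS QS carrier_kernel_dmod)
  ultimately have "projective_resolution K D A \<lparr>rterm = Q, rdiff = d, raug = e0\<rparr>"
    using QP d by (simp add: projective_resolution_def exact_at_def)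
  then show ?thesis by blast
qed

end

section \<open>Bimodules over the linearization of a category\<close>

text \<open>The counterpart of \<open>free_lift_linear_param\<close>: each law is an identity
  between maps linear in \<open>T\<close>, hence is checked on pure tensors. It handles the nested
  lifts in the composition of \<open>enveloping\<close>.\<close>

lemma tensor_lift_linear_param:
  assumes V: "module K V" and W: "module K W" and Y: "module K Y" and U: "module K U"
    and bil: "\<And>x. x \<in> carrier Y \<Longrightarrow> is_bilinear K V W U (\<phi> x)"
    and lin: "\<And>v w. \<lbrakk>v \<in> carrier V; w \<in> carrier W\<rbrakk> \<Longrightarrow> is_linear K Y U (\<lambda>x. \<phi> x (v, w))"
    and T: "T \<in> carrier (tensor_module K V W)"
  shows "is_linear K Y U (\<lambda>x. tensor_lift K U (\<phi> x) T)"
proof -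
  interpret Y: module K Y by fact
  note L = tensor_lift_linear[OF V W U bil] and M = module_tensor[OF V W]
  show ?thesis
  proof (rule is_linearI)
    fix x assume "x \<in> carrier Y"
    then show "tensor_lift K U (\<phi> x) T \<in> carrier U" by (rule is_linear_closed[OF L T])
  next
    fix x y assume xy: "x \<in> carrier Y" "y \<in> carrier Y"
    show "tensor_lift K U (\<phi> (x \<oplus>\<^bsub>Y\<^esub> y)) T = tensor_lift K U (\<phi> x) T \<oplus>\<^bsub>U\<^esub> tensor_lift K U (\<phi> y) T"
      by (rule tensor_ext[OF V W U L[OF Y.M.a_closed[OF xy]] is_linear_plus[OF U L[OF xy(1)] L[OF xy(2)] M] _ T])
        (simp add: tensor_lift_tensor[OF V W U bil] xy is_linear_add[OF lin])
  next
    fix a x assume ax: "a \<in> carrier K" "x \<in> carrier Y"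
    show "tensor_lift K U (\<phi> (a \<odot>\<^bsub>Y\<^esub> x)) T = a \<odot>\<^bsub>U\<^esub> tensor_lift K U (\<phi> x) T"
      by (rule tensor_ext[OF V W U L[OF Y.smult_closed[OF ax]] is_linear_scale[OF U L[OF ax(2)] ax(1)] _ T])
        (simp add: tensor_lift_tensor[OF V W U bil] ax is_linear_smult[OF lin])
  qed
qed

lemma is_bilinear_comp:
  assumes "is_bilinear K V W U \<phi>" "is_linear K V' V f" "is_linear K W' W g"
  shows "is_bilinear K V' W' U (\<lambda>(v, w). \<phi> (f v, g w))"
  unfolding is_bilinear_def
proof (intro conjI ballI; simp only: prod.case)
  show "is_linear K V' U (\<lambda>v. \<phi> (f v, g w))" if "w \<in> carrier W'" for w
    by (rule is_linear_comp[OF assms(2) is_bilinearD(1)[OF assms(1) is_linear_closed[OF assms(3) that]]])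
  show "is_linear K W' U (\<lambda>w. \<phi> (f v, g w))" if "v \<in> carrier V'" for v
    by (rule is_linear_comp[OF assms(3) is_bilinearD(2)[OF assms(1) is_linear_closed[OF assms(2) that]]])
qed

text \<open>The product of \<open>G\<close> with its opposite category. Its arrows will index bases
  of the Hom spaces of \<open>enveloping K (linearization K G)\<close>.\<close>

definition enveloping_cat :: "('o, 'a) cat \<Rightarrow> ('o \<times> 'o, 'a \<times> 'a) cat"
  where "enveloping_cat G = \<lparr>Obj = Obj G \<times> Obj G,
    Hom = (\<lambda>(x, y) (x', y'). Hom G x x' \<times> Hom G y' y),
    Id = (\<lambda>(x, y). (Id G x, Id G y)),
    Comp = (\<lambda>(x, y) (x', y') (x'', y'') (f', g') (f, g). (Comp G x x' x'' f' f, Comp G y'' y' y g g'))\<rparr>"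

lemma enveloping_cat_sel [simp]:
  "Obj (enveloping_cat G) = Obj G \<times> Obj G"
  "Hom (enveloping_cat G) (x, y) (x', y') = Hom G x x' \<times> Hom G y' y"
  "Id (enveloping_cat G) (x, y) = (Id G x, Id G y)"
  "Comp (enveloping_cat G) (x, y) (x', y') (x'', y'') (f', g') (f, g) = (Comp G x x' x'' f' f, Comp G y'' y' y g g')"
  by (simp_all add: enveloping_cat_def)

lemma (in small_category) small_category_enveloping: "small_category (enveloping_cat C)"
  by unfold_locales (auto simp: Id_in Comp_in Comp_Id Id_Comp Comp_assoc)

section \<open>The enveloping category of a linearization is itself a linearization\<close>

locale category_linearization = small_category G for G :: "('o, 'a) cat" +
  fixes K :: "('k, 'c) ring_scheme"
  assumes field_K: "field K"
begin

abbreviation FH :: "'o \<Rightarrow> 'o \<Rightarrow> ('k, 'a \<Rightarrow> 'k) module"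
  where "FH x y \<equiv> free_module K (Hom G x y)"

abbreviation L :: "('k, 'o, 'a \<Rightarrow> 'k) lincat"
  where "L \<equiv> linearization K G"

abbreviation D where "D \<equiv> enveloping K L"

lemma cring_K: "cring K"
  using field_K by (simp add: field.axioms(1) domain.axioms(1))

lemma FH: "module K (FH x y)"
  by (rule module_free_module[OF cring_K])

lemma basis_FH: "f \<in> Hom G x y \<Longrightarrow> basis_elt K f \<in> carrier (FH x y)"
  by (rule basis_elt_closed[OF cring_K])

context
  fixes x y z assumes xyz: "x \<in> Obj G" "y \<in> Obj G" "z \<in> Obj G"
begin

private lemma basis_comp: "\<lbrakk>f \<in> Hom G x y; g \<in> Hom G y z\<rbrakk> \<Longrightarrow> basis_elt K (Comp G x y z g f) \<in> carrier (FH x z)"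
  using xyz by (intro basis_FH Comp_in)

private lemma comp_inner: "g \<in> Hom G y z \<Longrightarrow>
    is_linear K (FH x y) (FH x z) (free_lift K (FH x z) (\<lambda>f. basis_elt K (Comp G x y z g f)))"
  using basis_comp by (intro free_lift_linear FH) auto

lemma LComp_linear_left:
  assumes "s \<in> carrier (FH x y)"
  shows "is_linear K (FH y z) (FH x z) (\<lambda>t. LComp L x y z t s)"
  unfolding linearization_def Let_def lincat.simps
  using is_linear_closed[OF comp_inner assms] by (intro free_lift_linear FH) auto

text \<open>Composition is a lift in \<open>t\<close> of a lift in \<open>s\<close>. With
  \<open>t\<close> held fixed, \<open>s\<close> is a parameter of the outer lift.\<close>

lemma LComp_linear_right:
  assumes "t \<in> carrier (FH y z)"
  shows "is_linear K (FH x y) (FH x z) (\<lambda>s. LComp L x y z t s)"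
  unfolding linearization_def Let_def lincat.simps
  by (rule free_lift_linear_param[OF FH FH comp_inner assms])

lemma LComp_closed:
  assumes "s \<in> carrier (FH x y)" "t \<in> carrier (FH y z)"
  shows "LComp L x y z t s \<in> carrier (FH x z)"
  by (rule is_linear_closed[OF LComp_linear_left[OF assms(1)] assms(2)])

lemma LComp_basis:
  assumes "f \<in> Hom G x y" "g \<in> Hom G y z"
  shows "LComp L x y z (basis_elt K g) (basis_elt K f) = basis_elt K (Comp G x y z g f)"
  unfolding linearization_def Let_def lincat.simps
  using assms basis_comp[OF assms] by (simp add: free_lift_basis[OF FH])

end

lemma L_sel [simp]: "LObj L = Obj G" "LHom L = FH" "LId L x = basis_elt K (Id G x)"
  by (simp_all add: linearization_def)

lemma LObj_D: "LObj D = Obj G \<times> Obj G"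
  by (simp add: enveloping_def)

lemma LHom_D: "LHom D (x, y) (x', y') = tensor_module K (FH x x') (FH y' y)"
  by (simp add: enveloping_def)

definition env_basis :: "'o \<times> 'o \<Rightarrow> 'o \<times> 'o \<Rightarrow> 'a \<times> 'a \<Rightarrow> (('a \<Rightarrow> 'k) \<times> ('a \<Rightarrow> 'k) \<Rightarrow> 'k) set"
  where "env_basis = (\<lambda>(x, y) (x', y') (f, g). tensor K (FH x x') (FH y' y) (basis_elt K f) (basis_elt K g))"

text \<open>The inverse of the canonical isomorphism from the space with basis A x B onto the tensor
  product of the spaces with bases A and B.\<close>

definition env_coord :: "'o \<times> 'o \<Rightarrow> 'o \<times> 'o \<Rightarrow> (('a \<Rightarrow> 'k) \<times> ('a \<Rightarrow> 'k) \<Rightarrow> 'k) set \<Rightarrow> 'a \<times> 'a \<Rightarrow> 'k"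
  where "env_coord = (\<lambda>(x, y) (x', y'). tensor_lift K (free_module K (Hom G x x' \<times> Hom G y' y))
    (\<lambda>(t, s) (f, g). t f \<otimes>\<^bsub>K\<^esub> s g))"

lemma env_basis_eq: "env_basis (x, y) (x', y') (f, g) = tensor K (FH x x') (FH y' y) (basis_elt K f) (basis_elt K g)"
  by (simp add: env_basis_def)

text \<open>The pointwise product is supported in the product of the two supports, which is
  finite.\<close>

lemma product_bilinear:
  "is_bilinear K (free_module K A) (free_module K B) (free_module K (A \<times> B)) (\<lambda>(t, s) (f, g). t f \<otimes>\<^bsub>K\<^esub> s g)"
proof -
  interpret cring K by (rule cring_K)
  note D = free_moduleD(1)
  have cl: "(\<lambda>(f, g). t f \<otimes>\<^bsub>K\<^esub> s g) \<in> carrier (free_module K (A \<times> B))"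
    if "t \<in> carrier (free_module K A)" "s \<in> carrier (free_module K B)" for t s
    using that
    by (intro free_moduleI[where A = "{f. t f \<noteq> \<zero>\<^bsub>K\<^esub>} \<times> {g. s g \<noteq> \<zero>\<^bsub>K\<^esub>}"])
      (auto simp: carrier_free_module split: prod.splits)
  show ?thesis
    unfolding is_bilinear_def
    by (intro conjI ballI is_linearI)
      (auto simp: cl fun_eq_iff l_distr r_distr m_assoc m_lcomm D split: prod.splits)
qed

lemma product_basis: "(\<lambda>(f, g). basis_elt K a f \<otimes>\<^bsub>K\<^esub> basis_elt K b g) = basis_elt K (a, b)"
proof -
  interpret cring K by (rule cring_K)
  show ?thesis by (auto simp: fun_eq_iff basis_elt_def)
qed

context
  fixes x y x' y' x'' y''
  assumes O: "x \<in> Obj G" "y \<in> Obj G" "x' \<in> Obj G" "y' \<in> Obj G" "x'' \<in> Obj G" "y'' \<in> Obj G"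
begin

private abbreviation "U \<equiv> tensor_module K (FH x x'') (FH y'' y)"

private lemma U: "module K U"
  by (rule module_tensor[OF FH FH])

private abbreviation "\<phi> f' g' \<equiv> (\<lambda>(f, g). tensor K (FH x x'') (FH y'' y) (LComp L x x' x'' f' f) (LComp L y'' y' y g g'))"

private lemma inner_bilinear:
  assumes "f' \<in> carrier (FH x' x'')" "g' \<in> carrier (FH y'' y')"
  shows "is_bilinear K (FH x x') (FH y' y) U (\<phi> f' g')"
  using is_bilinear_comp[OF tensor_bilinear[OF FH FH] LComp_linear_right[OF O(1,3,5) assms(1)]
      LComp_linear_left[OF O(6,4,2) assms(2)]]
  by simp

text \<open>Composition in \<open>D\<close> is a lift of a lift. The outer one obeys the universal
  property once the inner one is known to depend bilinearly on the pair (f', g'), that is, linearly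
  on each as a parameter.\<close>

private lemma outer_bilinear:
  assumes T: "T \<in> carrier (tensor_module K (FH x x') (FH y' y))"
  shows "is_bilinear K (FH x' x'') (FH y'' y') U (\<lambda>(f', g'). tensor_lift K U (\<phi> f' g') T)"
  unfolding is_bilinear_def
proof (intro conjI ballI; simp only: prod.case)
  show "is_linear K (FH x' x'') U (\<lambda>f'. tensor_lift K U (\<phi> f' g') T)" if g': "g' \<in> carrier (FH y'' y')" for g'
  proof (rule tensor_lift_linear_param[OF FH FH FH U inner_bilinear[OF _ g'] _ T]; (simp only: prod.case)?)
    fix f g assume fg: "f \<in> carrier (FH x x')" "g \<in> carrier (FH y' y)"
    show "is_linear K (FH x' x'') U (\<lambda>f'. tensor K (FH x x'') (FH y'' y) (LComp L x x' x'' f' f) (LComp L y'' y' y g g'))"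
      by (rule is_linear_comp[OF LComp_linear_left[OF O(1,3,5) fg(1)]
            is_bilinearD(1)[OF tensor_bilinear[OF FH FH] LComp_closed[OF O(6,4,2) g' fg(2)], simplified]])
  qed
  show "is_linear K (FH y'' y') U (\<lambda>g'. tensor_lift K U (\<phi> f' g') T)" if f': "f' \<in> carrier (FH x' x'')" for f'
  proof (rule tensor_lift_linear_param[OF FH FH FH U inner_bilinear[OF f'] _ T]; (simp only: prod.case)?)
    fix f g assume fg: "f \<in> carrier (FH x x')" "g \<in> carrier (FH y' y)"
    show "is_linear K (FH y'' y') U (\<lambda>g'. tensor K (FH x x'') (FH y'' y) (LComp L x x' x'' f' f) (LComp L y'' y' y g g'))"
      by (rule is_linear_comp[OF LComp_linear_right[OF O(6,4,2) fg(2)]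
            is_bilinearD(2)[OF tensor_bilinear[OF FH FH] LComp_closed[OF O(1,3,5) fg(1) f'], simplified]])
  qed
qed

private lemma LComp_D: "LComp D (x, y) (x', y') (x'', y'') S T
    = tensor_lift K U (\<lambda>(f', g'). tensor_lift K U (\<phi> f' g') T) S"
  by (simp add: enveloping_def Let_def)

lemma LComp_D_linear_left:
  assumes "T \<in> carrier (LHom D (x, y) (x', y'))"
  shows "is_linear K (LHom D (x', y') (x'', y'')) (LHom D (x, y) (x'', y'')) (\<lambda>S. LComp D (x, y) (x', y') (x'', y'') S T)"
  unfolding LComp_D LHom_D using assms unfolding LHom_D
  by (intro tensor_lift_linear FH U outer_bilinear)

lemma LComp_D_linear_right:
  assumes "S \<in> carrier (LHom D (x', y') (x'', y''))"
  shows "is_linear K (LHom D (x, y) (x', y')) (LHom D (x, y) (x'', y'')) (\<lambda>T. LComp D (x, y) (x', y') (x'', y'') S T)"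
  unfolding LComp_D LHom_D
proof (rule tensor_lift_linear_param[OF FH FH module_tensor[OF FH FH] U outer_bilinear _ assms[unfolded LHom_D]]; (simp only: prod.case)?)
  fix f' g' assume "f' \<in> carrier (FH x' x'')" "g' \<in> carrier (FH y'' y')"
  then show "is_linear K (tensor_module K (FH x x') (FH y' y)) U (tensor_lift K U (\<phi> f' g'))"
    by (intro tensor_lift_linear FH U inner_bilinear)
qed

lemma LComp_D_basis:
  assumes "f \<in> Hom G x x'" "g \<in> Hom G y' y" "f' \<in> Hom G x' x''" "g' \<in> Hom G y'' y'"
  shows "LComp D (x, y) (x', y') (x'', y'') (env_basis (x', y') (x'', y'') (f', g')) (env_basis (x, y) (x', y') (f, g))
    = env_basis (x, y) (x'', y'') (Comp G x x' x'' f' f, Comp G y'' y' y g g')"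
proof -
  note b = basis_FH[OF assms(1)] basis_FH[OF assms(2)] basis_FH[OF assms(3)] basis_FH[OF assms(4)]
  have T: "tensor K (FH x x') (FH y' y) (basis_elt K f) (basis_elt K g) \<in> carrier (tensor_module K (FH x x') (FH y' y))"
    by (rule tensor_closed[OF FH FH b(1,2)])
  show ?thesis
    unfolding LComp_D env_basis_eq
      tensor_lift_tensor[OF FH FH U outer_bilinear[OF T] b(3,4), simplified prod.case]
      tensor_lift_tensor[OF FH FH U inner_bilinear[OF b(3,4)] b(1,2), simplified prod.case]
    using LComp_basis O assms by simp
qed

end

text \<open>The point with content is \<open>coord_expand\<close>, that the arrows span each tensor
  product; the other conditions come down to bilinearity and values on pure tensors of
  arrows.\<close>

lemma env_linearized: "linearized_category K D (enveloping_cat G) env_basis env_coord"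
proof (intro linearized_category.intro prelinear_category.intro linearized_category_axioms.intro
    small_category_enveloping; (unfold LObj_D)?)
  fix p q assume "p \<in> Obj G \<times> Obj G" "q \<in> Obj G \<times> Obj G"
  then obtain x y x' y' where p: "p = (x, y)" "x \<in> Obj G" "y \<in> Obj G" and q: "q = (x', y')" "x' \<in> Obj G" "y' \<in> Obj G"
    by auto
  let ?P = "free_module K (Hom G x x' \<times> Hom G y' y)"
  have P: "module K ?P" by (rule module_free_module[OF cring_K])
  let ?T = "tensor_module K (FH x x') (FH y' y)"
  note T = module_tensor[OF FH[of x x'] FH[of y' y]]
  note tl = tensor_lift_linear[OF FH FH P product_bilinear]
  show "module K (LHom D p q)" unfolding p q LHom_D by (rule T)
  show lin: "is_linear K (LHom D p q) (free_module K (Hom (enveloping_cat G) p q)) (env_coord p q)"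
    unfolding p q LHom_D enveloping_cat_sel env_coord_def prod.case by (rule tl)
  {
    fix b assume "b \<in> Hom (enveloping_cat G) p q"
    then obtain f g where b: "b = (f, g)" "f \<in> Hom G x x'" "g \<in> Hom G y' y" by (auto simp: p q)
    show "env_basis p q b \<in> carrier (LHom D p q)"
      unfolding p q b env_basis_eq LHom_D by (intro tensor_closed FH basis_FH b)
    show "env_coord p q (env_basis p q b) = basis_elt K b"
      unfolding p q b env_basis_eq env_coord_def prod.case
      by (simp add: tensor_lift_tensor[OF FH FH P product_bilinear basis_FH[OF b(2)] basis_FH[OF b(3)]] product_basis)
  }
  fix S assume S: "S \<in> carrier (LHom D p q)"
  let ?b = "\<lambda>(f, g). tensor K (FH x x') (FH y' y) (basis_elt K f) (basis_elt K g)"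
  have b: "?b \<in> Hom G x x' \<times> Hom G y' y \<rightarrow> carrier ?T"
    by (auto intro!: tensor_closed FH basis_FH)
  note fl = free_lift_linear[OF T b]
  note bil = is_bilinearD[OF product_bilinear[of "Hom G x x'" "Hom G y' y"], simplified prod.case]
  note tbil = is_bilinearD[OF tensor_bilinear[OF FH[of x x'] FH[of y' y]], simplified prod.case]
  \<comment> \<open>Three reductions in turn: from elements of the tensor product to pure tensors,
    then to an arrow in the first factor, then to an arrow in the second.\<close>
  have "free_lift K ?T ?b (tensor_lift K ?P (\<lambda>(t, s) (f, g). t f \<otimes>\<^bsub>K\<^esub> s g) S) = S"
  proof (rule tensor_ext[OF FH FH T is_linear_comp[OF tl fl] _ _ S[unfolded p q LHom_D]])
    show "is_linear K ?T ?T (\<lambda>S. S)"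
      by (rule is_linearI) simp_all
    fix t s assume t: "t \<in> carrier (FH x x')" and s: "s \<in> carrier (FH y' y)"
    have "free_lift K ?T ?b (\<lambda>(f, g). t f \<otimes>\<^bsub>K\<^esub> s g) = tensor K (FH x x') (FH y' y) t s"
    proof (rule free_module_ext[OF T is_linear_comp[OF bil(1)[OF s] fl] tbil(1)[OF s] _ t])
      fix f assume f: "f \<in> Hom G x x'"
      show "free_lift K ?T ?b (\<lambda>(f', g). basis_elt K f f' \<otimes>\<^bsub>K\<^esub> s g)
          = tensor K (FH x x') (FH y' y) (basis_elt K f) s"
      proof (rule free_module_ext[OF T is_linear_comp[OF bil(2)[OF basis_FH[OF f]] fl] tbil(2)[OF basis_FH[OF f]] _ s])
        fix g assume g: "g \<in> Hom G y' y"
        show "free_lift K ?T ?b (\<lambda>(f', g'). basis_elt K f f' \<otimes>\<^bsub>K\<^esub> basis_elt K g g')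
            = tensor K (FH x x') (FH y' y) (basis_elt K f) (basis_elt K g)"
          unfolding product_basis
          using tensor_closed[OF FH FH basis_FH[OF f] basis_FH[OF g]] by (simp add: free_lift_basis[OF T])
      qed
    qed
    then show "free_lift K ?T ?b
        (tensor_lift K ?P (\<lambda>(t, s) (f, g). t f \<otimes>\<^bsub>K\<^esub> s g) (tensor K (FH x x') (FH y' y) t s)) = tensor K (FH x x') (FH y' y) t s"
      by (simp add: tensor_lift_tensor[OF FH FH P product_bilinear t s])
  qed
  moreover have "env_basis (x, y) (x', y') = ?b" by (auto simp: env_basis_eq)
  ultimately show "free_lift K (LHom D p q) (env_basis p q) (env_coord p q S) = S"
    unfolding p q LHom_D env_coord_def prod.case by simp
next
  fix p assume "p \<in> Obj G \<times> Obj G"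
  then obtain x y where p: "p = (x, y)" "x \<in> Obj G" "y \<in> Obj G" by auto
  show "LId D p = env_basis p p (Id (enveloping_cat G) p)"
    by (simp add: p enveloping_def env_basis_eq)
  show "LId D p \<in> carrier (LHom D p p)"
    using p by (simp add: enveloping_def tensor_closed[OF FH FH] basis_FH Id_in)
next
  fix p q r assume "p \<in> Obj G \<times> Obj G" "q \<in> Obj G \<times> Obj G" "r \<in> Obj G \<times> Obj G"
  then obtain x y x' y' x'' y'' where pqr: "p = (x, y)" "q = (x', y')" "r = (x'', y'')"
    and O: "x \<in> Obj G" "y \<in> Obj G" "x' \<in> Obj G" "y' \<in> Obj G" "x'' \<in> Obj G" "y'' \<in> Obj G"
    by auto
  show ll: "is_linear K (LHom D q r) (LHom D p r) (\<lambda>S. LComp D p q r S T)" if "T \<in> carrier (LHom D p q)" for T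
    using that unfolding pqr by (rule LComp_D_linear_left[OF O])
  show "is_linear K (LHom D p q) (LHom D p r) (\<lambda>T. LComp D p q r S T)" if "S \<in> carrier (LHom D q r)" for S
    using that unfolding pqr by (rule LComp_D_linear_right[OF O])
  show "LComp D p q r S T \<in> carrier (LHom D p r)" if "T \<in> carrier (LHom D p q)" "S \<in> carrier (LHom D q r)" for S T
    using is_linear_closed[OF ll[OF that(1)] that(2)] .
  show "LComp D p q r (env_basis q r c) (env_basis p q b) = env_basis p r (Comp (enveloping_cat G) p q r c b)"
    if "b \<in> Hom (enveloping_cat G) p q" "c \<in> Hom (enveloping_cat G) q r" for b c
    using that unfolding pqr by (auto simp: LComp_D_basis[OF O])
qed (simp_all add: field_K)

sublocale D: linearized_category K D "enveloping_cat G" env_basis env_coord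
  by (rule env_linearized)

section \<open>The regular bimodule\<close>

abbreviation C where "C \<equiv> regular_bimodule K L"

lemma FObj_C: "FObj C (x, y) = FH y x"
  by (simp add: regular_bimodule_def)

context
  fixes x y x' y'
  assumes O: "x \<in> Obj G" "y \<in> Obj G" "x' \<in> Obj G" "y' \<in> Obj G"
begin

lemma sandwich_bilinear:
  assumes m: "m \<in> carrier (FH y x)"
  shows "is_bilinear K (FH x x') (FH y' y) (FH y' x') (\<lambda>(f, g). LComp L y' x x' f (LComp L y' y x m g))"
  unfolding is_bilinear_def
proof (intro conjI ballI; simp only: prod.case)
  show "is_linear K (FH x x') (FH y' x') (\<lambda>f. LComp L y' x x' f (LComp L y' y x m g))" if "g \<in> carrier (FH y' y)" for g
    by (rule LComp_linear_left[OF O(4,1,3) LComp_closed[OF O(4,2,1) that m]])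
  show "is_linear K (FH y' y) (FH y' x') (\<lambda>g. LComp L y' x x' f (LComp L y' y x m g))" if "f \<in> carrier (FH x x')" for f
    by (rule is_linear_comp[OF LComp_linear_right[OF O(4,2,1) m] LComp_linear_right[OF O(4,1,3) that]])
qed

lemma sandwich_linear:
  assumes "f \<in> carrier (FH x x')" "g \<in> carrier (FH y' y)"
  shows "is_linear K (FH y x) (FH y' x') (\<lambda>m. LComp L y' x x' f (LComp L y' y x m g))"
  by (rule is_linear_comp[OF LComp_linear_left[OF O(4,2,1) assms(2)] LComp_linear_right[OF O(4,1,3) assms(1)]])

lemma sandwich_basis:
  assumes "f \<in> Hom G x x'" "g \<in> Hom G y' y" "m \<in> Hom G y x"
  shows "LComp L y' x x' (basis_elt K f) (LComp L y' y x (basis_elt K m) (basis_elt K g))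
    = basis_elt K (Comp G y' x x' f (Comp G y' y x m g))"
  using assms O by (simp add: LComp_basis Comp_in)

lemma sandwich_lift:
  assumes "f \<in> Hom G x x'" "g \<in> Hom G y' y" "m \<in> carrier (FH y x)"
  shows "tensor_lift K (FH y' x') (\<lambda>(f, g). LComp L y' x x' f (LComp L y' y x m g)) (env_basis (x, y) (x', y') (f, g))
    = LComp L y' x x' (basis_elt K f) (LComp L y' y x m (basis_elt K g))"
  unfolding env_basis_eq
  by (simp add: tensor_lift_tensor[OF FH FH FH sandwich_bilinear[OF assms(3)] basis_FH[OF assms(1)] basis_FH[OF assms(2)]])

end

text \<open>Written through \<open>mk_dmod\<close>, the bimodule needs its functor laws on pairs of
  arrows only, where they are the unit and associativity laws of \<open>G\<close>.\<close>

lemma regular_bimodule: "is_dmod K D C"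
proof -
  let ?V = "\<lambda>(x, y). FH y x"
  let ?h = "\<lambda>(x, y) (x', y') T m. tensor_lift K (FH y' x') (\<lambda>(f, g). LComp L y' x x' f (LComp L y' y x m g)) T"
  have "C = mk_dmod ?V ?h"
    by (auto simp: regular_bimodule_def mk_dmod_def fun_eq_iff split: prod.splits)
  moreover have "is_dmod K D (mk_dmod ?V ?h)"
  proof (rule D.mk_dmod_basisI; unfold LObj_D)
    show "module K (?V p)" for p by (simp add: FH split: prod.split)
    fix p q assume "p \<in> Obj G \<times> Obj G" "q \<in> Obj G \<times> Obj G"
    then obtain x y x' y' where pq: "p = (x, y)" "q = (x', y')"
      and O: "x \<in> Obj G" "y \<in> Obj G" "x' \<in> Obj G" "y' \<in> Obj G" by auto
    show "is_linear K (?V p) (?V q) (?h p q T)" if "T \<in> carrier (LHom D p q)" for T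
      using that unfolding pq LHom_D prod.case
      by (intro tensor_lift_linear_param[OF FH FH FH FH sandwich_bilinear[OF O]])
        (auto intro: sandwich_linear[OF O])
    show "is_linear K (LHom D p q) (?V q) (\<lambda>T. ?h p q T m)" if "m \<in> carrier (?V p)" for m
      using that unfolding pq LHom_D prod.case
      by (intro tensor_lift_linear FH sandwich_bilinear[OF O])
  next
    fix p v assume p': "p \<in> Obj G \<times> Obj G" and v: "v \<in> carrier (?V p)"
    then obtain x y where p: "p = (x, y)" and O: "x \<in> Obj G" "y \<in> Obj G" by auto
    have v': "v \<in> carrier (FH y x)" using v by (simp add: p)
    have Id: "Id G x \<in> Hom G x x" "Id G y \<in> Hom G y y" using O by (auto intro: Id_in)
    have "LComp L y x x (basis_elt K (Id G x)) (LComp L y y x v (basis_elt K (Id G y))) = v"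
      by (rule free_module_ext[OF FH sandwich_linear[OF O O basis_FH[OF Id(1)] basis_FH[OF Id(2)]] _ _ v'])
        (use O Id in \<open>auto intro!: is_linearI simp: sandwich_basis Comp_Id Id_Comp\<close>)
    then show "?h p p (env_basis p p (Id (enveloping_cat G) p)) v = v"
      by (simp add: p sandwich_lift[OF O O Id v'])
  next
    fix p q r b c v assume "p \<in> Obj G \<times> Obj G" "q \<in> Obj G \<times> Obj G" "r \<in> Obj G \<times> Obj G"
    then obtain x y x' y' x'' y'' where pqr: "p = (x, y)" "q = (x', y')" "r = (x'', y'')"
      and O: "x \<in> Obj G" "y \<in> Obj G" and O': "x' \<in> Obj G" "y' \<in> Obj G" and O'': "x'' \<in> Obj G" "y'' \<in> Obj G"
      by auto
    assume "b \<in> Hom (enveloping_cat G) p q" "c \<in> Hom (enveloping_cat G) q r"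
    then obtain f g f' g' where bc: "b = (f, g)" "c = (f', g')"
      and H: "f \<in> Hom G x x'" "g \<in> Hom G y' y" and H': "f' \<in> Hom G x' x''" "g' \<in> Hom G y'' y'"
      unfolding pqr by auto
    assume "v \<in> carrier (?V p)"
    then have v: "v \<in> carrier (FH y x)" by (simp add: pqr)
    have H'': "Comp G x x' x'' f' f \<in> Hom G x x''" "Comp G y'' y' y g g' \<in> Hom G y'' y"
      using H H' O O' O'' by (auto intro: Comp_in)
    note l = sandwich_linear[OF O O' basis_FH[OF H(1)] basis_FH[OF H(2)]]
      and l' = sandwich_linear[OF O' O'' basis_FH[OF H'(1)] basis_FH[OF H'(2)]]
      and l'' = sandwich_linear[OF O O'' basis_FH[OF H''(1)] basis_FH[OF H''(2)]]
    \<comment> \<open>Two-sided associativity, (f' f) v (g g') = f' (f v g) g', by linearity in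
      \<open>v\<close> from the same identity for arrows.\<close>
    have "LComp L y'' x x'' (basis_elt K (Comp G x x' x'' f' f)) (LComp L y'' y x v (basis_elt K (Comp G y'' y' y g g')))
      = LComp L y'' x' x'' (basis_elt K f') (LComp L y'' y' x' (LComp L y' x x' (basis_elt K f) (LComp L y' y x v (basis_elt K g))) (basis_elt K g'))"
      by (rule free_module_ext[OF FH l'' is_linear_comp[OF l l'] _ v])
        (use O O' O'' H H' H'' in \<open>simp add: sandwich_basis Comp_in Comp_assoc\<close>)
    then show "?h p r (env_basis p r (Comp (enveloping_cat G) p q r c b)) v
        = ?h q r (env_basis q r c) (?h p q (env_basis p q b) v)"
      by (simp add: pqr bc sandwich_lift[OF O O'' H'' v] sandwich_lift[OF O O' H v]
          sandwich_lift[OF O' O'' H' is_linear_closed[OF l v]])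
  qed
  ultimately show ?thesis by simp
qed

lemma FMor_C:
  assumes O: "x \<in> Obj G" "y \<in> Obj G" "x' \<in> Obj G" "y' \<in> Obj G"
    and "f \<in> Hom G x x'" "g \<in> Hom G y' y" "m \<in> Hom G y x"
  shows "FMor C (x, y) (x', y') (env_basis (x, y) (x', y') (f, g)) (basis_elt K m)
    = basis_elt K (Comp G y' x x' f (Comp G y' y x m g))"
  using assms basis_FH[of m y x]
  by (simp add: regular_bimodule_def sandwich_lift[OF O] sandwich_basis[OF O])

end

section \<open>Separability of the linearization of a groupoid\<close>

text \<open>Turns repeated addition of a vector into the scalar through which the order of a Hom set
  enters the theorem.\<close>

lemma (in module) finsum_const_smult:
  assumes "finite A" "v \<in> carrier M"
  shows "(\<Oplus>\<^bsub>M\<^esub>_\<in>A. v) = ([card A] \<cdot>\<^bsub>R\<^esub> \<one>\<^bsub>R\<^esub>) \<odot>\<^bsub>M\<^esub> v"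
  using assms(1)
proof (induction A rule: finite_induct)
  case empty
  then show ?case using assms(2) by simp
next
  case (insert a A)
  then show ?case
    using assms(2) by (simp add: smult_l_distr M.a_comm)
qed

lemma finsum_free_module_apply:
  assumes "cring K" "finite A" "f \<in> A \<rightarrow> carrier (free_module K B)"
  shows "(\<Oplus>\<^bsub>free_module K B\<^esub>a\<in>A. f a) b = (\<Oplus>\<^bsub>K\<^esub>a\<in>A. f a b)"
proof -
  interpret K: cring K by fact
  interpret F: module K "free_module K B" by (rule module_free_module[OF assms(1)])
  note D = free_moduleD(1)[of _ K B]
  show ?thesis
    using assms(2,3)
  proof (induction A rule: finite_induct)
    case empty
    then show ?case using F.M.finsum_empty by simp
  next
    case (insert a A)
    then show ?case
      using F.M.finsum_insert[of A a f] K.finsum_insert[of A a "\<lambda>a. f a b"] D by (simp add: Pi_iff)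
  qed
qed

text \<open>Pushing forward along an injection moves each coefficient without merging any two. It is
  applied to conjugation on the basis triples.\<close>

lemma free_lift_reindex_apply:
  assumes K: "cring K" and \<theta>: "inj_on \<theta> B" "\<theta> ` B \<subseteq> B'" and t: "t \<in> carrier (free_module K B)" and b: "b \<in> B"
  shows "free_lift K (free_module K B') (\<lambda>b. basis_elt K (\<theta> b)) t (\<theta> b) = t b"
proof -
  interpret K: cring K by fact
  let ?F' = "free_module K B'"
  have F': "module K ?F'" by (rule module_free_module[OF K])
  have cl: "(\<lambda>b. basis_elt K (\<theta> b)) \<in> B \<rightarrow> carrier ?F'"
    using \<theta>(2) by (auto intro: basis_elt_closed[OF K])
  note lin = free_lift_linear[OF F' cl]
  show ?thesis
    using K t
  proof (induction rule: free_module_induct)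
    case zero
    have "free_lift K ?F' (\<lambda>b. basis_elt K (\<theta> b)) (\<lambda>_. \<zero>\<^bsub>K\<^esub>) = (\<lambda>_. \<zero>\<^bsub>K\<^esub>)"
      using is_linear_zero[OF module_free_module[OF K] F' lin] by simp
    then show ?case by simp
  next
    case (add a b' s)
    have e: "basis_elt K b' \<in> carrier (free_module K B)" by (rule basis_elt_closed[OF K add(2)])
    have "free_lift K ?F' (\<lambda>b. basis_elt K (\<theta> b)) (a \<odot>\<^bsub>free_module K B\<^esub> basis_elt K b' \<oplus>\<^bsub>free_module K B\<^esub> s)
      = a \<odot>\<^bsub>?F'\<^esub> basis_elt K (\<theta> b') \<oplus>\<^bsub>?F'\<^esub> free_lift K ?F' (\<lambda>b. basis_elt K (\<theta> b)) s"
      using is_linear_add[OF lin module.smult_closed[OF module_free_module[OF K] add(1) e] add(3)]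
        is_linear_smult[OF lin add(1) e] free_lift_basis[OF F', of "\<lambda>b. basis_elt K (\<theta> b)" b'] cl add(2)
      by (simp only: Pi_iff)
    moreover have "basis_elt K (\<theta> b') (\<theta> b) = basis_elt K b' b"
      using inj_onD[OF \<theta>(1) _ b add(2)] by (auto simp: basis_elt_def)
    ultimately show ?case using add(4) by simp
  qed
qed

section \<open>Inverses and cardinalities of Hom sets in a groupoid\<close>

context small_groupoid
begin

definition ginv :: "'o \<Rightarrow> 'o \<Rightarrow> 'a \<Rightarrow> 'a"
  where "ginv x y f = (SOME g. g \<in> Hom G y x \<and> Comp G x y x g f = Id G x \<and> Comp G y x y f g = Id G y)"

context
  fixes x y f assumes xy: "x \<in> Obj G" "y \<in> Obj G" and f: "f \<in> Hom G x y"
begin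

lemma ginv: "ginv x y f \<in> Hom G y x" "Comp G x y x (ginv x y f) f = Id G x" "Comp G y x y f (ginv x y f) = Id G y"
proof -
  have "\<exists>g. g \<in> Hom G y x \<and> Comp G x y x g f = Id G x \<and> Comp G y x y f g = Id G y"
    using invertible[OF xy f] by blast
  from someI_ex[OF this]
  show "ginv x y f \<in> Hom G y x" "Comp G x y x (ginv x y f) f = Id G x" "Comp G y x y f (ginv x y f) = Id G y"
    unfolding ginv_def by blast+
qed

text \<open>h = (f^-1 f) h = f^-1 (f h), so a right inverse already is the chosen inverse.\<close>

lemma ginv_unique:
  assumes h: "h \<in> Hom G y x" and eq: "Comp G y x y f h = Id G y"
  shows "h = ginv x y f"
proof -
  have "h = Comp G y x x (Comp G x y x (ginv x y f) f) h" using xy h by (simp add: ginv Id_Comp)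
  also have "\<dots> = Comp G y y x (ginv x y f) (Comp G y x y f h)"
    using xy f h ginv(1) by (simp add: Comp_assoc)
  also have "\<dots> = ginv x y f" using xy ginv(1) by (simp add: eq Comp_Id)
  finally show ?thesis .
qed

lemma Comp_bij:
  assumes z: "z \<in> Obj G"
  shows "bij_betw (\<lambda>g. Comp G z x y f g) (Hom G z x) (Hom G z y)"
proof (rule bij_betw_byWitness[where f' = "\<lambda>h. Comp G z y x (ginv x y f) h"])
  show "\<forall>g\<in>Hom G z x. Comp G z y x (ginv x y f) (Comp G z x y f g) = g"
    using xy z f ginv by (simp add: Comp_assoc Id_Comp)
  show "\<forall>h\<in>Hom G z y. Comp G z x y f (Comp G z y x (ginv x y f) h) = h"
    using xy z f ginv by (simp add: Comp_assoc Id_Comp)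
qed (use xy z f ginv in \<open>auto intro: Comp_in\<close>)

end

text \<open>The two forms of (f g)^-1 = g^-1 f^-1 that occur: the first when an averaged sum is
  reindexed, the second when (g, g^-1) is conjugated.\<close>

lemma ginv_Comp:
  assumes O: "x \<in> Obj G" "y \<in> Obj G" "z \<in> Obj G" and f: "f \<in> Hom G x y" and g: "g \<in> Hom G z x"
  shows "Comp G x y z (ginv z y (Comp G z x y f g)) f = ginv z x g"
    and "Comp G y x z (ginv z x g) (ginv x y f) = ginv z y (Comp G z x y f g)"
proof -
  let ?k = "ginv z y (Comp G z x y f g)"
  have fg: "Comp G z x y f g \<in> Hom G z y" using O f g by (intro Comp_in)
  note fi = ginv[OF O(1,2) f] and gi = ginv[OF O(3,1) g] and ki = ginv[OF O(3,2) fg]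
  have kf: "Comp G x y z ?k f \<in> Hom G x z" using O f ki by (intro Comp_in)
  have "Comp G x y z ?k f = Comp G x x z (Comp G x y z ?k f) (Comp G x z x g (ginv z x g))"
    using O kf by (simp add: gi Comp_Id)
  also have "\<dots> = Comp G x z z (Comp G z x z (Comp G x y z ?k f) g) (ginv z x g)"
    by (rule Comp_assoc[OF O(1,3,1,3) gi(1) g kf])
  also have "Comp G z x z (Comp G x y z ?k f) g = Comp G z y z ?k (Comp G z x y f g)"
    by (rule Comp_assoc[OF O(3,1,2,3) g f ki(1), symmetric])
  also have "\<dots> = Id G z" by (rule ki(2))
  also have "Comp G x z z (Id G z) (ginv z x g) = ginv z x g" by (rule Id_Comp[OF O(1,3) gi(1)])
  finally show kf_eq: "Comp G x y z ?k f = ginv z x g" .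
  have "Comp G y x z (Comp G x y z ?k f) (ginv x y f) = Comp G y y z ?k (Comp G y x y f (ginv x y f))"
    by (rule Comp_assoc[OF O(2,1,2,3) fi(1) f ki(1), symmetric])
  also have "\<dots> = ?k" using O ki(1) by (simp add: fi Comp_Id)
  finally show "Comp G y x z (ginv z x g) (ginv x y f) = ?k" unfolding kf_eq .
qed

lemma Hom_connected:
  assumes "x \<in> Obj G" "y \<in> Obj G" "z \<in> Obj G" "Hom G x y \<noteq> {}"
  shows "Hom G z x \<noteq> {} \<longleftrightarrow> Hom G z y \<noteq> {}"
    and "finite (Hom G z x) \<longleftrightarrow> finite (Hom G z y)"
    and "card (Hom G z x) = card (Hom G z y)"
proof -
  obtain f where f: "f \<in> Hom G x y" using assms(4) by blast
  note b = Comp_bij[OF assms(1,2) f assms(3)]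
  show "Hom G z x \<noteq> {} \<longleftrightarrow> Hom G z y \<noteq> {}" using b bij_betw_empty1 bij_betw_empty2 by metis
  show "finite (Hom G z x) \<longleftrightarrow> finite (Hom G z y)" by (rule bij_betw_finite[OF b])
  show "card (Hom G z x) = card (Hom G z y)" by (rule bij_betw_same_card[OF b])
qed

lemma ginv_bij:
  assumes "x \<in> Obj G" "y \<in> Obj G"
  shows "bij_betw (ginv x y) (Hom G x y) (Hom G y x)"
proof -
  have "ginv y x (ginv x y f) = f" if "x \<in> Obj G" "y \<in> Obj G" "f \<in> Hom G x y" for x y f
    using ginv_unique[OF that(2,1) ginv(1)[OF that] that(3) ginv(2)[OF that]] by simp
  then show ?thesis
    using assms ginv(1) by (intro bij_betw_byWitness[where f' = "ginv y x"]) auto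
qed

text \<open>Postcomposition with an arrow z -> x and inversion are bijections, so the finiteness and
  order of a nonempty Hom set are those of a loop group. This reduces the theorem to the case x =
  y.\<close>

lemma Hom_loops:
  assumes "x \<in> Obj G" "z \<in> Obj G" "Hom G z x \<noteq> {}"
  shows "finite (Hom G z x) \<longleftrightarrow> finite (Hom G x x)" and "card (Hom G z x) = card (Hom G x x)"
  using Hom_connected(2,3)[OF assms(2,1,1,3)] bij_betw_finite[OF ginv_bij[OF assms(2,1)]]
    bij_betw_same_card[OF ginv_bij[OF assms(2,1)]] by simp_all

end

section \<open>A section by averaging\<close>

locale groupoid_linearization = category_linearization G K + small_groupoid G
  for G :: "('o, 'a) cat" and K :: "('k, 'c) ring_scheme"
begin

abbreviation ord_Hom :: "'o \<Rightarrow> 'o \<Rightarrow> 'k"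
  where "ord_Hom x y \<equiv> [card (Hom G x y)] \<cdot>\<^bsub>K\<^esub> \<one>\<^bsub>K\<^esub>"

text \<open>
  A section of an epimorphism onto \<open>K[G]\<close> is obtained by averaging: with a base object \<open>b\<close> chosen in
  each connected component and \<open>q\<close> a preimage of the identity of \<open>b\<close>, it maps \<open>m : y \<rightarrow> x\<close> to the
  mean of \<open>g \<cdot> q \<cdot> g\<^sup>-\<^sup>1 m\<close> over all \<open>g : b \<rightarrow> x\<close>.
\<close>

lemma averaging_section:
  fixes P :: "('k, 'o, 'a \<Rightarrow> 'k, 'm) bimod"
  assumes P: "is_dmod K D P" and e: "e \<in> nat_trans K D P C" and epi: "dmod_epi D P C e"
    and fin: "\<And>x y. \<lbrakk>x \<in> Obj G; y \<in> Obj G; Hom G x y \<noteq> {}\<rbrakk> \<Longrightarrow> finite (Hom G x y)"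
    and unit: "\<And>x y. \<lbrakk>x \<in> Obj G; y \<in> Obj G; Hom G x y \<noteq> {}\<rbrakk> \<Longrightarrow> ord_Hom x y \<in> Units K"
  shows "\<exists>s \<in> nat_trans K D C P. \<forall>p\<in>LObj D. \<forall>a\<in>carrier (FObj C p). e p (s p a) = a"
proof -
  interpret K: cring K by (rule cring_K)
  \<comment> \<open>The predicate under \<open>SOME\<close> depends only on the connected component
    of \<open>x\<close>, so a component shares one base object. Naturality along an arrow x -> x'
    relies on both ends using the same one.\<close>
  define b where "b x = (SOME z. z \<in> Obj G \<and> Hom G z x \<noteq> {})" for x
  have b: "b x \<in> Obj G" "Hom G (b x) x \<noteq> {}" if "x \<in> Obj G" for x
    using someI[of "\<lambda>z. z \<in> Obj G \<and> Hom G z x \<noteq> {}" x] that Id_in[OF that] unfolding b_def by blast+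
  have b_eq: "b x = b y" if "x \<in> Obj G" "y \<in> Obj G" "Hom G x y \<noteq> {}" for x y
  proof -
    have "(\<lambda>z. z \<in> Obj G \<and> Hom G z x \<noteq> {}) = (\<lambda>z. z \<in> Obj G \<and> Hom G z y \<noteq> {})"
      using Hom_connected(1)[OF that(1,2) _ that(3)] by (intro ext conj_cong refl)
    then show ?thesis by (simp add: b_def)
  qed
  have "\<exists>q. q \<in> carrier (FObj P (z, z)) \<and> e (z, z) q = basis_elt K (Id G z)" if z: "z \<in> Obj G" for z
  proof -
    have "basis_elt K (Id G z) \<in> e (z, z) ` carrier (FObj P (z, z))"
      using epi z basis_FH[OF Id_in[OF z]] by (auto simp: dmod_epi_def LObj_D FObj_C)
    then show ?thesis by (auto simp: image_iff)
  qed
  then obtain q where q: "\<And>z. z \<in> Obj G \<Longrightarrow> q z \<in> carrier (FObj P (z, z))"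
    "\<And>z. z \<in> Obj G \<Longrightarrow> e (z, z) (q z) = basis_elt K (Id G z)" by metis
  \<comment> \<open>The element g q_z h, for the two-sided action on \<open>P\<close>.\<close>
  define A where "A z x y g h = FMor P (z, z) (x, y) (env_basis (z, z) (x, y) (g, h)) (q z)" for z x y g h
  have A_closed: "A z x y g h \<in> carrier (FObj P (x, y))"
    if "z \<in> Obj G" "x \<in> Obj G" "y \<in> Obj G" "g \<in> Hom G z x" "h \<in> Hom G y z" for z x y g h
    unfolding A_def using that q(1)
    by (intro D.dmod_closed[OF P] D.basis_closed) (auto simp: LObj_D)
  have A_act: "FMor P (x, y) (x', y') (env_basis (x, y) (x', y') (f, k)) (A z x y g h)
      = A z x' y' (Comp G z x x' f g) (Comp G y' y z h k)"
    if "z \<in> Obj G" "x \<in> Obj G" "y \<in> Obj G" "x' \<in> Obj G" "y' \<in> Obj G"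
      "g \<in> Hom G z x" "h \<in> Hom G y z" "f \<in> Hom G x x'" "k \<in> Hom G y' y" for z x y x' y' g h f k
  proof -
    have O: "(z, z) \<in> LObj D" "(x, y) \<in> LObj D" "(x', y') \<in> LObj D" using that by (auto simp: LObj_D)
    have H: "(g, h) \<in> Hom (enveloping_cat G) (z, z) (x, y)" "(f, k) \<in> Hom (enveloping_cat G) (x, y) (x', y')"
      using that by auto
    show ?thesis
      unfolding A_def D.dmod_comp[OF P O D.basis_closed[OF O(1,2) H(1)] D.basis_closed[OF O(2,3) H(2)] q(1)[OF that(1)], symmetric]
      using D.LComp_basis[OF O H] by simp
  qed
  have e_A: "e (x, y) (A z x y g h) = basis_elt K (Comp G y z x g h)"
    if "z \<in> Obj G" "x \<in> Obj G" "y \<in> Obj G" "g \<in> Hom G z x" "h \<in> Hom G y z" for z x y g h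
  proof -
    have O: "(z, z) \<in> LObj D" "(x, y) \<in> LObj D" using that by (auto simp: LObj_D)
    have H: "(g, h) \<in> Hom (enveloping_cat G) (z, z) (x, y)" using that by auto
    show ?thesis
      unfolding A_def D.nat_trans_natural[OF e O D.basis_closed[OF O H] q(1)[OF that(1)]] q(2)[OF that(1)]
      using FMor_C[OF that(1,1,2,3,4,5) Id_in[OF that(1)]] that by (simp add: Id_Comp)
  qed
  \<comment> \<open>The reciprocal of the number of summands below; \<open>unit\<close> makes it
    exist because some arrow leads from \<open>b x\<close> to \<open>x\<close>.\<close>
  define N where "N x = inv\<^bsub>K\<^esub> (ord_Hom (b x) x)" for x
  have N: "N x \<in> carrier K" "N x \<otimes>\<^bsub>K\<^esub> (ord_Hom (b x) x) = \<one>\<^bsub>K\<^esub>" if "x \<in> Obj G" for x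
    using unit[OF b(1)[OF that] that b(2)[OF that]] by (auto simp: N_def)
  have N_eq: "N x = N y" if "x \<in> Obj G" "y \<in> Obj G" "Hom G x y \<noteq> {}" for x y
    using Hom_connected(3)[OF that(1,2) b(1)[OF that(1)] that(3)] b_eq[OF that] by (simp add: N_def)
  define T where "T x y m g = A (b x) x y g (Comp G y x (b x) (ginv (b x) x g) m)" for x y m g
  define S where "S x y m = (\<Oplus>\<^bsub>FObj P (x, y)\<^esub>g\<in>Hom G (b x) x. T x y m g)" for x y m
  define s0 where "s0 x y m = N x \<odot>\<^bsub>FObj P (x, y)\<^esub> S x y m" for x y m
  have Pm: "module K (FObj P (x, y))" if "x \<in> Obj G" "y \<in> Obj G" for x y
    using that by (intro D.dmod_module[OF P]) (simp add: LObj_D)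
  have T_closed: "T x y m g \<in> carrier (FObj P (x, y))"
    if "x \<in> Obj G" "y \<in> Obj G" "m \<in> Hom G y x" "g \<in> Hom G (b x) x" for x y m g
    unfolding T_def using that b ginv(1) by (intro A_closed Comp_in) auto
  have S_closed: "S x y m \<in> carrier (FObj P (x, y))"
    if "x \<in> Obj G" "y \<in> Obj G" "m \<in> Hom G y x" for x y m
  proof -
    interpret Pxy: module K "FObj P (x, y)" by (rule Pm[OF that(1,2)])
    show ?thesis unfolding S_def using T_closed[OF that] by (intro Pxy.M.finsum_closed) auto
  qed
  have s0_closed: "s0 x y m \<in> carrier (FObj P (x, y))" if "x \<in> Obj G" "y \<in> Obj G" "m \<in> Hom G y x" for x y m
    unfolding s0_def by (rule module.smult_closed[OF Pm[OF that(1,2)] N(1)[OF that(1)] S_closed[OF that]])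
  have e_s0: "e (x, y) (s0 x y m) = basis_elt K m" if O: "x \<in> Obj G" "y \<in> Obj G" and m: "m \<in> Hom G y x" for x y m
  proof -
    have xy: "(x, y) \<in> LObj D" using O by (simp add: LObj_D)
    interpret F: module K "FH y x" by (rule FH)
    note lin = D.nat_trans_linear[OF e xy, unfolded FObj_C]
    \<comment> \<open>The summand g q (g^-1 m) is sent to g 1 (g^-1 m) = m whatever \<open>g\<close>
      is, so the sum is sent to a multiple of m that \<open>N x\<close> normalizes.\<close>
    have "e (x, y) (T x y m g) = basis_elt K m" if g: "g \<in> Hom G (b x) x" for g
      unfolding T_def using O b[OF O(1)] g m ginv[OF b(1)[OF O(1)] O(1) g]
      by (simp add: e_A Comp_in Comp_assoc Id_Comp)
    then have "(\<Oplus>\<^bsub>FH y x\<^esub>g\<in>Hom G (b x) x. e (x, y) (T x y m g)) = (\<Oplus>\<^bsub>FH y x\<^esub>g\<in>Hom G (b x) x. basis_elt K m)"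
      using basis_FH[OF m] by (intro F.M.finsum_cong') auto
    also have "\<dots> = (ord_Hom (b x) x) \<odot>\<^bsub>FH y x\<^esub> basis_elt K m"
      by (rule F.finsum_const_smult[OF fin[OF b(1)[OF O(1)] O(1) b(2)[OF O(1)]] basis_FH[OF m]])
    finally have sum: "e (x, y) (S x y m)
        = (ord_Hom (b x) x) \<odot>\<^bsub>FH y x\<^esub> basis_elt K m"
      using is_linear_finsum[OF Pm[OF O] FH lin fin[OF b(1)[OF O(1)] O(1) b(2)[OF O(1)]], of "T x y m"] T_closed[OF O m]
      by (auto simp: S_def)
    show ?thesis
      unfolding s0_def is_linear_smult[OF lin N(1)[OF O(1)] S_closed[OF O m]] sum
      using N[OF O(1)] basis_FH[OF m] F.smult_assoc1[OF N(1)[OF O(1)], of "ord_Hom (b x) x" "basis_elt K m"]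
        F.smult_one[OF basis_FH[OF m]]
      by (simp del: free_module_sel)
  qed
  have s0_act: "FMor P (x, y) (x', y') (env_basis (x, y) (x', y') (f, k)) (s0 x y m)
      = s0 x' y' (Comp G y' x x' f (Comp G y' y x m k))"
    if O: "x \<in> Obj G" "y \<in> Obj G" and O': "x' \<in> Obj G" "y' \<in> Obj G"
      and m: "m \<in> Hom G y x" and f: "f \<in> Hom G x x'" and k: "k \<in> Hom G y' y" for x y x' y' m f k
  proof -
    let ?act = "FMor P (x, y) (x', y') (env_basis (x, y) (x', y') (f, k))"
    have L: "(x, y) \<in> LObj D" "(x', y') \<in> LObj D" using O O' by (simp_all add: LObj_D)
    have H: "(f, k) \<in> Hom (enveloping_cat G) (x, y) (x', y')" using f k by auto
    note lin = D.dmod_linear[OF P L D.basis_closed[OF L H]]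
    interpret P': module K "FObj P (x', y')" by (rule Pm[OF O'])
    have ne: "Hom G x x' \<noteq> {}" using f by blast
    have bx: "b x' = b x" using b_eq[OF O(1) O'(1) ne] by simp
    let ?m = "Comp G y' x x' f (Comp G y' y x m k)"
    have m': "?m \<in> Hom G y' x'" using O O' m f k by (auto intro: Comp_in)
    note bij = Comp_bij[OF O(1) O'(1) f b(1)[OF O(1)]]
    \<comment> \<open>Acting by (f, k) takes the summand of \<open>g\<close> to the summand of f g,
      because g^-1 = (f g)^-1 f.\<close>
    have act: "?act (T x y m g) = T x' y' ?m (Comp G (b x) x x' f g)"
      if g: "g \<in> Hom G (b x) x" for g
    proof -
      have bO: "b x \<in> Obj G" by (rule b(1)[OF O(1)])
      have gi: "ginv (b x) x g \<in> Hom G x (b x)" by (rule ginv(1)[OF bO O(1) g])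
      have fg: "Comp G (b x) x x' f g \<in> Hom G (b x) x'" using bO O O' f g by (intro Comp_in)
      have fgi: "ginv (b x) x' (Comp G (b x) x x' f g) \<in> Hom G x' (b x)" by (rule ginv(1)[OF bO O'(1) fg])
      have mk: "Comp G y' y x m k \<in> Hom G y' x" using O O' m k by (intro Comp_in)
      have "Comp G y' x' (b x) (ginv (b x) x' (Comp G (b x) x x' f g)) ?m
          = Comp G y' x (b x) (Comp G x x' (b x) (ginv (b x) x' (Comp G (b x) x x' f g)) f) (Comp G y' y x m k)"
        by (rule Comp_assoc[OF O'(2) O(1) O'(1) bO mk f fgi])
      also have "\<dots> = Comp G y' x (b x) (ginv (b x) x g) (Comp G y' y x m k)"
        using ginv_Comp(1)[OF O(1) O'(1) bO f g] by simp
      also have "\<dots> = Comp G y' y (b x) (Comp G y x (b x) (ginv (b x) x g) m) k"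
        by (rule Comp_assoc[OF O'(2) O(2,1) bO k m gi])
      finally show ?thesis
        unfolding T_def bx using A_act[OF bO O O' g Comp_in[OF O(2,1) bO m gi] f k] by simp
    qed
    have "?act (S x y m)
        = (\<Oplus>\<^bsub>FObj P (x', y')\<^esub>g\<in>Hom G (b x) x. ?act (T x y m g))"
      unfolding S_def using T_closed[OF O m] by (intro is_linear_finsum[OF Pm[OF O] Pm[OF O'] lin fin[OF b(1)[OF O(1)] O(1) b(2)[OF O(1)]]]) auto
    also have "\<dots> = (\<Oplus>\<^bsub>FObj P (x', y')\<^esub>g\<in>Hom G (b x) x. T x' y' ?m (Comp G (b x) x x' f g))"
      using T_closed[OF O' m'] bx bij_betwE[OF bij] by (intro P'.M.finsum_cong') (auto simp: act)
    \<comment> \<open>As \<open>g\<close> runs through the arrows from the base object to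
      \<open>x\<close>, the composite f g runs once through those to x'.\<close>
    also have "\<dots> = (\<Oplus>\<^bsub>FObj P (x', y')\<^esub>h\<in>(\<lambda>g. Comp G (b x) x x' f g) ` Hom G (b x) x. T x' y' ?m h)"
      using T_closed[OF O' m'] bx bij
      by (intro P'.M.finsum_reindex[symmetric]) (auto simp: bij_betw_def)
    also have "(\<lambda>g. Comp G (b x) x x' f g) ` Hom G (b x) x = Hom G (b x') x'"
      using bij bx by (simp add: bij_betw_def)
    finally show ?thesis
      unfolding s0_def using S_def is_linear_smult[OF lin N(1)[OF O(1)] S_closed[OF O m]] N_eq[OF O(1) O'(1) ne] by simp
  qed
  let ?h = "\<lambda>(x, y). free_lift K (FObj P (x, y)) (s0 x y)"
  have lin: "is_linear K (FObj C p) (FObj P p) (?h p)" if "p \<in> LObj D" for p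
    using that s0_closed Pm by (auto simp: LObj_D FObj_C intro!: free_lift_linear)
  have hb: "?h (x, y) (basis_elt K m) = s0 x y m" if "x \<in> Obj G" "y \<in> Obj G" "m \<in> Hom G y x" for x y m
    using free_lift_basis[OF Pm[OF that(1,2)], of "s0 x y" m] s0_closed[OF that] by simp
  have s: "mk_nat D C ?h \<in> nat_trans K D C P"
  proof (rule D.mk_nat_basisI[OF regular_bimodule P lin])
    fix p p' c v assume p: "p \<in> LObj D" and p': "p' \<in> LObj D" and c: "c \<in> Hom (enveloping_cat G) p p'"
      and v: "v \<in> carrier (FObj C p)"
    then obtain x y x' y' f k where pp': "p = (x, y)" "p' = (x', y')" "c = (f, k)"
      and O: "x \<in> Obj G" "y \<in> Obj G" and O': "x' \<in> Obj G" "y' \<in> Obj G" and fk: "f \<in> Hom G x x'" "k \<in> Hom G y' y"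
      by (auto simp: LObj_D)
    note \<beta> = D.basis_closed[OF p p' c]
    have lC: "is_linear K (FH y x) (FObj C p') (FMor C p p' (env_basis p p' c))"
      using D.dmod_linear[OF regular_bimodule p p' \<beta>] by (simp add: pp' FObj_C)
    have lP: "is_linear K (FH y x) (FObj P p) (?h p)" using lin[OF p] by (simp add: pp' FObj_C)
    have v': "v \<in> carrier (FH y x)" using v by (simp add: pp' FObj_C)
    show "?h p' (FMor C p p' (env_basis p p' c) v) = FMor P p p' (env_basis p p' c) (?h p v)"
    proof (rule free_module_ext[OF D.dmod_module[OF P p'] is_linear_comp[OF lC lin[OF p']]
          is_linear_comp[OF lP D.dmod_linear[OF P p p' \<beta>]] _ v'])
      fix m assume m: "m \<in> Hom G y x"
      have "Comp G y' x x' f (Comp G y' y x m k) \<in> Hom G y' x'" using O O' fk m by (auto intro: Comp_in)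
      then show "?h p' (FMor C p p' (env_basis p p' c) (basis_elt K m)) = FMor P p p' (env_basis p p' c) (?h p (basis_elt K m))"
        unfolding pp' FMor_C[OF O O' fk m] hb[OF O m] s0_act[OF O O' m fk] by (rule hb[OF O'])
    qed
  qed
  moreover have "e p (mk_nat D C ?h p a) = a" if p: "p \<in> LObj D" and a: "a \<in> carrier (FObj C p)" for p a
  proof -
    obtain x y where xy: "p = (x, y)" and O: "x \<in> Obj G" "y \<in> Obj G" using p by (auto simp: LObj_D)
    have lP: "is_linear K (FH y x) (FObj P p) (?h p)" using lin[OF p] by (simp add: xy FObj_C)
    have le: "is_linear K (FObj P p) (FH y x) (e p)" using D.nat_trans_linear[OF e p] by (simp add: xy FObj_C)
    have a': "a \<in> carrier (FH y x)" using a by (simp add: xy FObj_C)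
    have "e p (?h p a) = a"
    proof (rule free_module_ext[OF FH is_linear_comp[OF lP le] _ _ a'])
      show "is_linear K (FH y x) (FH y x) (\<lambda>a. a)" by (rule is_linearI) simp_all
      show "e p (?h p (basis_elt K m)) = basis_elt K m" if "m \<in> Hom G y x" for m
        unfolding xy hb[OF O that] by (rule e_s0[OF O that])
    qed
    then show ?thesis using p a by simp
  qed
  ultimately show ?thesis by blast
qed

section \<open>The free bimodule on the diagonal objects and conjugation\<close>

definition diag_dmod :: "('k, 'o, 'a \<Rightarrow> 'k, 'o \<times> ('a \<times> 'a) \<Rightarrow> 'k) bimod"
  where "diag_dmod = D.free_dmod (Obj G) (\<lambda>z. (z, z))"

lemma diag_obj: "z \<in> Obj G \<Longrightarrow> (z, z) \<in> LObj D"
  by (simp add: LObj_D)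

lemma diag_dmod: "is_dmod K D diag_dmod"
  unfolding diag_dmod_def by (rule D.free_dmod) (rule diag_obj)

lemma FObj_diag: "FObj diag_dmod (x, y) = free_module K (SIGMA z:Obj G. Hom G z x \<times> Hom G y z)"
  by (simp add: diag_dmod_def D.FObj_free_dmod D.free_basis_def)

text \<open>Sending the generator at (z, z) to 1_z sends (g, h) to the composite g h. Surjectivity
  is visible in the summand z = x, where (1_x, m) is sent to m.\<close>

lemma diag_epi:
  obtains \<pi> where "\<pi> \<in> nat_trans K D diag_dmod C" and "dmod_epi D diag_dmod C \<pi>"
    and "\<And>x y z g h. \<lbrakk>x \<in> Obj G; y \<in> Obj G; z \<in> Obj G; g \<in> Hom G z x; h \<in> Hom G y z\<rbrakk>
      \<Longrightarrow> \<pi> (x, y) (basis_elt K (z, (g, h))) = basis_elt K (Comp G y z x g h)"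
proof -
  have m: "basis_elt K (Id G z) \<in> carrier (FObj C (z, z))" if "z \<in> Obj G" for z
    using basis_FH[OF Id_in[OF that]] by (simp add: FObj_C)
  define \<pi> where "\<pi> = mk_nat D diag_dmod (\<lambda>p. free_lift K (FObj C p)
    (\<lambda>(z, b). FMor C (z, z) p (env_basis (z, z) p b) (basis_elt K (Id G z))))"
  note ext = D.free_dmod_extend[where I = "Obj G" and p = "\<lambda>z. (z, z)" and m = "\<lambda>z. basis_elt K (Id G z)",
      OF diag_obj regular_bimodule m, folded diag_dmod_def, folded \<pi>_def]
  have \<pi>: "\<pi> \<in> nat_trans K D diag_dmod C" by (rule ext(1))
  have \<pi>_basis: "\<pi> (x, y) (basis_elt K (z, (g, h))) = basis_elt K (Comp G y z x g h)"
    if O: "x \<in> Obj G" "y \<in> Obj G" "z \<in> Obj G" and gh: "g \<in> Hom G z x" "h \<in> Hom G y z" for x y z g h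
  proof -
    have "\<pi> (x, y) (basis_elt K (z, (g, h))) = FMor C (z, z) (x, y) (env_basis (z, z) (x, y) (g, h)) (basis_elt K (Id G z))"
      by (rule ext(2)) (use O gh in \<open>simp_all add: LObj_D\<close>)
    also have "\<dots> = basis_elt K (Comp G y z x g h)"
      using FMor_C[OF O(3,3,1,2) gh Id_in[OF O(3)]] O gh by (simp add: Id_Comp)
    finally show ?thesis .
  qed
  have "dmod_epi D diag_dmod C \<pi>"
    unfolding dmod_epi_def
  proof (intro ballI equalityI subsetI)
    fix p v assume p: "p \<in> LObj D" and v: "v \<in> carrier (FObj C p)"
    obtain x y where xy: "p = (x, y)" and O: "x \<in> Obj G" "y \<in> Obj G" using p by (auto simp: LObj_D)
    let ?Q = "FObj diag_dmod p"
    let ?\<sigma> = "free_lift K ?Q (\<lambda>m. basis_elt K (x, (Id G x, m)))"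
    have Q: "module K ?Q" by (rule D.dmod_module[OF diag_dmod p])
    have cl: "basis_elt K (x, (Id G x, m)) \<in> carrier ?Q" if "m \<in> Hom G y x" for m
      unfolding xy FObj_diag using that O by (intro basis_elt_closed cring_K) (auto intro: Id_in)
    have \<sigma>: "is_linear K (FH y x) ?Q ?\<sigma>" using cl by (intro free_lift_linear Q) auto
    have lin: "is_linear K ?Q (FH y x) (\<pi> p)" using D.nat_trans_linear[OF \<pi> p] by (simp add: xy FObj_C)
    have v': "v \<in> carrier (FH y x)" using v by (simp add: xy FObj_C)
    have "\<pi> p (?\<sigma> v) = v"
    proof (rule free_module_ext[OF FH is_linear_comp[OF \<sigma> lin] _ _ v'])
      show "is_linear K (FH y x) (FH y x) (\<lambda>v. v)" by (rule is_linearI) simp_all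
      fix m assume m: "m \<in> Hom G y x"
      have "?\<sigma> (basis_elt K m) = basis_elt K (x, (Id G x, m))"
        using free_lift_basis[OF Q, of "\<lambda>m. basis_elt K (x, (Id G x, m))" m] cl[OF m] by simp
      then show "\<pi> p (?\<sigma> (basis_elt K m)) = basis_elt K m"
        unfolding xy using \<pi>_basis[OF O O(1) Id_in[OF O(1)] m] O m by (simp add: Id_Comp)
    qed
    then show "v \<in> \<pi> p ` carrier ?Q" using is_linear_closed[OF \<sigma> v'] by (metis image_eqI)
  qed (use D.nat_trans_closed[OF \<pi>] in auto)
  with \<pi> \<pi>_basis show thesis using that by blast
qed

text \<open>Here \<open>u\<close> stands for a lift of 1_x to the diagonal bimodule. Its
  coefficients at triples (z, g, g^-1) are compared along orbits of conjugation, and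
  \<open>one\<close> says that they add up to 1.\<close>

lemma conjugation_invariant:
  assumes x: "x \<in> Obj G" and u: "u \<in> carrier (FObj diag_dmod (x, x))"
    and inv: "\<And>f. f \<in> Hom G x x \<Longrightarrow> FMor diag_dmod (x, x) (x, x) (env_basis (x, x) (x, x) (f, ginv x x f)) u = u"
    and one: "free_lift K (FH x x) (\<lambda>(z, g, h). basis_elt K (Comp G x z x g h)) u = basis_elt K (Id G x)"
  shows "finite (Hom G x x)" and "ord_Hom x x \<in> Units K"
proof -
  interpret K: field K by (rule field_K)
  let ?B = "SIGMA z:Obj G. Hom G z x \<times> Hom G x z"
  have u': "u \<in> carrier (free_module K ?B)" using u by (simp add: FObj_diag)
  have xx: "(x, x) \<in> LObj D" using x by (simp add: LObj_D)
  \<comment> \<open>Conjugation by \<open>f\<close> acts on the basis through the injection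
    \<open>?\<theta>\<close>; invariance of \<open>u\<close> therefore equates its coefficients at a
    triple and at the image of that triple.\<close>
  have shift: "u (z, (Comp G z x x f g, ginv z x (Comp G z x x f g))) = u (z, (g, ginv z x g))"
    if f: "f \<in> Hom G x x" and z: "z \<in> Obj G" and g: "g \<in> Hom G z x" for f z g
  proof -
    let ?fi = "ginv x x f"
    note fi = ginv[OF x x f]
    let ?\<theta> = "\<lambda>(z, (g, h)). (z, (Comp G z x x f g, Comp G x x z h ?fi))"
    have H: "(f, ?fi) \<in> Hom (enveloping_cat G) (x, x) (x, x)" using f fi by simp
    have "u = D.free_act (Obj G) (\<lambda>z. (z, z)) (x, x) (x, x) (f, ?fi) u"
      using inv[OF f] D.FMor_free_dmod[where I = "Obj G" and p = "\<lambda>z. (z, z)", OF diag_obj xx xx H] u unfolding diag_dmod_def by simp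
    also have "\<dots> = free_lift K (free_module K ?B) (\<lambda>b. basis_elt K (?\<theta> b)) u"
      unfolding D.free_act_def D.free_basis_def
      by (intro arg_cong2[where f = "\<lambda>\<phi> B. free_lift K (free_module K B) \<phi> u"])
        (auto simp: fun_eq_iff split: prod.split)
    finally have u_eq: "u = free_lift K (free_module K ?B) (\<lambda>b. basis_elt K (?\<theta> b)) u" .
    have "inj_on ?\<theta> ?B"
    proof (rule inj_onI)
      fix a b assume a: "a \<in> ?B" and b: "b \<in> ?B" and eq: "?\<theta> a = ?\<theta> b"
      obtain w g h where a': "a = (w, (g, h))" "w \<in> Obj G" "g \<in> Hom G w x" "h \<in> Hom G x w" using a by auto
      obtain g' h' where b': "b = (w, (g', h'))" "g' \<in> Hom G w x" "h' \<in> Hom G x w" using b eq a' by auto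
      have "Comp G w x x f g = Comp G w x x f g'" and h: "Comp G x x w h ?fi = Comp G x x w h' ?fi"
        using eq a' b' by auto
      then have "g = g'"
        using inj_onD[OF bij_betw_imp_inj_on[OF Comp_bij[OF x x f a'(2)]]] a' b' by blast
      have cancel: "k = Comp G x x w (Comp G x x w k ?fi) f" if k: "k \<in> Hom G x w" for k
        using Comp_assoc[OF x x x a'(2) f fi(1) k] k x a'(2) by (simp add: fi Comp_Id)
      have "h = h'" using cancel[OF a'(4)] cancel[OF b'(3)] h by simp
      with \<open>g = g'\<close> show "a = b" using a' b' by simp
    qed
    moreover have "?\<theta> ` ?B \<subseteq> ?B" using x f fi by (auto intro: Comp_in)
    moreover have gi: "(z, (g, ginv z x g)) \<in> ?B" using z g ginv[OF z x g] by simp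
    ultimately have "free_lift K (free_module K ?B) (\<lambda>b. basis_elt K (?\<theta> b)) u (?\<theta> (z, (g, ginv z x g))) = u (z, (g, ginv z x g))"
      by (rule free_lift_reindex_apply[OF cring_K _ _ u'])
    then have "u (?\<theta> (z, (g, ginv z x g))) = u (z, (g, ginv z x g))" unfolding u_eq[symmetric] .
    then show ?thesis using ginv_Comp(2)[OF x x z f g] by simp
  qed
  have const: "u (z, (g', ginv z x g')) = u (z, (g, ginv z x g))"
    if z: "z \<in> Obj G" and g: "g \<in> Hom G z x" and g': "g' \<in> Hom G z x" for z g g'
  proof -
    \<comment> \<open>The loop g' g^-1 carries \<open>g\<close> to \<open>g'\<close>, so a single
      conjugation links any two arrows from z to x.\<close>
    let ?f = "Comp G x z x g' (ginv z x g)"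
    note gi = ginv[OF z x g]
    have f: "?f \<in> Hom G x x" by (rule Comp_in[OF x z x gi(1) g'])
    have "Comp G z x x ?f g = g'"
      using Comp_assoc[OF z x z x g gi(1) g'] z x g' by (simp add: gi Comp_Id)
    then show ?thesis using shift[OF f z g] by simp
  qed
  let ?\<theta> = "\<lambda>(z, g, h). Comp G x z x g h"
  \<comment> \<open>The triples of the support that contribute to the coefficient of 1_x in
    \<open>one\<close>; they have the form (z, g, g^-1).\<close>
  define S where "S = {b. u b \<noteq> \<zero>\<^bsub>K\<^esub> \<and> ?\<theta> b = Id G x}"
  have fin: "finite {b. u b \<noteq> \<zero>\<^bsub>K\<^esub>}" and supp: "{b. u b \<noteq> \<zero>\<^bsub>K\<^esub>} \<subseteq> ?B"
    using u' by (auto simp: carrier_free_module)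
  have finS: "finite S" using fin by (rule rev_finite_subset) (auto simp: S_def)
  note uK = free_moduleD(1)[OF u']
  have SE: "\<exists>z g. z \<in> Obj G \<and> g \<in> Hom G z x \<and> b = (z, (g, ginv z x g)) \<and> u (z, (g, ginv z x g)) \<noteq> \<zero>\<^bsub>K\<^esub>"
    if "b \<in> S" for b
  proof -
    from that have ub: "u b \<noteq> \<zero>\<^bsub>K\<^esub>" "?\<theta> b = Id G x" by (auto simp: S_def)
    then obtain z g h where b: "b = (z, (g, h))" "z \<in> Obj G" "g \<in> Hom G z x" "h \<in> Hom G x z" using supp by blast
    then have "h = ginv z x g" using ub by (intro ginv_unique x) auto
    then show ?thesis using b ub by blast
  qed
  have SI: "(z, (g, ginv z x g)) \<in> S"
    if "z \<in> Obj G" "g \<in> Hom G z x" "u (z, (g, ginv z x g)) \<noteq> \<zero>\<^bsub>K\<^esub>" for z g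
    using that ginv(3)[OF _ x] by (simp add: S_def)
  have sum_one: "(\<Oplus>\<^bsub>K\<^esub>b\<in>S. u b) = \<one>\<^bsub>K\<^esub>"
  proof -
    let ?F = "FH x x"
    let ?t = "\<lambda>b. u b \<odot>\<^bsub>?F\<^esub> basis_elt K (?\<theta> b)"
    have "basis_elt K (?\<theta> b) \<in> carrier ?F" if ub: "u b \<noteq> \<zero>\<^bsub>K\<^esub>" for b
    proof -
      obtain z g h where "b = (z, (g, h))" "z \<in> Obj G" "g \<in> Hom G z x" "h \<in> Hom G x z" using supp ub by blast
      then show ?thesis using x by (auto intro!: basis_FH Comp_in)
    qed
    then have t: "?t \<in> {b. u b \<noteq> \<zero>\<^bsub>K\<^esub>} \<rightarrow> carrier ?F"
      using module.smult_closed[OF FH uK] by blast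
    have "\<one>\<^bsub>K\<^esub> = free_lift K ?F (\<lambda>b. basis_elt K (?\<theta> b)) u (Id G x)"
      using one by (simp add: basis_elt_def case_prod_unfold)
    also have "\<dots> = (\<Oplus>\<^bsub>K\<^esub>b\<in>{b. u b \<noteq> \<zero>\<^bsub>K\<^esub>}. ?t b (Id G x))"
      unfolding free_lift_def by (rule finsum_free_module_apply[OF cring_K fin t])
    also have "\<dots> = (\<Oplus>\<^bsub>K\<^esub>b\<in>S. u b)"
      using fin uK unfolding S_def
      by (intro K.add.finprod_mono_neutral_cong_right) (auto simp: basis_elt_def)
    finally show ?thesis by simp
  qed
  then have "S \<noteq> {}" using K.one_not_zero by auto
  then obtain z0 g0 where z0: "z0 \<in> Obj G" and g0: "g0 \<in> Hom G z0 x" and u0: "u (z0, (g0, ginv z0 x g0)) \<noteq> \<zero>\<^bsub>K\<^esub>"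
    using SE by (metis ex_in_conv)
  \<comment> \<open>By \<open>const\<close>, one nonzero coefficient over \<open>z\<close> makes all
    coefficients at (z, g', g'^-1) nonzero, so this part of the finite set \<open>S\<close> is a
    full copy of \<open>Hom G z x\<close>.\<close>
  have fiber: "{b \<in> S. fst b = z} = (\<lambda>g. (z, (g, ginv z x g))) ` Hom G z x" if "z \<in> fst ` S" for z
  proof -
    from that obtain b where "b \<in> S" "z = fst b" by blast
    from SE[OF this(1)] this(2) obtain g
      where z: "z \<in> Obj G" and g: "g \<in> Hom G z x" and nz: "u (z, (g, ginv z x g)) \<noteq> \<zero>\<^bsub>K\<^esub>"
      by auto
    show ?thesis
    proof (intro equalityI subsetI)
      fix c assume "c \<in> {b \<in> S. fst b = z}"
      then have "c \<in> S" and "fst c = z" by auto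
      from SE[OF this(1)] this(2) show "c \<in> (\<lambda>g. (z, (g, ginv z x g))) ` Hom G z x" by auto
    next
      fix c assume "c \<in> (\<lambda>g. (z, (g, ginv z x g))) ` Hom G z x"
      then obtain g' where g': "g' \<in> Hom G z x" and c: "c = (z, (g', ginv z x g'))" by blast
      have "u (z, (g', ginv z x g')) \<noteq> \<zero>\<^bsub>K\<^esub>" using const[OF z g g'] nz by simp
      from SI[OF z g' this] show "c \<in> {b \<in> S. fst b = z}" using c by simp
    qed
  qed
  have inj: "inj_on (\<lambda>g. (z, (g, ginv z x g))) A" for z A by (auto simp: inj_on_def)
  have z0S: "z0 \<in> fst ` S" using imageI[OF SI[OF z0 g0 u0], of fst] by simp
  have fin0: "finite (Hom G z0 x)"
  proof (rule finite_imageD[OF _ inj])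
    have "finite {b \<in> S. fst b = z0}" using finS by simp
    then show "finite ((\<lambda>g. (z0, (g, ginv z0 x g))) ` Hom G z0 x)" unfolding fiber[OF z0S] .
  qed
  show finH: "finite (Hom G x x)" using Hom_loops(1)[OF x z0] g0 fin0 by blast
  show "ord_Hom x x \<in> Units K"
  proof (rule ccontr)
    assume "ord_Hom x x \<notin> Units K"
    then have n0: "ord_Hom x x = \<zero>\<^bsub>K\<^esub>" by (simp add: K.field_Units)
    \<comment> \<open>Over \<open>z\<close> the coefficients are constant, so they add up to |G(z,
      x)| = |G(x, x)| times their common value, which is zero under the assumption.\<close>
    have inner: "(\<Oplus>\<^bsub>K\<^esub>b\<in>{b \<in> S. fst b = z}. u b) = \<zero>\<^bsub>K\<^esub>" if zS: "z \<in> fst ` S" for z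
    proof -
      from zS obtain b where "b \<in> S" "z = fst b" by blast
      from SE[OF this(1)] this(2) obtain g where z: "z \<in> Obj G" and g: "g \<in> Hom G z x" by auto
      have "(\<Oplus>\<^bsub>K\<^esub>b\<in>{b \<in> S. fst b = z}. u b) = (\<Oplus>\<^bsub>K\<^esub>g'\<in>Hom G z x. u (z, (g', ginv z x g')))"
        unfolding fiber[OF zS] using uK by (intro K.add.finprod_reindex inj) auto
      also have "\<dots> = (\<Oplus>\<^bsub>K\<^esub>g'\<in>Hom G z x. u (z, (g, ginv z x g)))"
        using uK const[OF z g] by (intro K.add.finprod_cong') auto
      also have "\<dots> = [card (Hom G z x)] \<cdot>\<^bsub>K\<^esub> u (z, (g, ginv z x g))"
        by (rule K.add.finprod_const[OF uK])
      also have "\<dots> = (ord_Hom x x) \<otimes>\<^bsub>K\<^esub> u (z, (g, ginv z x g))"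
      proof -
        have "Hom G z x \<noteq> {}" using g by blast
        then show ?thesis using Hom_loops(2)[OF x z] uK K.add_pow_ldistr[OF K.one_closed uK] by simp
      qed
      finally show ?thesis using n0 uK by simp
    qed
    \<comment> \<open>Grouping \<open>S\<close> by first components makes the whole sum zero,
      against \<open>sum_one\<close>.\<close>
    have "(\<Oplus>\<^bsub>K\<^esub>b\<in>S. u b) = (\<Oplus>\<^bsub>K\<^esub>b\<in>(\<Union>z\<in>fst ` S. {b \<in> S. fst b = z}). u b)"
      by (rule arg_cong[where f = "finsum K u"]) auto
    also have "\<dots> = (\<Oplus>\<^bsub>K\<^esub>z\<in>fst ` S. (\<Oplus>\<^bsub>K\<^esub>b\<in>{b \<in> S. fst b = z}. u b))"
      using finS uK by (intro K.add.finprod_UN_disjoint) (auto simp: pairwise_def disjnt_def)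
    also have "\<dots> = (\<Oplus>\<^bsub>K\<^esub>z\<in>fst ` S. \<zero>\<^bsub>K\<^esub>)"
      using inner by (intro K.add.finprod_cong') auto
    also have "\<dots> = \<zero>\<^bsub>K\<^esub>" by simp
    finally show False using sum_one by simp
  qed
qed

text \<open>The element u = psi (s 1_x) of the diagonal bimodule is fixed by conjugation, since f
  1_x f^-1 = 1_x and both maps are natural, and it lies over 1_x, since pi psi = e and e s =
  1.\<close>

lemma section_imp_invertible:
  fixes P :: "('k, 'o, 'a \<Rightarrow> 'k, 'm) bimod"
  assumes small: "small_in TYPE('m) K G" and P: "projective_dmod K D P"
    and e: "e \<in> nat_trans K D P C" and s: "s \<in> nat_trans K D C P"
    and es: "\<And>p a. \<lbrakk>p \<in> LObj D; a \<in> carrier (FObj C p)\<rbrakk> \<Longrightarrow> e p (s p a) = a"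
    and x: "x \<in> Obj G"
  shows "finite (Hom G x x)" and "ord_Hom x x \<in> Units K"
proof -
  have inf: "infinite (UNIV :: 'm set)" and Ks: "carrier K \<lesssim> (UNIV :: 'm set)" and Os: "Obj G \<lesssim> (UNIV :: 'm set)"
    and Hs: "\<And>x y. \<lbrakk>x \<in> Obj G; y \<in> Obj G\<rbrakk> \<Longrightarrow> Hom G x y \<lesssim> (UNIV :: 'm set)"
    using small by (auto simp: small_in_def)
  obtain \<pi> where \<pi>: "\<pi> \<in> nat_trans K D diag_dmod C" "dmod_epi D diag_dmod C \<pi>"
    and \<pi>_basis: "\<And>x y z g h. \<lbrakk>x \<in> Obj G; y \<in> Obj G; z \<in> Obj G; g \<in> Hom G z x; h \<in> Hom G y z\<rbrakk>
      \<Longrightarrow> \<pi> (x, y) (basis_elt K (z, (g, h))) = basis_elt K (Comp G y z x g h)"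
    using diag_epi by blast
  have sQ: "carrier (FObj diag_dmod p) \<lesssim> (UNIV :: 'm set)" if "p \<in> LObj D" for p
    using that unfolding LObj_D
    by (auto simp: FObj_diag intro!: free_module_lepoll Sigma_lepoll_UNIV inf Ks Os Hs)
  have sC: "carrier (FObj C p) \<lesssim> (UNIV :: 'm set)" if "p \<in> LObj D" for p
    using that unfolding LObj_D by (auto simp: FObj_C intro!: free_module_lepoll inf Ks Hs)
  \<comment> \<open>The diagonal and the regular bimodule have elements outside 'm; the bounds
    \<open>sQ\<close> and \<open>sC\<close> make projectivity of \<open>P\<close> applicable to
    them.\<close>
  obtain \<psi> where \<psi>: "\<psi> \<in> nat_trans K D P diag_dmod"
    and \<pi>\<psi>: "\<And>p v. \<lbrakk>p \<in> LObj D; v \<in> carrier (FObj P p)\<rbrakk> \<Longrightarrow> \<pi> p (\<psi> p v) = e p v"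
    by (rule D.projective_lift[OF P diag_dmod sQ regular_bimodule sC \<pi> e]) blast+
  have xx: "(x, x) \<in> LObj D" using x by (simp add: LObj_D)
  have id: "basis_elt K (Id G x) \<in> carrier (FObj C (x, x))" using basis_FH[OF Id_in[OF x]] by (simp add: FObj_C)
  define v where "v = s (x, x) (basis_elt K (Id G x))"
  define u where "u = \<psi> (x, x) v"
  have v: "v \<in> carrier (FObj P (x, x))" unfolding v_def by (rule D.nat_trans_closed[OF s xx id])
  have u: "u \<in> carrier (FObj diag_dmod (x, x))" unfolding u_def by (rule D.nat_trans_closed[OF \<psi> xx v])
  have inv: "FMor diag_dmod (x, x) (x, x) (env_basis (x, x) (x, x) (f, ginv x x f)) u = u" if f: "f \<in> Hom G x x" for f
  proof -
    note fi = ginv[OF x x f]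
    have "(f, ginv x x f) \<in> Hom (enveloping_cat G) (x, x) (x, x)" using f fi by simp
    note \<beta> = D.basis_closed[OF xx xx this]
    have "FMor C (x, x) (x, x) (env_basis (x, x) (x, x) (f, ginv x x f)) (basis_elt K (Id G x)) = basis_elt K (Id G x)"
      using FMor_C[OF x x x x f fi(1) Id_in[OF x]] x fi by (simp add: Id_Comp)
    then show ?thesis
      unfolding u_def v_def
      using D.nat_trans_natural[OF \<psi> xx xx \<beta> v] D.nat_trans_natural[OF s xx xx \<beta> id] by (simp add: v_def)
  qed
  have one: "free_lift K (FH x x) (\<lambda>(z, g, h). basis_elt K (Comp G x z x g h)) u = basis_elt K (Id G x)"
  proof -
    have u': "u \<in> carrier (free_module K (SIGMA z:Obj G. Hom G z x \<times> Hom G x z))" using u by (simp add: FObj_diag)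
    have lin: "is_linear K (free_module K (SIGMA z:Obj G. Hom G z x \<times> Hom G x z)) (FH x x) (\<pi> (x, x))"
      using D.nat_trans_linear[OF \<pi>(1) xx] by (simp add: FObj_diag FObj_C)
    have "basis_elt K (Id G x) = \<pi> (x, x) u"
      using \<pi>\<psi>[OF xx v] es[OF xx id] by (simp add: u_def v_def)
    also have "\<dots> = free_lift K (FH x x) (\<lambda>b. \<pi> (x, x) (basis_elt K b)) u"
      by (rule linear_free_lift[OF FH lin u'])
    also have "\<dots> = free_lift K (FH x x) (\<lambda>(z, g, h). basis_elt K (Comp G x z x g h)) u"
      by (rule free_lift_cong[OF _ FH _ u']) (use x \<pi>_basis in \<open>auto intro!: basis_FH Comp_in\<close>)
    finally show ?thesis by simp
  qed
  show "finite (Hom G x x)" "ord_Hom x x \<in> Units K"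
    by (rule conjugation_invariant[OF x u inv one]; assumption)+
qed

end

text \<open>An empty Hom set has order 0, which is no unit of a field; the condition is therefore
  placed on pairs of objects in one connected component.\<close>

theorem corollary2p6:
  fixes K :: "('k, 'c) ring_scheme" and G :: "('o, 'a) cat"
  assumes "field K" and "small_groupoid G"
    and "small_in TYPE('m) K G"
  shows "separable TYPE('m) K (linearization K G) \<longleftrightarrow>
    (\<forall>x\<in>Obj G. \<forall>y\<in>Obj G. Hom G x y \<noteq> {} \<longrightarrow>
      finite (Hom G x y) \<and> [card (Hom G x y)] \<cdot>\<^bsub>K\<^esub> \<one>\<^bsub>K\<^esub> \<in> Units K)"
proof -
  interpret small_groupoid G by fact
  interpret groupoid_linearization G K
    by (intro groupoid_linearization.intro category_linearization.intro category_linearization_axioms.intro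
        small_category_axioms small_groupoid_axioms assms(1))
  have inf: "infinite (UNIV :: 'm set)" and Ks: "carrier K \<lesssim> (UNIV :: 'm set)" and Os: "Obj G \<lesssim> (UNIV :: 'm set)"
    and Hs: "\<And>x y. \<lbrakk>x \<in> Obj G; y \<in> Obj G\<rbrakk> \<Longrightarrow> Hom G x y \<lesssim> (UNIV :: 'm set)"
    using assms(3) by (auto simp: small_in_def)
  have small: "small_linearized_category TYPE('m) K D (enveloping_cat G) env_basis env_coord"
    by (intro small_linearized_category.intro env_linearized small_linearized_category_axioms.intro)
      (auto simp: LObj_D intro!: inf Ks Sigma_lepoll_UNIV Os Hs)
  have sC: "carrier (FObj C p) \<lesssim> (UNIV :: 'm set)" if "p \<in> LObj D" for p
    using that unfolding LObj_D by (auto simp: FObj_C intro!: free_module_lepoll inf Ks Hs)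
  \<comment> \<open>The same choice as inside \<open>Ext\<close>; the existence of resolutions in
    the universe 'm ensures that it picks a genuine one.\<close>
  define R where "R = (SOME R :: ('k, 'o \<times> 'o, (('a \<Rightarrow> 'k) \<times> ('a \<Rightarrow> 'k) \<Rightarrow> 'k) set, 'm, 'a \<Rightarrow> 'k) resolution.
    projective_resolution K D C R)"
  have R: "projective_resolution K D C R"
    unfolding R_def
    by (rule someI_ex[OF small_linearized_category.projective_resolution_exists[OF small regular_bimodule sC]])
  note RD = D.projective_resolutionD[OF R]
  have "separable TYPE('m) K L \<longleftrightarrow>
      (\<exists>s \<in> nat_trans K D C (rterm R 0). \<forall>p\<in>LObj D. \<forall>a\<in>carrier (FObj C p). raug R p (s p a) = a)"
    using D.Ext1_vanishes_iff_splits[OF R[unfolded R_def] regular_bimodule]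
    unfolding separable_def HM_cohomology_def R_def[symmetric] .
  also have "\<dots> \<longleftrightarrow> (\<forall>x\<in>Obj G. \<forall>y\<in>Obj G. Hom G x y \<noteq> {} \<longrightarrow>
      finite (Hom G x y) \<and> [card (Hom G x y)] \<cdot>\<^bsub>K\<^esub> \<one>\<^bsub>K\<^esub> \<in> Units K)"
  proof
    assume "\<exists>s \<in> nat_trans K D C (rterm R 0). \<forall>p\<in>LObj D. \<forall>a\<in>carrier (FObj C p). raug R p (s p a) = a"
    then obtain s where s: "s \<in> nat_trans K D C (rterm R 0)"
      and es: "\<And>p a. \<lbrakk>p \<in> LObj D; a \<in> carrier (FObj C p)\<rbrakk> \<Longrightarrow> raug R p (s p a) = a" by blast
    \<comment> \<open>This settles loops; \<open>Hom_loops\<close> moves the result to every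
      nonempty Hom set.\<close>
    note inv = section_imp_invertible[OF assms(3) RD(2,4) s es]
    show "\<forall>x\<in>Obj G. \<forall>y\<in>Obj G. Hom G x y \<noteq> {} \<longrightarrow>
        finite (Hom G x y) \<and> [card (Hom G x y)] \<cdot>\<^bsub>K\<^esub> \<one>\<^bsub>K\<^esub> \<in> Units K"
    proof (intro ballI impI)
      fix x y assume *: "x \<in> Obj G" "y \<in> Obj G" "Hom G x y \<noteq> {}"
      show "finite (Hom G x y) \<and> [card (Hom G x y)] \<cdot>\<^bsub>K\<^esub> \<one>\<^bsub>K\<^esub> \<in> Units K"
        using Hom_loops[OF *(2,1,3)] inv[OF _ _ *(2)] by simp
    qed
  next
    assume "\<forall>x\<in>Obj G. \<forall>y\<in>Obj G. Hom G x y \<noteq> {} \<longrightarrow>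
      finite (Hom G x y) \<and> [card (Hom G x y)] \<cdot>\<^bsub>K\<^esub> \<one>\<^bsub>K\<^esub> \<in> Units K"
    then show "\<exists>s \<in> nat_trans K D C (rterm R 0). \<forall>p\<in>LObj D. \<forall>a\<in>carrier (FObj C p). raug R p (s p a) = a"
      by (intro averaging_section RD) auto
  qed
  finally show ?thesis .
qed

end
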